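(* Consider a family of $k$-local Hamiltonians $H$ on $D$-dimensional cubic lattices $\Lambda$ with $N$ sites ($N\to\infty$), and let $\beta$ be an inverse temperature for which the Gibbs state $g_\beta(H)$ has exponential decay of correlations, energy standard deviation $\sigma\ge\Omega(\sqrt N)$, and Berry--Esseen error $\zeta_N\le\tilde O(N^{-1/2-\kappa})$ for some $\kappa\ge 0$. Let $\alpha\in[0,1)$ and let $\omega=\omega(E,\Delta,\delta,\mathbf q)$ be a generalized micro-canonical ensemble (GmE) whose bins all have equal width $\delta$, such that $$e^{\Delta^2/\sigma^2}\le \tilde O\!\left(N^{\frac{1-\alpha}{D+1}}\right),\qquad \Omega\!\left(N^{\frac{1-\alpha}{D+1}-\kappa}\right)\le\delta\le\sigma,\qquad |E-E_\beta|\le\sigma,$$ where $E_\beta=\mathrm{tr}(g_\beta(H)H)$. Then there are constants $\gamma_1,\gamma_2>0$ depending only on $D$, and system-size independent (i.e. $N$-independent) constants $C_1,C_2>0$, such that for every side length $l$ with $l^D\le C_1N^{\frac{1}{D+1}-\gamma_1\alpha}$, $$D_l(\omega,g_\beta(H))\le C_2N^{-\gamma_2\alpha}.$$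
   Context: Setting: $\Lambda$ is a cubic $D$-dimensional lattice with $N$ sites; each site carries a Hilbert space of dimension $d$. $d,D,k,\beta$ are fixed, independent of $N$. $\mathrm d(\cdot,\cdot)$ is the Manhattan distance. A $k$-local Hamiltonian is $H=\sum_{i\in\Lambda}h_i$, where $h_i$ is Hermitian with operator norm $1$ and supported only on sites $j$ with $\mathrm d(i,j)\le k$. Spectral decomposition: $H=\sum_\nu E_\nu P_\nu$, assumed non-degenerate ($\mathrm{tr}(P_\nu)=1$ for all $\nu$). Asymptotics: $O,\Omega$ are with respect to $N\to\infty$, with constants independent of $N$; $f=\tilde O(g)$ means $f(N)=O(\log^r(N)\,g(N))$ for some $r$. "System-size independent" constants may depend on the constants in the hypotheses but not on $N$. Gibbs state: $g_\beta(H)=e^{-\beta H}/\mathrm{tr}(e^{-\beta H})$. Energy standard deviation: $\sigma^2=\mathrm{tr}(g_\beta(H)H^2)-\mathrm{tr}(g_\beta(H)H)^2$. Exponential decay of correlations of a state $\rho$: for some $\xi>0$ (independent of $N$), for any regions $X,Y\subset\Lambda$ and operators $A,B$ supported on $X,Y$ respectively, $|\mathrm{tr}(\rho AB)-\mathrm{tr}(\rho A)\mathrm{tr}(\rho B)|\le\|A\|\|B\|e^{-\mathrm d(X,Y)/\xi}$. Berry--Esseen error: $\zeta_N=\sup_x|\mathrm{tr}(g_\beta(H)\Pi_x)-G(x)|$, where $\Pi_x$ is the projector onto all eigenstates of $H$ with energy smaller than $x$ and $G$ is the cumulative distribution function of the Gaussian with the same mean $\mathrm{tr}(g_\beta(H)H)$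 and variance $\sigma^2$. GmE: the energy window $[E-\Delta,E+\Delta]$, $\Delta>0$, is divided into $K$ bins, here all of width $\delta$. A generalized micro-canonical ensemble is a state $\omega=\sum_{k=1}^Kq_k\,\omega_{\delta_k}$, where $\omega_{\delta_k}$ is the maximally mixed state on the span of the eigenstates of $H$ with energy in the $k$-th bin, and $\mathbf q=(q_1,\dots,q_K)$ is a probability vector. Local distance: $D_l(\rho,\tau)=\frac1{|\mathcal C_l|}\sum_{C\in\mathcal C_l}\|\rho_C-\tau_C\|_1$, where $\mathcal C_l$ is the set of all hypercubes of side length $l$ in $\Lambda$, $\rho_C$ is the reduced state on $C$, and $\|\cdot\|_1$ is the trace norm. *)

theory Defs
  imports
    "HOL-Probability.Probability"
    "HOL-Library.Landau_Symbols"
    "Jordan_Normal_Form.Schur_Decomposition"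
    "Jordan_Normal_Form.Spectral_Radius"
begin

definition mat_trace :: "complex mat \<Rightarrow> complex" where
  "mat_trace A = (\<Sum>i<dim_row A. A $$ (i, i))"

definition mat_sum :: "nat \<Rightarrow> ('i \<Rightarrow> complex mat) \<Rightarrow> 'i set \<Rightarrow> complex mat" where
  "mat_sum n f I = mat n n (\<lambda>(x, y). \<Sum>i\<in>I. f i $$ (x, y))"

definition mat_exp :: "complex mat \<Rightarrow> complex mat" where
  "mat_exp A = mat (dim_row A) (dim_row A) (\<lambda>(x, y). \<Sum>m. (A ^\<^sub>m m) $$ (x, y) / fact m)"

definition hermitian_mat :: "complex mat \<Rightarrow> bool" where
  "hermitian_mat A \<longleftrightarrow> square_mat A \<and> mat_adjoint A = A"

definition euclid_norm :: "complex vec \<Rightarrow> real" where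
  "euclid_norm v = sqrt (\<Sum>i<dim_vec v. (cmod (v $ i))\<^sup>2)"

definition op_norm :: "complex mat \<Rightarrow> real" where
  "op_norm A = (SUP v\<in>{v \<in> carrier_vec (dim_col A). euclid_norm v = 1}. euclid_norm (A *\<^sub>v v))"

definition psd_mat :: "complex mat \<Rightarrow> bool" where
  "psd_mat A \<longleftrightarrow> hermitian_mat A \<and> (\<forall>v\<in>carrier_vec (dim_row A). 0 \<le> Re ((A *\<^sub>v v) \<bullet>c v))"

definition psd_sqrt :: "complex mat \<Rightarrow> complex mat" where
  "psd_sqrt A = (THE B. B \<in> carrier_mat (dim_row A) (dim_row A) \<and> psd_mat B \<and> B * B = A)"

definition trace_norm :: "complex mat \<Rightarrow> real" where
  "trace_norm A = Re (mat_trace (psd_sqrt (mat_adjoint A * A)))"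

definition orth_proj :: "nat \<Rightarrow> complex vec set \<Rightarrow> complex mat" where
  "orth_proj n W = (THE P. P \<in> carrier_mat n n \<and> P * P = P \<and> mat_adjoint P = P
                           \<and> (\<lambda>v. P *\<^sub>v v) ` carrier_vec n = W)"

definition spec_proj :: "complex mat \<Rightarrow> real set \<Rightarrow> complex mat" where
  "spec_proj H S = orth_proj (dim_row H)
     (LinearCombinations.module.span class_ring (module_vec TYPE(complex) (dim_row H))
        {v. \<exists>e\<in>S. eigenvector H v (complex_of_real e)})"

definition nondegenerate :: "complex mat \<Rightarrow> bool" where
  "nondegenerate H \<longleftrightarrow>
     (\<forall>e. eigenvalue H (complex_of_real e) \<longrightarrow> mat_trace (spec_proj H {e}) = 1)"

text \<open>
  Sites of the cubic lattice of side length \<open>L\<close> in dimension \<open>D\<close> are the numbers below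
  \<open>N = L ^ D\<close>: the \<open>a\<close>-th coordinate (\<open>a < D\<close>) of site \<open>i\<close> is its \<open>a\<close>-th digit in base \<open>L\<close>.
  Likewise the product basis of the space of dimension \<open>d ^ N\<close> is indexed by the numbers
  \<open>x < d ^ N\<close>: site \<open>i\<close> is in its local basis state number \<open>digit d x i\<close>.
\<close>

definition digit :: "nat \<Rightarrow> nat \<Rightarrow> nat \<Rightarrow> nat" where
  "digit b x i = (x div b ^ i) mod b"

definition site_dist :: "nat \<Rightarrow> nat \<Rightarrow> nat \<Rightarrow> nat \<Rightarrow> nat" where
  "site_dist D L i j = (\<Sum>a<D. nat \<bar>int (digit L i a) - int (digit L j a)\<bar>)"

definition region_dist :: "nat \<Rightarrow> nat \<Rightarrow> nat set \<Rightarrow> nat set \<Rightarrow> nat" where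
  "region_dist D L X Y = Min ((\<lambda>(i, j). site_dist D L i j) ` (X \<times> Y))"

definition hypercubes :: "nat \<Rightarrow> nat \<Rightarrow> nat \<Rightarrow> nat set set" where
  "hypercubes D L l =
     {{i. i < L ^ D \<and> (\<forall>a<D. c a \<le> digit L i a \<and> digit L i a < c a + l)} | c. \<forall>a<D. c a + l \<le> L}"

text \<open>
  \<open>restrict_conf d X x\<close> is the index, in the product basis of the region \<open>X\<close> (sites in increasing
  order), of the restriction to \<open>X\<close> of the basis state \<open>x\<close>.
\<close>

definition restrict_conf :: "nat \<Rightarrow> nat set \<Rightarrow> nat \<Rightarrow> nat" where
  "restrict_conf d X x = (\<Sum>j<card X. digit d x (sorted_list_of_set X ! j) * d ^ j)"

definition agree_off :: "nat \<Rightarrow> nat \<Rightarrow> nat set \<Rightarrow> nat \<Rightarrow> nat \<Rightarrow> bool" where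
  "agree_off d N X x y \<longleftrightarrow> (\<forall>i<N. i \<notin> X \<longrightarrow> digit d x i = digit d y i)"

text \<open>\<open>extend_op d N X B\<close> is \<open>B\<close> on the region \<open>X\<close> tensored with the identity on the other sites.\<close>

definition extend_op :: "nat \<Rightarrow> nat \<Rightarrow> nat set \<Rightarrow> complex mat \<Rightarrow> complex mat" where
  "extend_op d N X B = mat (d ^ N) (d ^ N)
     (\<lambda>(x, y). if agree_off d N X x y then B $$ (restrict_conf d X x, restrict_conf d X y) else 0)"

definition supported_on :: "nat \<Rightarrow> nat \<Rightarrow> nat set \<Rightarrow> complex mat \<Rightarrow> bool" where
  "supported_on d N X A \<longleftrightarrow> A \<in> extend_op d N X ` carrier_mat (d ^ card X) (d ^ card X)"

text \<open>Partial trace over the complement of \<open>X\<close>.\<close>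

definition reduced_state :: "nat \<Rightarrow> nat \<Rightarrow> nat set \<Rightarrow> complex mat \<Rightarrow> complex mat" where
  "reduced_state d N X \<rho> = mat (d ^ card X) (d ^ card X)
     (\<lambda>(s, t). \<Sum>(x, y)\<in>{(x, y). x < d ^ N \<and> y < d ^ N \<and> restrict_conf d X x = s
                                 \<and> restrict_conf d X y = t \<and> agree_off d N X x y}. \<rho> $$ (x, y))"

definition local_distance ::
  "nat \<Rightarrow> nat \<Rightarrow> nat \<Rightarrow> nat \<Rightarrow> complex mat \<Rightarrow> complex mat \<Rightarrow> real" where
  "local_distance d D L l \<rho> \<tau> =
     1 / real (card (hypercubes D L l)) *
     (\<Sum>C\<in>hypercubes D L l.
        trace_norm (reduced_state d (L ^ D) C \<rho> - reduced_state d (L ^ D) C \<tau>))"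

definition local_terms :: "nat \<Rightarrow> nat \<Rightarrow> nat \<Rightarrow> nat \<Rightarrow> (nat \<Rightarrow> complex mat) \<Rightarrow> bool" where
  "local_terms d D L k h \<longleftrightarrow>
     (\<forall>i<L ^ D. hermitian_mat (h i) \<and> op_norm (h i) = 1 \<and>
                supported_on d (L ^ D) {j. j < L ^ D \<and> site_dist D L i j \<le> k} (h i))"

definition hamiltonian :: "nat \<Rightarrow> nat \<Rightarrow> (nat \<Rightarrow> complex mat) \<Rightarrow> complex mat" where
  "hamiltonian d N h = mat_sum (d ^ N) h {..<N}"

definition exp_decay_correlations ::
  "nat \<Rightarrow> nat \<Rightarrow> nat \<Rightarrow> real \<Rightarrow> complex mat \<Rightarrow> bool" where
  "exp_decay_correlations d D L \<xi> \<rho> \<longleftrightarrow>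
     (\<forall>X Y A B. X \<subseteq> {..<L ^ D} \<and> Y \<subseteq> {..<L ^ D} \<and> X \<noteq> {} \<and> Y \<noteq> {} \<and>
        supported_on d (L ^ D) X A \<and> supported_on d (L ^ D) Y B \<longrightarrow>
        cmod (mat_trace (\<rho> * A * B) - mat_trace (\<rho> * A) * mat_trace (\<rho> * B))
          \<le> op_norm A * op_norm B * exp (- real (region_dist D L X Y) / \<xi>))"

definition gibbs_state :: "real \<Rightarrow> complex mat \<Rightarrow> complex mat" where
  "gibbs_state \<beta> H =
     (1 / mat_trace (mat_exp (complex_of_real (- \<beta>) \<cdot>\<^sub>m H))) \<cdot>\<^sub>m mat_exp (complex_of_real (- \<beta>) \<cdot>\<^sub>m H)"

definition gibbs_energy :: "real \<Rightarrow> complex mat \<Rightarrow> real" where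
  "gibbs_energy \<beta> H = Re (mat_trace (gibbs_state \<beta> H * H))"

definition gibbs_sd :: "real \<Rightarrow> complex mat \<Rightarrow> real" where
  "gibbs_sd \<beta> H =
     sqrt (Re (mat_trace (gibbs_state \<beta> H * (H * H))) - (Re (mat_trace (gibbs_state \<beta> H * H)))\<^sup>2)"

definition gaussian_cdf :: "real \<Rightarrow> real \<Rightarrow> real \<Rightarrow> real" where
  "gaussian_cdf \<mu> \<sigma> x = cdf (density lborel (\<lambda>y. ennreal (normal_density \<mu> \<sigma> y))) x"

definition berry_esseen_error :: "real \<Rightarrow> complex mat \<Rightarrow> real" where
  "berry_esseen_error \<beta> H =
     (SUP x. \<bar>Re (mat_trace (gibbs_state \<beta> H * spec_proj H {..<x}))
              - gaussian_cdf (gibbs_energy \<beta> H) (gibbs_sd \<beta> H) x\<bar>)"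

text \<open>
  Partition of the window into \<open>K\<close> consecutive intervals of width \<open>\<delta>\<close>. To which of the two adjacent
  bins a common end point belongs is left open.
\<close>

definition equal_bins :: "real \<Rightarrow> real \<Rightarrow> real \<Rightarrow> nat \<Rightarrow> (nat \<Rightarrow> real set) \<Rightarrow> bool" where
  "equal_bins E \<Delta> \<delta> K b \<longleftrightarrow>
     0 < \<Delta> \<and> 0 < \<delta> \<and> real K * \<delta> = 2 * \<Delta> \<and>
     (\<forall>j<K. {E - \<Delta> + real j * \<delta> <..< E - \<Delta> + real (Suc j) * \<delta>} \<subseteq> b j \<and>
            b j \<subseteq> {E - \<Delta> + real j * \<delta> .. E - \<Delta> + real (Suc j) * \<delta>}) \<and>
     disjoint_family_on b {..<K} \<and> (\<Union>j<K. b j) = {E - \<Delta> .. E + \<Delta>}"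

definition max_mixed :: "complex mat \<Rightarrow> real set \<Rightarrow> complex mat" where
  "max_mixed H S = (1 / mat_trace (spec_proj H S)) \<cdot>\<^sub>m spec_proj H S"

text \<open>
  The state \<open>max_mixed H (b j)\<close> exists only if bin \<open>j\<close> contains an eigenvalue, so other bins
  must have weight 0.
\<close>

definition gme_weights :: "complex mat \<Rightarrow> nat \<Rightarrow> (nat \<Rightarrow> real set) \<Rightarrow> (nat \<Rightarrow> real) \<Rightarrow> bool" where
  "gme_weights H K b q \<longleftrightarrow>
     (\<forall>j<K. 0 \<le> q j) \<and> (\<Sum>j<K. q j) = 1 \<and>
     (\<forall>j<K. q j \<noteq> 0 \<longrightarrow> (\<exists>e\<in>b j. eigenvalue H (complex_of_real e)))"

definition gme :: "complex mat \<Rightarrow> nat \<Rightarrow> (nat \<Rightarrow> real set) \<Rightarrow> (nat \<Rightarrow> real) \<Rightarrow> complex mat" where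
  "gme H K b q = mat_sum (dim_row H) (\<lambda>j. complex_of_real (q j) \<cdot>\<^sub>m max_mixed H (b j)) {..<K}"

definition soft_O :: "(nat \<Rightarrow> nat) \<Rightarrow> (nat \<Rightarrow> real) \<Rightarrow> (nat \<Rightarrow> real) set" where
  "soft_O N g = {f. \<exists>r::nat. f \<in> O(\<lambda>n. ln (real (N n)) ^ r * g n)}"

end

(*
  Both states are diagonal in an eigenbasis of H. A bin of the GmE contains a subinterval at its
  upper end (lower end if \<beta> < 0) whose Gibbs weight is bounded below by the Berry--Esseen hypothesis.
  On the whole bin the Gibbs weights are at least exp(- 2 |\<beta>| \<delta>') times those on the subinterval of
  width \<delta>', so \<omega> \<le> lam * g with ln lam = O(N^((1-\<alpha>)/(D+1))).
  Each trace norm on a cube equals 2 (tr(\<omega> Q) - tr(g Q)) for a projection Q supported on the cube.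
  For m cubes at mutual distance at least s the projections Q_j commute, and
    exp(t \<Sum> tr(\<omega> Q_j)) \<le> tr(\<omega> exp(t \<Sum> Q_j)) \<le> lam * tr(g \<Prod> (1 + (e^t - 1) Q_j)),
  where by decay of correlations the last trace factorises up to errors e^(t m - s/\<xi>). This gives
    \<Sum> (tr(\<omega> Q_j) - tr(g Q_j)) \<le> ln lam / t + m t + m e^(t m - s/\<xi>) / t.
  All cubes split into (l+s)^D such families according to the residues of their corners; the choice
  s ~ N^(1/(D+1)), t = N^(-\<alpha>/(2(D+1))) balances the terms.
*)

theory Submission
  imports Defs "HOL-Real_Asymp.Real_Asymp"
begin

unbundle no vec_syntax

subsection \<open>Adjoints and the spectral theorem\<close>

text \<open>A bin may be as wide as \<sigma>, and Gibbs weights may vary across it by a factor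
  exponential in its width. Hence the comparison of the states is one-sided, and the width of the
  slice is tied to the lower bound on \<delta> and not to \<delta> itself. The projections Q_j do
  not commute with H; the states enter only through expectations of observables in eigenvectors of
  H, and positivity is carried by quadratic forms. Two margins decide the exponents. Put a =
  (1-\<alpha>)/(D+1) and y = N^(1/(D+1)). Up to logarithms the Gaussian density in the window is at
  least of order N^(-3a/4)/\<sigma>, and decay of correlations yields \<sigma> = O(sqrt N); a slice
  of width N^(a-\<kappa>) thus has weight N^(a/4) times N^(-1/2-\<kappa>), which beats the
  Berry--Esseen error by a power of N. On the other side a separated family has O(y) members, so t m
  = O(y^(1-\<alpha>/2)) is of lower order than s/\<xi> and the factorisation error vanishes.
  Averaged over all cubes, the entropy term is of order ln lam / (t y), and t^2 = y^(-\<alpha>)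
  makes it equal in order to t.\<close>

lemma mat_adjoint_eq:
  "mat_adjoint A = mat (dim_col A) (dim_row A) (\<lambda>(i, j). cnj (A $$ (j, i)))" for A :: "complex mat"
  by (rule eq_matI) (auto simp: mat_adjoint_def mat_of_rows_index)

lemma mat_adjoint_index [simp]:
  "i < dim_col A \<Longrightarrow> j < dim_row A \<Longrightarrow> mat_adjoint A $$ (i, j) = cnj (A $$ (j, i))" for A :: "complex mat"
  by (simp add: mat_adjoint_eq)

lemma mat_adjoint_dim [simp]:
  "dim_row (mat_adjoint A) = dim_col A" "dim_col (mat_adjoint A) = dim_row A" for A :: "complex mat"
  by (simp_all add: mat_adjoint_eq)

lemma mat_adjoint_carrier [simp]:
  "A \<in> carrier_mat n m \<Longrightarrow> mat_adjoint A \<in> carrier_mat m n" for A :: "complex mat"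
  by (simp add: mat_adjoint_eq)

lemma mat_adjoint_mult:
  assumes "A \<in> carrier_mat n m" "B \<in> carrier_mat m k"
  shows "mat_adjoint (A * B) = mat_adjoint B * mat_adjoint (A :: complex mat)"
  using assms by (intro eq_matI) (auto simp: scalar_prod_def mult.commute intro!: sum.cong)

lemma mat_adjoint_adjoint [simp]: "mat_adjoint (mat_adjoint A) = (A :: complex mat)"
  by (rule eq_matI) auto

lemma mat_adjoint_one [simp]: "mat_adjoint (1\<^sub>m n) = (1\<^sub>m n :: complex mat)"
  by (rule eq_matI) auto

lemma mat_adjoint_zero [simp]: "mat_adjoint (0\<^sub>m n m) = (0\<^sub>m m n :: complex mat)"
  by (rule eq_matI) auto

lemma mat_adjoint_minus:
  assumes "A \<in> carrier_mat n m" "B \<in> carrier_mat n m"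
  shows "mat_adjoint (A - B) = mat_adjoint A - mat_adjoint (B :: complex mat)"
  using assms by (intro eq_matI) auto

lemma mat_adjoint_four_block:
  assumes "A \<in> carrier_mat n1 m1" "B \<in> carrier_mat n1 m2" "C \<in> carrier_mat n2 m1" "E \<in> carrier_mat n2 m2"
  shows "mat_adjoint (four_block_mat A B C E) =
    four_block_mat (mat_adjoint A) (mat_adjoint C) (mat_adjoint B) (mat_adjoint (E :: complex mat))"
  using assms by (intro eq_matI) auto

lemma hermitian_mat_carrier:
  "A \<in> carrier_mat n n \<Longrightarrow> hermitian_mat A \<longleftrightarrow> mat_adjoint A = A"
  by (auto simp: hermitian_mat_def)

section \<open>Inner product and norm of complex vectors\<close>

lemma cscalar_eq_sum:
  "v \<bullet>c w = (\<Sum>i<dim_vec w. v $ i * cnj (w $ i))" for v w :: "complex vec"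
  by (auto simp: scalar_prod_def atLeast0LessThan)

lemma cscalar_add_left:
  fixes u v w :: "complex vec"
  assumes "u \<in> carrier_vec n" "v \<in> carrier_vec n" "w \<in> carrier_vec n"
  shows "(u + v) \<bullet>c w = u \<bullet>c w + v \<bullet>c w"
  using assms by (auto simp: cscalar_eq_sum sum.distrib algebra_simps)

lemma cscalar_add_right:
  fixes u v w :: "complex vec"
  assumes "u \<in> carrier_vec n" "v \<in> carrier_vec n" "w \<in> carrier_vec n"
  shows "w \<bullet>c (u + v) = w \<bullet>c u + w \<bullet>c v"
  using assms by (auto simp: cscalar_eq_sum sum.distrib algebra_simps)

lemma cscalar_smult_left:
  fixes u w :: "complex vec"
  assumes "u \<in> carrier_vec n" "w \<in> carrier_vec n"
  shows "(c \<cdot>\<^sub>v u) \<bullet>c w = c * (u \<bullet>c w)"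
  using assms by (auto simp: cscalar_eq_sum sum_distrib_left algebra_simps)

lemma cscalar_zero [simp]:
  "w \<in> carrier_vec n \<Longrightarrow> 0\<^sub>v n \<bullet>c w = 0" for w :: "complex vec"
  by (simp add: cscalar_eq_sum)

lemma cscalar_commute:
  fixes u w :: "complex vec"
  assumes "u \<in> carrier_vec n" "w \<in> carrier_vec n"
  shows "u \<bullet>c w = cnj (w \<bullet>c u)"
  using assms by (auto simp: cscalar_eq_sum mult.commute)

lemma cscalar_smult_right:
  fixes u w :: "complex vec"
  assumes "u \<in> carrier_vec n" "w \<in> carrier_vec n"
  shows "w \<bullet>c (c \<cdot>\<^sub>v u) = cnj c * (w \<bullet>c u)"
  using assms by (auto simp: cscalar_eq_sum sum_distrib_left algebra_simps)

lemma cscalar_adjoint: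
  fixes v w :: "complex vec"
  assumes "A \<in> carrier_mat n m" "v \<in> carrier_vec m" "w \<in> carrier_vec n"
  shows "(A *\<^sub>v v) \<bullet>c w = v \<bullet>c (mat_adjoint A *\<^sub>v w)"
proof -
  have "(A *\<^sub>v v) \<bullet>c w = (\<Sum>i<n. \<Sum>j<m. A $$ (i, j) * v $ j * cnj (w $ i))"
    using assms by (auto simp: cscalar_eq_sum scalar_prod_def sum_distrib_right atLeast0LessThan
        intro!: sum.cong)
  also have "\<dots> = (\<Sum>j<m. \<Sum>i<n. A $$ (i, j) * v $ j * cnj (w $ i))"
    by (rule sum.swap)
  also have "\<dots> = v \<bullet>c (mat_adjoint A *\<^sub>v w)"
    using assms by (auto simp: cscalar_eq_sum scalar_prod_def sum_distrib_left atLeast0LessThan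
        mult_ac intro!: sum.cong)
  finally show ?thesis .
qed

lemma cscalar_self: "v \<bullet>c v = complex_of_real ((euclid_norm v)\<^sup>2)" for v :: "complex vec"
proof -
  have "v \<bullet>c v = complex_of_real (\<Sum>i<dim_vec v. (cmod (v $ i))\<^sup>2)"
    by (simp add: cscalar_eq_sum complex_norm_square[symmetric] del: of_real_power)
  thus ?thesis by (simp add: euclid_norm_def sum_nonneg)
qed

lemma euclid_norm_sq: "(euclid_norm v)\<^sup>2 = Re (v \<bullet>c v)"
  unfolding cscalar_self by simp

lemma euclid_norm_nonneg [simp]: "0 \<le> euclid_norm v"
  by (simp add: euclid_norm_def sum_nonneg)

lemma euclid_norm_eq_0: "v \<in> carrier_vec n \<Longrightarrow> euclid_norm v = 0 \<longleftrightarrow> v = 0\<^sub>v n"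
  by (auto simp: euclid_norm_def sum_nonneg_eq_0_iff intro!: eq_vecI)

section \<open>Unitary matrices and diagonalisation\<close>

definition unitary_mat :: "nat \<Rightarrow> complex mat \<Rightarrow> bool" where
  "unitary_mat n U \<longleftrightarrow> U \<in> carrier_mat n n \<and> mat_adjoint U * U = 1\<^sub>m n"

lemma unitary_matD:
  assumes "unitary_mat n U"
  shows "U \<in> carrier_mat n n" "mat_adjoint U * U = 1\<^sub>m n" "U * mat_adjoint U = 1\<^sub>m n"
  using assms mat_mult_left_right_inverse[of "mat_adjoint U" n U] by (auto simp: unitary_mat_def)

lemma unitary_mat_mult:
  assumes "unitary_mat n U" "unitary_mat n V"
  shows "unitary_mat n (U * V)"
proof -
  note U = unitary_matD[OF assms(1)] and V = unitary_matD[OF assms(2)]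
  have "mat_adjoint (U * V) * (U * V) = mat_adjoint V * (mat_adjoint U * (U * V))"
    using U(1) V(1) by (subst mat_adjoint_mult[of _ n n _ n]) (auto intro: assoc_mult_mat[of _ n n _ n _ n])
  also have "mat_adjoint U * (U * V) = (mat_adjoint U * U) * V"
    using U(1) V(1) by (intro assoc_mult_mat[of _ n n _ n _ n, symmetric]) auto
  finally show ?thesis using U V by (auto simp: unitary_mat_def)
qed

text \<open>The functional calculus of a matrix diagonalised by \<open>U\<close>, with
  \<open>f\<close> attached to the columns of \<open>U\<close> and not to eigenvalues. Hamiltonian,
  Gibbs state, ensemble and spectral projections are all written with the same \<open>U\<close>, so
  that their products, sums and traces become pointwise operations on \<open>f\<close>.\<close>

definition spec_mat :: "nat \<Rightarrow> complex mat \<Rightarrow> (nat \<Rightarrow> complex) \<Rightarrow> complex mat" where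
  "spec_mat n U f = U * mat_diag n f * mat_adjoint U"

abbreviation real_spec_mat :: "nat \<Rightarrow> complex mat \<Rightarrow> (nat \<Rightarrow> real) \<Rightarrow> complex mat" where
  "real_spec_mat n U f \<equiv> spec_mat n U (\<lambda>i. complex_of_real (f i))"

lemma spec_mat_carrier [simp]: "U \<in> carrier_mat n n \<Longrightarrow> spec_mat n U f \<in> carrier_mat n n"
  by (auto simp: spec_mat_def)

text \<open>Completes \<open>v\<close> to a basis, orthogonalises by Gram--Schmidt starting with
  \<open>v\<close>, and normalises. The first column is only said to be a multiple of
  \<open>v\<close>, which is enough for it to inherit the eigenvalue equation.\<close>

lemma unit_vector_extend:
  fixes v :: "complex vec"
  assumes v: "v \<in> carrier_vec n" and v0: "v \<noteq> 0\<^sub>v n"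
  obtains W a where "unitary_mat n W" "col W 0 = a \<cdot>\<^sub>v v"
proof -
  interpret cof_vec_space n "TYPE(complex)" .
  define b where "b = basis_completion v"
  define ws where "ws = gram_schmidt n b"
  have n0: "0 < n" using v v0 by (cases n) auto
  from basis_completion[OF v v0, folded b_def]
  have dist_b: "distinct b" and indep: "\<not> lin_dep (set b)" and b: "set b \<subseteq> carrier_vec n"
    and hdb: "hd b = v" and len_b: "length b = n" by auto
  from hdb len_b n0 obtain vs where bv: "b = v # vs" by (cases b, auto)
  from gram_schmidt_result[OF b dist_b indep refl, folded ws_def]
  have ws: "set ws \<subseteq> carrier_vec n" "corthogonal ws" "length ws = n" by (auto simp: len_b)
  from gram_schmidt_hd[OF v, of vs, folded bv] have hdws: "hd ws = v" unfolding ws_def .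
  have wsc: "i < n \<Longrightarrow> ws ! i \<in> carrier_vec n" for i using ws by auto
  have orth: "i < n \<Longrightarrow> j < n \<Longrightarrow> (ws ! i \<bullet>c ws ! j = 0) = (i \<noteq> j)" for i j
    using corthogonalD[OF ws(2)] ws(3) by auto
  define W where "W = mat n n (\<lambda>(x, i). ws ! i $ x / complex_of_real (euclid_norm (ws ! i)))"
  have nz: "euclid_norm (ws ! i) \<noteq> 0" if "i < n" for i
    using orth[OF that that] by (auto simp: cscalar_self)
  have "mat_adjoint W * W = 1\<^sub>m n"
  proof (rule eq_matI)
    fix i j assume ij: "i < dim_row (1\<^sub>m n)" "j < dim_col (1\<^sub>m n)"
    hence "(mat_adjoint W * W) $$ (i, j) =
        (\<Sum>x<n. cnj (W $$ (x, i)) * W $$ (x, j))"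
      by (auto simp: W_def scalar_prod_def atLeast0LessThan)
    also have "\<dots> = (\<Sum>x<n. ws ! j $ x * cnj (ws ! i $ x)) / (euclid_norm (ws ! i) * euclid_norm (ws ! j))"
      using ij by (auto simp: W_def sum_divide_distrib intro!: sum.cong)
    also have "\<dots> = (ws ! j \<bullet>c ws ! i) / (euclid_norm (ws ! i) * euclid_norm (ws ! j))"
      using wsc[of i] ij by (auto simp: cscalar_eq_sum)
    also have "\<dots> = (if i = j then 1 else 0)"
      using ij orth[of j i] nz[of i] by (auto simp: cscalar_self power2_eq_square)
    finally show "(mat_adjoint W * W) $$ (i, j) = 1\<^sub>m n $$ (i, j)" using ij by simp
  qed (auto simp: W_def)
  hence "unitary_mat n W" by (auto simp: unitary_mat_def W_def)
  moreover have "col W 0 = (1 / complex_of_real (euclid_norm v)) \<cdot>\<^sub>v v"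
  proof -
    have "ws ! 0 = v" using hd_conv_nth[of ws] hdws ws(3) n0 by auto
    thus ?thesis using n0 v by (intro eq_vecI) (auto simp: W_def)
  qed
  ultimately show ?thesis by (rule that)
qed

text \<open>Moving \<open>A\<close> across the inner product of \<open>v\<close> with itself
  multiplies the squared norm once by \<open>c\<close> and once by its conjugate.\<close>

lemma hermitian_eigenvalue_real:
  fixes A :: "complex mat"
  assumes A: "A \<in> carrier_mat n n" and herm: "mat_adjoint A = A" and v: "v \<in> carrier_vec n" "v \<noteq> 0\<^sub>v n"
    and ev: "A *\<^sub>v v = c \<cdot>\<^sub>v v"
  shows "c \<in> \<real>"
proof -
  have "c * (v \<bullet>c v) = (A *\<^sub>v v) \<bullet>c v" using v ev by simp
  also have "\<dots> = v \<bullet>c (c \<cdot>\<^sub>v v)" using cscalar_adjoint[OF A v(1) v(1)] herm ev by simp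
  also have "\<dots> = cnj c * (v \<bullet>c v)" using v by (simp add: conjugate_smult_vec)
  finally have "c = cnj c" using v euclid_norm_eq_0[OF v(1)] by (auto simp: cscalar_self)
  thus ?thesis by (metis Reals_cnj_iff)
qed

text \<open>Deflation by induction on the dimension: in an orthonormal basis starting with an
  eigenvector the first column has at most its diagonal entry, hermiticity clears the first row too,
  and the remaining block is again hermitian.\<close>

lemma spectral_theorem:
  assumes "A \<in> carrier_mat n n" "hermitian_mat A"
  obtains U e where "unitary_mat n U" "A = real_spec_mat n U e"
proof -
  have "\<exists>U e. unitary_mat n U \<and> A = real_spec_mat n U e"
    using assms
  proof (induction n arbitrary: A)
    case 0
    show ?case
      by (rule exI[of _ "1\<^sub>m 0"]) (use 0 in \<open>auto simp: unitary_mat_def spec_mat_def intro!: eq_matI\<close>)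
  next
    case (Suc n)
    note A = Suc.prems(1)
    have herm: "mat_adjoint A = A" using Suc.prems by (simp add: hermitian_mat_carrier)
    from spectrum_non_empty[OF A] obtain c v where ev: "eigenvector A v c"
      by (auto simp: spectrum_def eigenvalue_def)
    hence v: "v \<in> carrier_vec (Suc n)" "v \<noteq> 0\<^sub>v (Suc n)" and Av: "A *\<^sub>v v = c \<cdot>\<^sub>v v"
      using A by (auto simp: eigenvector_def)
    obtain e0 where c: "c = complex_of_real e0"
      using hermitian_eigenvalue_real[OF A herm v Av] by (auto elim: Reals_cases)
    obtain W a where W: "unitary_mat (Suc n) W" and W0: "col W 0 = a \<cdot>\<^sub>v v"
      using unit_vector_extend[OF v] .
    note Wc = unitary_matD(1)[OF W]
    define A' where "A' = mat_adjoint W * A * W"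
    have A'c: "A' \<in> carrier_mat (Suc n) (Suc n)" using A Wc by (auto simp: A'_def)
    have A'h: "mat_adjoint A' = A'"
    proof -
      have "mat_adjoint A' = mat_adjoint W * mat_adjoint (mat_adjoint W * A)"
        unfolding A'_def by (rule mat_adjoint_mult) (use A Wc in auto)
      also have "mat_adjoint (mat_adjoint W * A) = A * W"
        by (subst mat_adjoint_mult) (use A Wc herm in auto)
      also have "mat_adjoint W * (A * W) = A'"
        unfolding A'_def by (rule assoc_mult_mat[symmetric]) (use A Wc in auto)
      finally show ?thesis .
    qed
    have col0: "A' $$ (i, 0) = (if i = 0 then c else 0)" if i: "i < Suc n" for i
    proof -
      have "col (mat_adjoint W * A * W) 0 = (mat_adjoint W * A) *\<^sub>v col W 0"
        using Wc A by auto
      also have "\<dots> = mat_adjoint W *\<^sub>v (A *\<^sub>v col W 0)"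
        using Wc A v W0 by (intro assoc_mult_mat_vec[of _ "Suc n" "Suc n" _ "Suc n"]) auto
      also have "A *\<^sub>v col W 0 = c \<cdot>\<^sub>v col W 0"
        unfolding W0 using v A by (simp add: mult_mat_vec[of _ "Suc n" "Suc n"] Av smult_smult_assoc mult.commute)
      also have "mat_adjoint W *\<^sub>v (c \<cdot>\<^sub>v col W 0) = c \<cdot>\<^sub>v (mat_adjoint W *\<^sub>v col W 0)"
        using Wc v W0 by (intro mult_mat_vec[of _ "Suc n" "Suc n"]) auto
      also have "mat_adjoint W *\<^sub>v col W 0 = col (mat_adjoint W * W) 0" using Wc by auto
      also have "\<dots> = col (1\<^sub>m (Suc n)) 0" using unitary_matD(2)[OF W] by simp
      finally have "col A' 0 = c \<cdot>\<^sub>v col (1\<^sub>m (Suc n)) 0" unfolding A'_def .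
      hence "col A' 0 $ i = (c \<cdot>\<^sub>v col (1\<^sub>m (Suc n)) 0) $ i" by simp
      thus ?thesis using i A'c by auto
    qed
    \<comment> \<open>The first row is the conjugate of the first column; the diagonal entry stays
      \<open>c\<close> because \<open>c\<close> is real.\<close>
    have row0: "A' $$ (0, j) = (if j = 0 then c else 0)" if j: "j < Suc n" for j
    proof -
      have "A' $$ (0, j) = mat_adjoint A' $$ (0, j)" using A'h by simp
      also have "\<dots> = cnj (A' $$ (j, 0))" using A'c j by auto
      finally show ?thesis using col0[OF j] c by auto
    qed
    define A3 where "A3 = mat n n (\<lambda>(i, j). A' $$ (Suc i, Suc j))"
    have A3c: "A3 \<in> carrier_mat n n" by (simp add: A3_def)
    have blk: "A' = four_block_mat (mat 1 1 (\<lambda>_. c)) (0\<^sub>m 1 n) (0\<^sub>m n 1) A3"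
      using A'c col0 row0 by (intro eq_matI) (auto simp: A3_def)
    have "mat_adjoint A3 = A3"
    proof (rule eq_matI)
      fix i j assume "i < dim_row A3" "j < dim_col A3"
      hence ij: "i < n" "j < n" using A3c by auto
      have "cnj (A' $$ (Suc j, Suc i)) = mat_adjoint A' $$ (Suc i, Suc j)" using ij A'c by auto
      thus "mat_adjoint A3 $$ (i, j) = A3 $$ (i, j)" using ij A'h by (auto simp: A3_def)
    qed (use A3c in auto)
    with Suc.IH[OF A3c] A3c obtain P e where P: "unitary_mat n P"
      and A3: "A3 = real_spec_mat n P e"
      by (auto simp: hermitian_mat_carrier)
    note Pc = unitary_matD(1)[OF P]
    \<comment> \<open>The unitary that diagonalises the block, acting trivially on the eigenvector
      already split off.\<close>
    define B where "B = four_block_mat (1\<^sub>m 1) (0\<^sub>m 1 n) (0\<^sub>m n 1) P"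
    have Badj: "mat_adjoint B = four_block_mat (1\<^sub>m 1) (0\<^sub>m 1 n) (0\<^sub>m n 1) (mat_adjoint P)"
      unfolding B_def using Pc by (subst mat_adjoint_four_block[of _ 1 1 _ n _ n]) auto
    have Bc: "B \<in> carrier_mat (Suc n) (Suc n)" unfolding B_def using Pc by auto
    have "mat_adjoint B * B = four_block_mat (1\<^sub>m 1) (0\<^sub>m 1 n) (0\<^sub>m n 1) (1\<^sub>m n)"
      unfolding Badj unfolding B_def using Pc unitary_matD(2)[OF P]
      by (subst mult_four_block_mat[of _ 1 1 _ n _ n _ _ 1 _ n]) auto
    also have "\<dots> = 1\<^sub>m (Suc n)" by (intro eq_matI) auto
    finally have B: "unitary_mat (Suc n) B" using Bc by (simp add: unitary_mat_def)
    define e' where "e' i = (case i of 0 \<Rightarrow> e0 | Suc k \<Rightarrow> e k)" for i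
    have dg: "mat_diag (Suc n) (\<lambda>i. complex_of_real (e' i)) =
       four_block_mat (mat 1 1 (\<lambda>_. c)) (0\<^sub>m 1 n) (0\<^sub>m n 1) (mat_diag n (\<lambda>i. complex_of_real (e i)))"
      by (intro eq_matI) (auto simp: mat_diag_def e'_def c split: nat.split)
    let ?D = "mat_diag (Suc n) (\<lambda>i. complex_of_real (e' i))"
    have "B * ?D * mat_adjoint B = A'"
    proof -
      define PD where "PD = P * mat_diag n (\<lambda>i. complex_of_real (e i))"
      have PD: "PD \<in> carrier_mat n n" using Pc by (auto simp: PD_def)
      have PDP: "PD * mat_adjoint P \<in> carrier_mat n n" using PD Pc by (intro mult_carrier_mat[of _ n n]) auto
      have "B * ?D = four_block_mat (mat 1 1 (\<lambda>_. c)) (0\<^sub>m 1 n) (0\<^sub>m n 1) PD"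
        unfolding dg B_def PD_def using Pc
        by (subst mult_four_block_mat[of _ 1 1 _ n _ n _ _ 1 _ n]) (auto simp: left_mult_zero_mat[OF mat_diag_dim])
      also have "\<dots> * mat_adjoint B = four_block_mat (mat 1 1 (\<lambda>_. c)) (0\<^sub>m 1 n) (0\<^sub>m n 1) (PD * mat_adjoint P)"
        unfolding Badj
        by (subst mult_four_block_mat[of _ 1 1 _ n _ n _ _ 1 _ n])
          (use Pc PD in \<open>simp_all add: right_mult_zero_mat[OF PD] left_add_zero_mat[OF PDP]\<close>)
      finally show ?thesis using blk A3 by (simp add: spec_mat_def PD_def)
    qed
    have "A = W * A' * mat_adjoint W"
    proof -
      have "W * A' = W * (mat_adjoint W * (A * W))"
        unfolding A'_def using Wc A by (subst assoc_mult_mat[of _ "Suc n" "Suc n" _ "Suc n" _ "Suc n"]) auto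
      also have "\<dots> = W * mat_adjoint W * (A * W)"
        using Wc A by (intro assoc_mult_mat[of _ "Suc n" "Suc n" _ "Suc n" _ "Suc n", symmetric]) auto
      also have "\<dots> = A * W" using unitary_matD(3)[OF W] Wc A by auto
      also have "A * W * mat_adjoint W = A * (W * mat_adjoint W)"
        using Wc A by (intro assoc_mult_mat[of _ "Suc n" "Suc n" _ "Suc n" _ "Suc n"]) auto
      finally show ?thesis using unitary_matD(3)[OF W] A by simp
    qed
    also have "\<dots> = W * (B * ?D * mat_adjoint B) * mat_adjoint W"
      using \<open>B * ?D * mat_adjoint B = A'\<close> by simp
    also have "\<dots> = spec_mat (Suc n) (W * B) (\<lambda>i. complex_of_real (e' i))"
    proof -
      have "mat_adjoint (W * B) = mat_adjoint B * mat_adjoint W"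
        using Wc Bc by (rule mat_adjoint_mult)
      moreover have D: "?D \<in> carrier_mat (Suc n) (Suc n)" by simp
      have "W * (B * ?D * mat_adjoint B) = W * B * ?D * mat_adjoint B"
      proof -
        have "W * (B * ?D * mat_adjoint B) = W * (B * ?D) * mat_adjoint B"
          using Wc Bc D by (intro assoc_mult_mat[of _ "Suc n" "Suc n" _ "Suc n" _ "Suc n", symmetric]) auto
        also have "W * (B * ?D) = W * B * ?D"
          using Wc Bc D by (intro assoc_mult_mat[of _ "Suc n" "Suc n" _ "Suc n" _ "Suc n", symmetric]) auto
        finally show ?thesis .
      qed
      moreover have "W * B * ?D * mat_adjoint B * mat_adjoint W = W * B * ?D * (mat_adjoint B * mat_adjoint W)"
        using Wc Bc D by (intro assoc_mult_mat[of _ "Suc n" "Suc n" _ "Suc n" _ "Suc n"] mult_carrier_mat[of _ "Suc n" "Suc n"]) auto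
      ultimately show ?thesis unfolding spec_mat_def by simp
    qed
    finally show ?case using unitary_mat_mult[OF W B] by blast
  qed
  thus ?thesis using that by blast
qed

subsection \<open>Functional calculus and the trace norm\<close>

lemma spec_mat_dim [simp]:
  assumes "U \<in> carrier_mat n n"
  shows "dim_row (spec_mat n U f) = n" "dim_col (spec_mat n U f) = n"
  using spec_mat_carrier[OF assms, of f] by auto

lemma mat_diag_mult_carrier [simp]:
  "A \<in> carrier_mat n m \<Longrightarrow> mat_diag n f * A \<in> carrier_mat n m"
  "A \<in> carrier_mat m n \<Longrightarrow> A * mat_diag n f \<in> carrier_mat m n"
  using mult_carrier_mat[OF mat_diag_dim] mult_carrier_mat[OF _ mat_diag_dim] by blast+

lemma mat_trace_add:
  "A \<in> carrier_mat n n \<Longrightarrow> B \<in> carrier_mat n n \<Longrightarrow> mat_trace (A + B) = mat_trace A + mat_trace B"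
  by (simp add: mat_trace_def sum.distrib)

lemma mat_trace_minus:
  "A \<in> carrier_mat n n \<Longrightarrow> B \<in> carrier_mat n n \<Longrightarrow> mat_trace (A - B) = mat_trace A - mat_trace B"
  by (simp add: mat_trace_def sum_subtractf)

lemma mat_trace_smult: "A \<in> carrier_mat n n \<Longrightarrow> mat_trace (c \<cdot>\<^sub>m A) = c * mat_trace A"
  by (simp add: mat_trace_def sum_distrib_left)

lemma mat_trace_mult:
  assumes "A \<in> carrier_mat n m" "B \<in> carrier_mat m n"
  shows "mat_trace (A * B) = (\<Sum>x<n. \<Sum>y<m. A $$ (x, y) * B $$ (y, x))"
  using assms by (auto simp: mat_trace_def scalar_prod_def atLeast0LessThan intro!: sum.cong)

lemma spec_mat_index:
  assumes "U \<in> carrier_mat n n" "x < n" "y < n"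
  shows "spec_mat n U f $$ (x, y) = (\<Sum>i<n. U $$ (x, i) * f i * cnj (U $$ (y, i)))"
  using assms unfolding spec_mat_def
  by (subst mat_diag_mult_right[of _ n n]) (auto simp: scalar_prod_def atLeast0LessThan intro!: sum.cong)

lemma spec_mat_mult:
  assumes "unitary_mat n U"
  shows "spec_mat n U f * spec_mat n U g = spec_mat n U (\<lambda>i. f i * g i)"
proof -
  note U = unitary_matD[OF assms]
  let ?F = "mat_diag n f" and ?G = "mat_diag n g"
  have UF: "U * ?F \<in> carrier_mat n n" using U by auto
  have "spec_mat n U f * spec_mat n U g = U * ?F * (mat_adjoint U * (U * ?G * mat_adjoint U))"
    unfolding spec_mat_def using U by (intro assoc_mult_mat[of _ n n _ n _ n]) auto
  also have "mat_adjoint U * (U * ?G * mat_adjoint U) = mat_adjoint U * (U * (?G * mat_adjoint U))"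
    using U by (subst assoc_mult_mat[of U n n _ n _ n]) auto
  also have "\<dots> = mat_adjoint U * U * (?G * mat_adjoint U)"
    using U by (intro assoc_mult_mat[of _ n n _ n _ n, symmetric]) auto
  also have "\<dots> = ?G * mat_adjoint U"
    using U left_mult_one_mat[of "?G * mat_adjoint U" n n] by auto
  also have "U * ?F * (?G * mat_adjoint U) = U * ?F * ?G * mat_adjoint U"
    using U UF by (intro assoc_mult_mat[of _ n n _ n _ n, symmetric]) auto
  also have "U * ?F * ?G = U * (?F * ?G)"
    using U by (intro assoc_mult_mat[of _ n n _ n _ n]) auto
  finally show ?thesis by (simp add: spec_mat_def)
qed

lemma spec_mat_cong: "(\<And>i. i < n \<Longrightarrow> f i = g i) \<Longrightarrow> spec_mat n U f = spec_mat n U g"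
proof -
  assume "\<And>i. i < n \<Longrightarrow> f i = g i"
  hence "mat_diag n f = mat_diag n g" by (intro eq_matI) (auto simp: mat_diag_def)
  thus ?thesis by (simp add: spec_mat_def)
qed

lemma spec_mat_one:
  assumes "unitary_mat n U"
  shows "spec_mat n U (\<lambda>_. 1) = 1\<^sub>m n"
  using unitary_matD[OF assms] by (simp add: spec_mat_def)

lemma spec_mat_adjoint:
  assumes "U \<in> carrier_mat n n"
  shows "mat_adjoint (spec_mat n U f) = spec_mat n U (\<lambda>i. cnj (f i))"
proof (rule eq_matI)
  fix i j assume "i < dim_row (spec_mat n U (\<lambda>i. cnj (f i)))" "j < dim_col (spec_mat n U (\<lambda>i. cnj (f i)))"
  moreover note c = spec_mat_carrier[OF assms, of f] spec_mat_carrier[OF assms, of "\<lambda>i. cnj (f i)"]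
  ultimately have ij: "i < n" "j < n" by auto
  have "cnj (spec_mat n U f $$ (j, i)) = spec_mat n U (\<lambda>i. cnj (f i)) $$ (i, j)"
    using assms ij by (simp add: spec_mat_index mult_ac)
  thus "mat_adjoint (spec_mat n U f) $$ (i, j) = spec_mat n U (\<lambda>i. cnj (f i)) $$ (i, j)"
    using c ij by auto
qed (use spec_mat_carrier[OF assms, of f] spec_mat_carrier[OF assms, of "\<lambda>i. cnj (f i)"] in auto)

lemma unitary_col_inner:
  assumes "unitary_mat n U" "i < n" "j < n"
  shows "col U i \<bullet>c col U j = (if i = j then 1 else 0)"
proof -
  note U = unitary_matD[OF assms(1)]
  have "col U i \<bullet>c col U j = (mat_adjoint U * U) $$ (j, i)"
    using U(1) assms by (auto simp: cscalar_eq_sum scalar_prod_def atLeast0LessThan mult.commute intro!: sum.cong)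
  thus ?thesis using U(2) assms by auto
qed

text \<open>Cyclicity of the trace, written in the eigenbasis. \<open>X\<close> is arbitrary and may
  fail to commute with the diagonalised matrix, so local observables can be averaged over the
  eigenstates of the Hamiltonian.\<close>

lemma trace_spec_mat_mult:
  assumes "U \<in> carrier_mat n n" "X \<in> carrier_mat n n"
  shows "mat_trace (spec_mat n U f * X) = (\<Sum>i<n. f i * ((X *\<^sub>v col U i) \<bullet>c col U i))"
proof -
  have "mat_trace (spec_mat n U f * X) =
      (\<Sum>x<n. \<Sum>y<n. \<Sum>i<n. f i * (X $$ (y, x) * U $$ (x, i) * cnj (U $$ (y, i)) ))"
  proof -
    have "mat_trace (spec_mat n U f * X) = (\<Sum>x<n. \<Sum>y<n. spec_mat n U f $$ (x, y) * X $$ (y, x))"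
      using assms by (intro mat_trace_mult) auto
    also have "\<dots> = (\<Sum>x<n. \<Sum>y<n. \<Sum>i<n. f i * (X $$ (y, x) * U $$ (x, i) * cnj (U $$ (y, i))))"
      using assms by (intro sum.cong refl) (simp add: spec_mat_index sum_distrib_left sum_distrib_right mult_ac)
    finally show ?thesis .
  qed
  also have "\<dots> = (\<Sum>x<n. \<Sum>i<n. \<Sum>y<n. f i * (X $$ (y, x) * U $$ (x, i) * cnj (U $$ (y, i)) ))"
    by (intro sum.cong refl sum.swap)
  also have "\<dots> = (\<Sum>i<n. \<Sum>x<n. \<Sum>y<n. f i * (X $$ (y, x) * U $$ (x, i) * cnj (U $$ (y, i)) ))"
    by (rule sum.swap)
  also have "\<dots> = (\<Sum>i<n. \<Sum>y<n. \<Sum>x<n. f i * (X $$ (y, x) * U $$ (x, i) * cnj (U $$ (y, i)) ))"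
    by (intro sum.cong refl sum.swap)
  also have "\<dots> = (\<Sum>i<n. f i * ((X *\<^sub>v col U i) \<bullet>c col U i))"
    using assms by (auto simp: cscalar_eq_sum scalar_prod_def atLeast0LessThan sum_distrib_left sum_distrib_right
        intro!: sum.cong)
  finally show ?thesis .
qed

lemma trace_spec_mat:
  assumes "unitary_mat n U"
  shows "mat_trace (spec_mat n U f) = (\<Sum>i<n. f i)"
proof -
  note U = unitary_matD[OF assms(1)]
  have "mat_trace (spec_mat n U f) = mat_trace (spec_mat n U f * 1\<^sub>m n)"
    using U by (simp add: right_mult_one_mat[OF spec_mat_carrier])
  also have "\<dots> = (\<Sum>i<n. f i * (col U i \<bullet>c col U i))"
    using U by (subst trace_spec_mat_mult) (auto intro!: sum.cong)
  also have "\<dots> = (\<Sum>i<n. f i)"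
    using unitary_col_inner[OF assms] by (auto intro!: sum.cong)
  finally show ?thesis .
qed

lemma spec_mat_mult_vec:
  assumes U: "U \<in> carrier_mat n n" and v: "v \<in> carrier_vec n" and x: "x < n"
  shows "(spec_mat n U f *\<^sub>v v) $ x = (\<Sum>i<n. f i * (v \<bullet>c col U i) * U $$ (x, i))"
proof -
  have "(spec_mat n U f *\<^sub>v v) $ x = (\<Sum>y<n. spec_mat n U f $$ (x, y) * v $ y)"
    using U x v by (auto simp: scalar_prod_def atLeast0LessThan intro!: sum.cong)
  also have "\<dots> = (\<Sum>y<n. \<Sum>i<n. f i * (v $ y * cnj (U $$ (y, i))) * U $$ (x, i))"
    using U x by (simp add: spec_mat_index sum_distrib_left sum_distrib_right mult_ac)
  also have "\<dots> = (\<Sum>i<n. \<Sum>y<n. f i * (v $ y * cnj (U $$ (y, i))) * U $$ (x, i))"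
    by (rule sum.swap)
  also have "\<dots> = (\<Sum>i<n. f i * (v \<bullet>c col U i) * U $$ (x, i))"
    using U by (auto simp: cscalar_eq_sum sum_distrib_left sum_distrib_right intro!: sum.cong)
  finally show ?thesis .
qed

lemma spec_mat_mult_col:
  assumes "unitary_mat n U" "i < n"
  shows "spec_mat n U f *\<^sub>v col U i = f i \<cdot>\<^sub>v col U i"
proof (rule eq_vecI)
  note U = unitary_matD[OF assms(1)]
  fix x assume "x < dim_vec (f i \<cdot>\<^sub>v col U i)"
  hence x: "x < n" using U by auto
  have "(spec_mat n U f *\<^sub>v col U i) $ x = (\<Sum>j<n. f j * (col U i \<bullet>c col U j) * U $$ (x, j))"
    using U x by (intro spec_mat_mult_vec) auto
  also have "\<dots> = (\<Sum>j<n. if j = i then f j * U $$ (x, j) else 0)"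
    using unitary_col_inner[OF assms] by (intro sum.cong) auto
  also have "\<dots> = (f i \<cdot>\<^sub>v col U i) $ x" using x U assms(2) by simp
  finally show "(spec_mat n U f *\<^sub>v col U i) $ x = (f i \<cdot>\<^sub>v col U i) $ x" .
qed (use unitary_matD[OF assms(1)] in auto)

lemma spec_mat_smult:
  assumes "U \<in> carrier_mat n n"
  shows "c \<cdot>\<^sub>m spec_mat n U f = spec_mat n U (\<lambda>i. c * f i)"
  using assms by (intro eq_matI) (simp_all add: spec_mat_index sum_distrib_left mult_ac)

lemma spec_mat_sum:
  assumes "U \<in> carrier_mat n n"
  shows "mat_sum n (\<lambda>j. spec_mat n U (f j)) I = spec_mat n U (\<lambda>i. \<Sum>j\<in>I. f j i)"
proof (rule eq_matI)
  fix x y assume "x < dim_row (spec_mat n U (\<lambda>i. \<Sum>j\<in>I. f j i))" "y < dim_col (spec_mat n U (\<lambda>i. \<Sum>j\<in>I. f j i))"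
  hence xy: "x < n" "y < n" using spec_mat_carrier[OF assms, of "\<lambda>i. \<Sum>j\<in>I. f j i"] by auto
  have "mat_sum n (\<lambda>j. spec_mat n U (f j)) I $$ (x, y) =
      (\<Sum>j\<in>I. \<Sum>i<n. U $$ (x, i) * f j i * cnj (U $$ (y, i)))"
    using xy assms by (simp add: mat_sum_def spec_mat_index)
  also have "\<dots> = (\<Sum>i<n. \<Sum>j\<in>I. U $$ (x, i) * f j i * cnj (U $$ (y, i)))"
    by (rule sum.swap)
  also have "\<dots> = spec_mat n U (\<lambda>i. \<Sum>j\<in>I. f j i) $$ (x, y)"
    using xy assms by (simp add: spec_mat_index sum_distrib_left sum_distrib_right)
  finally show "mat_sum n (\<lambda>j. spec_mat n U (f j)) I $$ (x, y) = spec_mat n U (\<lambda>i. \<Sum>j\<in>I. f j i) $$ (x, y)" .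
qed (use spec_mat_carrier[OF assms, of "\<lambda>i. \<Sum>j\<in>I. f j i"] in \<open>auto simp: mat_sum_def\<close>)

lemma spec_mat_pow:
  assumes "unitary_mat n U"
  shows "spec_mat n U f ^\<^sub>m k = spec_mat n U (\<lambda>i. f i ^ k)"
proof (induction k)
  case 0
  show ?case using spec_mat_one[OF assms] spec_mat_carrier[OF unitary_matD(1)[OF assms], of f] by simp
next
  case (Suc k)
  thus ?case using spec_mat_mult[OF assms] by (simp add: mult.commute)
qed

text \<open>\<open>mat_exp\<close> is an entrywise series; in the eigenbasis each entry is a finite
  combination of scalar exponential series, which can be summed term by term.\<close>

lemma mat_exp_spec_mat:
  assumes "unitary_mat n U"
  shows "mat_exp (spec_mat n U f) = spec_mat n U (\<lambda>i. exp (f i))"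
proof (rule eq_matI)
  note U = unitary_matD(1)[OF assms]
  note dims = carrier_matD[OF spec_mat_carrier[OF U]]
  fix x y assume "x < dim_row (spec_mat n U (\<lambda>i. exp (f i)))" "y < dim_col (spec_mat n U (\<lambda>i. exp (f i)))"
  hence xy: "x < n" "y < n" by (simp_all add: dims)
  have "(\<lambda>m. U $$ (x, i) * (f i ^ m /\<^sub>R fact m) * cnj (U $$ (y, i))) sums (U $$ (x, i) * exp (f i) * cnj (U $$ (y, i)))" for i
    by (intro sums_mult sums_mult2 exp_converges)
  hence "(\<lambda>m. \<Sum>i<n. U $$ (x, i) * (f i ^ m /\<^sub>R fact m) * cnj (U $$ (y, i))) sums
      (\<Sum>i<n. U $$ (x, i) * exp (f i) * cnj (U $$ (y, i)))"
    by (intro sums_sum)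
  also have "(\<lambda>m. \<Sum>i<n. U $$ (x, i) * (f i ^ m /\<^sub>R fact m) * cnj (U $$ (y, i))) =
      (\<lambda>m. (spec_mat n U f ^\<^sub>m m) $$ (x, y) / fact m)"
    using xy U by (simp add: spec_mat_pow[OF assms] spec_mat_index sum_divide_distrib scaleR_conv_of_real field_simps)
  finally have "(\<Sum>m. (spec_mat n U f ^\<^sub>m m) $$ (x, y) / fact m) = spec_mat n U (\<lambda>i. exp (f i)) $$ (x, y)"
    using xy U by (simp add: sums_iff spec_mat_index)
  thus "mat_exp (spec_mat n U f) $$ (x, y) = spec_mat n U (\<lambda>i. exp (f i)) $$ (x, y)"
    using xy by (simp add: mat_exp_def dims)
qed (use unitary_matD(1)[OF assms] in \<open>auto simp: mat_exp_def\<close>)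

section \<open>Positive square roots and the trace norm\<close>

lemma psd_mat_spec_mat:
  assumes "unitary_mat n U" "\<And>i. i < n \<Longrightarrow> 0 \<le> e i"
  shows "psd_mat (real_spec_mat n U e)"
proof -
  note U = unitary_matD(1)[OF assms(1)]
  let ?R = "spec_mat n U (\<lambda>i. complex_of_real (sqrt (e i)))"
  let ?A = "real_spec_mat n U e"
  have Rc: "?R \<in> carrier_mat n n" and Ac: "?A \<in> carrier_mat n n" using U by auto
  have RA: "?R * ?R = ?A" unfolding spec_mat_mult[OF assms(1)]
    by (intro spec_mat_cong) (simp add: assms(2) flip: of_real_mult)
  have Radj: "mat_adjoint ?R = ?R" using U by (simp add: spec_mat_adjoint)
  have "0 \<le> Re ((?A *\<^sub>v v) \<bullet>c v)" if "v \<in> carrier_vec n" for v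
  proof -
    have "(?A *\<^sub>v v) \<bullet>c v = (?R *\<^sub>v (?R *\<^sub>v v)) \<bullet>c v"
      unfolding RA[symmetric] using Rc that by (simp add: assoc_mult_mat_vec[of _ n n _ n])
    also have "\<dots> = (?R *\<^sub>v v) \<bullet>c (?R *\<^sub>v v)"
      using cscalar_adjoint[OF Rc, of "?R *\<^sub>v v" v] Radj Rc that by auto
    finally show ?thesis by (simp add: cscalar_self)
  qed
  moreover have "hermitian_mat ?A" unfolding hermitian_mat_carrier[OF Ac] using U by (simp add: spec_mat_adjoint)
  ultimately show ?thesis using Ac by (auto simp: psd_mat_def)
qed

text \<open>\<open>psd_sqrt\<close> is a definite description, so uniqueness is the content. For a
  positive root \<open>B\<close> and an eigenvector \<open>u\<close> with \<open>e > 0\<close>, the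
  vector \<open>v = B u - e u\<close> satisfies \<open>B v = - e v\<close>, and positivity of
  \<open>B\<close> forces \<open>v = 0\<close>.\<close>

lemma psd_sqrt_spec_mat:
  assumes U: "unitary_mat n U" and nonneg: "\<And>i. i < n \<Longrightarrow> 0 \<le> e i"
  shows "psd_sqrt (spec_mat n U (\<lambda>i. complex_of_real ((e i)\<^sup>2))) = real_spec_mat n U e"
proof -
  note Uc = unitary_matD(1)[OF U]
  let ?C = "real_spec_mat n U e"
  let ?A = "spec_mat n U (\<lambda>i. complex_of_real ((e i)\<^sup>2))"
  have CC: "?C * ?C = ?A" unfolding spec_mat_mult[OF U]
    by (intro spec_mat_cong) (simp add: power2_eq_square)
  have dimA: "dim_row ?A = n" using spec_mat_carrier[OF Uc] by auto
  have unique: "B = ?C" if B: "B \<in> carrier_mat n n" "psd_mat B" "B * B = ?A" for B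
  proof -
    have Badj: "mat_adjoint B = B" using B(1,2) hermitian_mat_carrier[OF B(1)] by (auto simp: psd_mat_def)
    have Bu: "B *\<^sub>v col U i = complex_of_real (e i) \<cdot>\<^sub>v col U i" if i: "i < n" for i
    proof -
      let ?u = "col U i" and ?e = "complex_of_real (e i)"
      have u: "?u \<in> carrier_vec n" using Uc i by auto
      have Buc: "B *\<^sub>v ?u \<in> carrier_vec n" using B(1) u by (rule mult_mat_vec_carrier)
      have BBu: "B *\<^sub>v (B *\<^sub>v ?u) = (?e * ?e) \<cdot>\<^sub>v ?u"
        using assoc_mult_mat_vec[OF B(1,1) u] spec_mat_mult_col[OF U i] B(3) by (simp add: power2_eq_square)
      define v where "v = B *\<^sub>v ?u - ?e \<cdot>\<^sub>v ?u"
      have v: "v \<in> carrier_vec n" using Buc u by (simp add: v_def)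
      have "v = 0\<^sub>v n"
      \<comment> \<open>Positivity says nothing at eigenvalue 0; there the squared norm of
        \<open>B u\<close> is computed from \<open>B * B\<close> instead.\<close>
      proof (cases "e i = 0")
        case True
        have "(B *\<^sub>v ?u) \<bullet>c (B *\<^sub>v ?u) = (B *\<^sub>v (B *\<^sub>v ?u)) \<bullet>c ?u"
          using cscalar_adjoint[OF B(1) Buc u] Badj by simp
        also have "\<dots> = 0" unfolding BBu using True u by (simp add: cscalar_eq_sum)
        finally have "B *\<^sub>v ?u = 0\<^sub>v n" using euclid_norm_eq_0[OF Buc] by (simp add: cscalar_self)
        thus ?thesis using True u Uc unfolding v_def by (intro eq_vecI) auto
      next
        case False
        have "B *\<^sub>v v = B *\<^sub>v (B *\<^sub>v ?u) - ?e \<cdot>\<^sub>v (B *\<^sub>v ?u)"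
          unfolding v_def using mult_minus_distrib_mat_vec[OF B(1) Buc, of "?e \<cdot>\<^sub>v ?u"] mult_mat_vec[OF B(1) u] u by simp
        also have "\<dots> = - ?e \<cdot>\<^sub>v v"
          unfolding BBu v_def using u Uc B(1) by (intro eq_vecI) (auto simp: algebra_simps)
        finally have "(B *\<^sub>v v) \<bullet>c v = - ?e * (v \<bullet>c v)"
          using cscalar_smult_left[OF v v] by simp
        hence "Re ((B *\<^sub>v v) \<bullet>c v) = - e i * (euclid_norm v)\<^sup>2" by (simp add: cscalar_self)
        hence "0 \<le> - e i * (euclid_norm v)\<^sup>2" using B(1,2) v by (auto simp: psd_mat_def)
        hence "euclid_norm v = 0" using nonneg[OF i] False by (simp add: mult_le_0_iff)
        thus ?thesis using euclid_norm_eq_0[OF v] by simp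
      qed
      hence "(B *\<^sub>v ?u - ?e \<cdot>\<^sub>v ?u) $ x = 0" if "x < n" for x using that by (simp add: v_def)
      thus ?thesis using u Uc B(1) by (intro eq_vecI) auto
    qed
    \<comment> \<open>Both roots act alike on the columns of \<open>U\<close>, hence agree after
      right multiplication by \<open>U\<close>, which is then cancelled.\<close>
    have "col (B * U) i = col (?C * U) i" if "i < n" for i
      unfolding col_mult2[OF B(1) Uc that] col_mult2[OF spec_mat_carrier[OF Uc] Uc that]
        Bu[OF that] spec_mat_mult_col[OF U that] by (rule refl)
    hence BU: "B * U = ?C * U" using B(1) Uc by (intro mat_col_eqI) auto
    have "X = X * U * mat_adjoint U" if "X \<in> carrier_mat n n" for X
      using assoc_mult_mat[OF that Uc mat_adjoint_carrier[OF Uc]] unitary_matD(3)[OF U] that by simp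
    from this[OF B(1)] this[of ?C] show ?thesis using BU Uc by simp
  qed
  show ?thesis unfolding psd_sqrt_def dimA
    by (rule the_equality) (use unique CC psd_mat_spec_mat[OF U nonneg] Uc in auto)
qed

text \<open>\<open>Q\<close> projects onto the eigenvectors with positive eigenvalue. As the
  eigenvalues sum to 0, the positive ones make up exactly half of the sum of absolute values. A
  trace distance thus becomes the gain in expectation of a single projection, to which exponential
  moments apply.\<close>

lemma trace_norm_traceless:
  assumes X: "X \<in> carrier_mat n n" "hermitian_mat X" and tr: "mat_trace X = 0"
  obtains Q where "Q \<in> carrier_mat n n" "Q * Q = Q" "mat_adjoint Q = Q"
    "trace_norm X = 2 * Re (mat_trace (X * Q))"
proof -
  from spectral_theorem[OF X] obtain U e where U: "unitary_mat n U"
    and Xs: "X = real_spec_mat n U e" by blast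
  note Uc = unitary_matD(1)[OF U]
  have "mat_adjoint X * X = spec_mat n U (\<lambda>i. complex_of_real (\<bar>e i\<bar>\<^sup>2))"
    unfolding Xs spec_mat_adjoint[OF Uc] spec_mat_mult[OF U] by (intro spec_mat_cong) (simp add: power2_eq_square flip: of_real_mult)
  hence tn: "trace_norm X = (\<Sum>i<n. \<bar>e i\<bar>)"
    unfolding trace_norm_def using psd_sqrt_spec_mat[OF U, of "\<lambda>i. \<bar>e i\<bar>"] trace_spec_mat[OF U] by simp
  have "complex_of_real (\<Sum>i<n. e i) = 0" using tr unfolding Xs trace_spec_mat[OF U] by simp
  hence s0: "(\<Sum>i<n. e i) = 0" by (simp only: of_real_eq_0_iff)
  define Q where "Q = spec_mat n U (\<lambda>i. if e i > 0 then 1 else 0)"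
  have "Q \<in> carrier_mat n n" using Uc by (simp add: Q_def)
  moreover have "Q * Q = Q" unfolding Q_def spec_mat_mult[OF U] by (intro spec_mat_cong) auto
  moreover have "mat_adjoint Q = Q" unfolding Q_def spec_mat_adjoint[OF Uc] by (intro spec_mat_cong) auto
  moreover have "trace_norm X = 2 * Re (mat_trace (X * Q))"
  proof -
    have "Re (mat_trace (X * Q)) = (\<Sum>i<n. if e i > 0 then e i else 0)"
      unfolding Xs Q_def spec_mat_mult[OF U] trace_spec_mat[OF U] by (auto intro!: sum.cong)
    hence "2 * Re (mat_trace (X * Q)) - (\<Sum>i<n. e i) = (\<Sum>i<n. \<bar>e i\<bar>)"
      by (simp add: sum_distrib_left flip: sum_subtractf) (auto intro!: sum.cong)
    thus ?thesis using s0 tn by simp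
  qed
  ultimately show ?thesis by (rule that)
qed

text \<open>An idempotent fixes every vector of its range. Two orthogonal projections with the same
  range therefore satisfy \<open>P * R = R\<close> and \<open>R * P = P\<close>, and the adjoint of
  the first equation identifies them.\<close>

lemma orth_proj_eq:
  assumes P: "P \<in> carrier_mat n n" "P * P = P" "mat_adjoint P = P" "(\<lambda>v. P *\<^sub>v v) ` carrier_vec n = W"
  shows "orth_proj n W = P"
  unfolding orth_proj_def
proof (rule the_equality)
  show "P \<in> carrier_mat n n \<and> P * P = P \<and> mat_adjoint P = P \<and> (\<lambda>v. P *\<^sub>v v) ` carrier_vec n = W"
    using P by blast
next
  fix R assume R: "R \<in> carrier_mat n n \<and> R * R = R \<and> mat_adjoint R = R \<and> (\<lambda>v. R *\<^sub>v v) ` carrier_vec n = W"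
  have *: "S * T = T" if "S \<in> carrier_mat n n" "S * S = S" "T \<in> carrier_mat n n"
      "(\<lambda>v. S *\<^sub>v v) ` carrier_vec n = (\<lambda>v. T *\<^sub>v v) ` carrier_vec n" for S T :: "complex mat"
  proof (rule eq_matI)
    fix i j assume ij: "i < dim_row T" "j < dim_col T"
    have "T *\<^sub>v unit_vec n j \<in> (\<lambda>v. S *\<^sub>v v) ` carrier_vec n" using that(4) by auto
    then obtain v where v: "v \<in> carrier_vec n" "T *\<^sub>v unit_vec n j = S *\<^sub>v v" by auto
    have "S *\<^sub>v (S *\<^sub>v v) = S *\<^sub>v v"
      using assoc_mult_mat_vec[OF that(1,1) v(1)] that(2) by simp
    hence "S *\<^sub>v (T *\<^sub>v unit_vec n j) = T *\<^sub>v unit_vec n j" using v by simp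
    moreover have "T *\<^sub>v unit_vec n j = col T j" using that(3) ij by auto
    ultimately have "(S *\<^sub>v col T j) $ i = col T j $ i" by simp
    thus "(S * T) $$ (i, j) = T $$ (i, j)" using that ij by auto
  qed (use that in auto)
  have "P * R = R" using *[of P R] P R by auto
  moreover have "R * P = P" using *[of R P] P R by auto
  moreover have "mat_adjoint (P * R) = R * P" using mat_adjoint_mult[of P n n R n] P R by auto
  ultimately show "R = P" using R by simp
qed

text \<open>Moving \<open>H\<close> from one side of the inner product to the other shows that
  \<open>c - e i\<close> annihilates it.\<close>

lemma eigenvector_orthogonal:
  assumes U: "unitary_mat n U" and H: "H = real_spec_mat n U e"
    and v: "eigenvector H v (complex_of_real c)" and i: "i < n" "e i \<noteq> c"
  shows "v \<bullet>c col U i = 0"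
proof -
  note Uc = unitary_matD(1)[OF U]
  have Hc: "H \<in> carrier_mat n n" and Hadj: "mat_adjoint H = H" using Uc by (simp_all add: H spec_mat_adjoint)
  have vc: "v \<in> carrier_vec n" and Hv: "H *\<^sub>v v = complex_of_real c \<cdot>\<^sub>v v" using v Hc by (auto simp: eigenvector_def)
  have ci: "col U i \<in> carrier_vec n" using Uc i by auto
  have "complex_of_real c * (v \<bullet>c col U i) = (H *\<^sub>v v) \<bullet>c col U i"
    unfolding Hv by (rule cscalar_smult_left[OF vc ci, symmetric])
  also have "\<dots> = v \<bullet>c (H *\<^sub>v col U i)" using cscalar_adjoint[OF Hc vc ci] Hadj by simp
  also have "H *\<^sub>v col U i = complex_of_real (e i) \<cdot>\<^sub>v col U i" unfolding H by (rule spec_mat_mult_col[OF U i(1)])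
  also have "v \<bullet>c (complex_of_real (e i) \<cdot>\<^sub>v col U i) = complex_of_real (e i) * (v \<bullet>c col U i)"
    using cscalar_smult_right[OF ci vc] by simp
  finally show ?thesis using i(2) by auto
qed

text \<open>Both sides project onto the same space. The matrix on the right fixes every eigenvector
  for \<open>S\<close>, whose components along the remaining columns vanish; conversely each of its
  values is a combination of columns of \<open>U\<close> that are themselves eigenvectors for
  \<open>S\<close>.\<close>

lemma spec_proj_spec_mat:
  assumes U: "unitary_mat n U" and H: "H = real_spec_mat n U e"
  shows "spec_proj H S = spec_mat n U (\<lambda>i. if e i \<in> S then 1 else 0)"
proof -
  note Uc = unitary_matD(1)[OF U]
  have dimH: "dim_row H = n" and Hc: "H \<in> carrier_mat n n" using spec_mat_carrier[OF Uc] unfolding H by auto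
  define P where "P = spec_mat n U (\<lambda>i. if e i \<in> S then 1 else 0)"
  have Pc: "P \<in> carrier_mat n n" using Uc by (simp add: P_def)
  define Ev where "Ev = {v. \<exists>e\<in>S. eigenvector H v (complex_of_real e)}"
  interpret cof_vec_space n "TYPE(complex)" .
  have Evc: "Ev \<subseteq> carrier_vec n" by (auto simp: Ev_def eigenvector_def dimH)
  have PEv: "P *\<^sub>v v = v" if vEv: "v \<in> Ev" for v
  proof (rule eq_vecI)
    obtain c where c: "c \<in> S" "eigenvector H v (complex_of_real c)" using vEv unfolding Ev_def by blast
    have v: "v \<in> carrier_vec n" using vEv Evc by blast
    fix x assume "x < dim_vec v"
    hence x: "x < n" using v by simp
    have "(P *\<^sub>v v) $ x = (spec_mat n U (\<lambda>_. 1) *\<^sub>v v) $ x"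
      unfolding P_def spec_mat_mult_vec[OF Uc v x]
      using eigenvector_orthogonal[OF U H c(2)] c(1) by (intro sum.cong) auto
    thus "(P *\<^sub>v v) $ x = v $ x" using spec_mat_one[OF U] v by simp
  qed (use Pc vEv Evc in auto)
  have "(\<lambda>v. P *\<^sub>v v) ` carrier_vec n = span Ev"
  proof (rule antisym)
    show "(\<lambda>v. P *\<^sub>v v) ` carrier_vec n \<subseteq> span Ev"
    proof (rule image_subsetI)
      fix v :: "complex vec" assume v: "v \<in> carrier_vec n"
      define c where "c i = v \<bullet>c col U i" for i
      \<comment> \<open>Partial sums of the expansion of \<open>P *\<^sub>v v\<close> in the columns
        of \<open>U\<close>, so that membership in the span follows by induction on
        \<open>k\<close>.\<close>
      define w where "w k = vec n (\<lambda>x. \<Sum>i<k. if e i \<in> S then c i * U $$ (x, i) else 0)" for k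
      have "w k \<in> span Ev" if "k \<le> n" for k
        using that
      proof (induction k)
        case 0
        have "w 0 = 0\<^sub>v n" by (rule eq_vecI) (auto simp: w_def)
        thus ?case using span_zero[of Ev] by simp
      next
        case (Suc k)
        show ?case
        proof (cases "e k \<in> S")
          case False
          hence "w (Suc k) = w k" by (simp add: w_def)
          thus ?thesis using Suc by simp
        next
          case True
          have kn: "k < n" using Suc by simp
          have "H *\<^sub>v col U k = complex_of_real (e k) \<cdot>\<^sub>v col U k"
            unfolding H using spec_mat_mult_col[OF U kn] by simp
          moreover have "col U k \<noteq> 0\<^sub>v n"
            using unitary_col_inner[OF U kn kn] by auto
          ultimately have "col U k \<in> Ev" using True Uc kn by (auto simp: Ev_def eigenvector_def dimH)
          hence "col U k \<in> span Ev" using in_own_span[OF Evc] by auto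
          hence "c k \<cdot>\<^sub>v col U k \<in> span Ev" by (rule smult_in_span[OF Evc])
          hence "w k + c k \<cdot>\<^sub>v col U k \<in> span Ev" using Suc span_add1[OF Evc] by auto
          moreover have "w (Suc k) = w k + c k \<cdot>\<^sub>v col U k"
            using True Uc kn by (intro eq_vecI) (auto simp: w_def)
          ultimately show ?thesis by simp
        qed
      qed
      from this[of n] have "w n \<in> span Ev" by simp
      moreover have "P *\<^sub>v v = w n"
      proof (rule eq_vecI)
        fix x assume "x < dim_vec (w n)"
        hence x: "x < n" by (simp add: w_def)
        show "(P *\<^sub>v v) $ x = w n $ x"
          unfolding P_def spec_mat_mult_vec[OF Uc v x] using x by (auto simp: w_def c_def intro!: sum.cong)
      qed (use Pc in \<open>auto simp: w_def\<close>)
      ultimately show "P *\<^sub>v v \<in> span Ev" by simp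
    qed
    show "span Ev \<subseteq> (\<lambda>v. P *\<^sub>v v) ` carrier_vec n"
    proof
      fix v assume "v \<in> span Ev"
      from in_spanE[OF this] obtain a A where a: "v = lincomb a A" "finite A" "A \<subseteq> Ev" by blast
      have Ac: "A \<subseteq> carrier_vec n" using a Evc by auto
      have vc: "v \<in> carrier_vec n" unfolding a(1) by (rule lincomb_dim[OF a(2) Ac, THEN carrier_vecI])
      \<comment> \<open>By linearity, since \<open>P\<close> fixes every vector of \<open>A\<close>;
        carried out entrywise by exchanging two finite sums.\<close>
      have "P *\<^sub>v v = v"
      proof (rule eq_vecI)
        fix x assume "x < dim_vec v"
        hence x: "x < n" using vc by auto
        have "(P *\<^sub>v v) $ x = (\<Sum>y<n. \<Sum>w\<in>A. P $$ (x, y) * (a w * w $ y))"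
          using x Pc vc lincomb_index[OF _ Ac, of _ a] by (auto simp: a(1) scalar_prod_def sum_distrib_left atLeast0LessThan intro!: sum.cong)
        also have "\<dots> = (\<Sum>w\<in>A. \<Sum>y<n. P $$ (x, y) * (a w * w $ y))" by (rule sum.swap)
        also have "\<dots> = (\<Sum>w\<in>A. a w * (P *\<^sub>v w) $ x)"
        proof (intro sum.cong refl)
          fix w assume "w \<in> A"
          hence "w \<in> carrier_vec n" using Ac by auto
          thus "(\<Sum>y<n. P $$ (x, y) * (a w * w $ y)) = a w * (P *\<^sub>v w) $ x"
            using x Pc by (auto simp: scalar_prod_def sum_distrib_left atLeast0LessThan mult_ac intro!: sum.cong)
        qed
        also have "\<dots> = (\<Sum>w\<in>A. a w * w $ x)" using PEv a(3) by (intro sum.cong) auto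
        also have "\<dots> = v $ x" using lincomb_index[OF x Ac, of a] a(1) by simp
        finally show "(P *\<^sub>v v) $ x = v $ x" .
      qed (use Pc vc in auto)
      thus "v \<in> (\<lambda>v. P *\<^sub>v v) ` carrier_vec n" using vc by (metis image_eqI)
    qed
  qed
  moreover have "P * P = P" unfolding P_def spec_mat_mult[OF U] by (intro spec_mat_cong) auto
  moreover have "mat_adjoint P = P" unfolding P_def spec_mat_adjoint[OF Uc] by (intro spec_mat_cong) auto
  ultimately have "orth_proj n (span Ev) = P" using orth_proj_eq[OF Pc] by blast
  thus ?thesis unfolding spec_proj_def dimH P_def Ev_def by simp
qed

subsection \<open>Operators supported on a region\<close>

lemma digit_less: "1 \<le> b \<Longrightarrow> digit b x i < b"
  by (simp add: digit_def)

lemma digit_add_mult: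
  assumes "1 \<le> b" "a < n"
  shows "digit b (x + c * b ^ n) a = digit b x a"
proof -
  obtain r where n: "n = a + Suc r" using assms(2) less_iff_Suc_add by auto
  have "(x + c * b ^ n) div b ^ a = (x + (c * b ^ r * b) * b ^ a) div b ^ a"
    by (simp add: n power_add mult_ac)
  also have "\<dots> = c * b ^ r * b + x div b ^ a" using assms(1) by simp
  finally show ?thesis by (simp add: digit_def)
qed

text \<open>Together with \<open>sum_digit\<close> this identifies the numbers below
  \<open>b ^ n\<close> with digit functions: basis states with configurations for
  \<open>b = d\<close>, and sites with coordinate vectors for \<open>b = L\<close>.\<close>

lemma digit_sum:
  assumes "1 \<le> b" "\<And>i. i < n \<Longrightarrow> f i < b"
  shows "(\<Sum>i<n. f i * b ^ i) < b ^ n" "i < n \<Longrightarrow> digit b (\<Sum>i<n. f i * b ^ i) i = f i"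
proof -
  have "(\<Sum>i<n. f i * b ^ i) < b ^ n \<and> (\<forall>i<n. digit b (\<Sum>i<n. f i * b ^ i) i = f i)"
    using assms(2)
  proof (induction n)
    case (Suc n)
    let ?s = "\<Sum>i<n. f i * b ^ i"
    have IH: "?s < b ^ n" "\<And>i. i < n \<Longrightarrow> digit b ?s i = f i" using Suc by auto
    have "?s + f n * b ^ n < (f n + 1) * b ^ n" using IH(1) by simp
    also have "\<dots> \<le> b * b ^ n" using Suc.prems[of n] by (intro mult_right_mono) auto
    finally have lt: "?s + f n * b ^ n < b ^ Suc n" by simp
    have "digit b (?s + f n * b ^ n) i = f i" if "i < Suc n" for i
    proof (cases "i = n")
      case True
      thus ?thesis using IH(1) Suc.prems[of n] assms(1) by (simp add: digit_def)
    next
      case False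
      hence i: "i < n" using that by simp
      have "digit b (?s + f n * b ^ n) i = digit b ?s i" by (rule digit_add_mult[OF assms(1) i])
      thus ?thesis using IH(2)[OF i] by simp
    qed
    thus ?case using lt by simp
  qed simp
  thus "(\<Sum>i<n. f i * b ^ i) < b ^ n" "i < n \<Longrightarrow> digit b (\<Sum>i<n. f i * b ^ i) i = f i" by auto
qed

lemma sum_digit: "x < b ^ n \<Longrightarrow> (\<Sum>i<n. digit b x i * b ^ i) = x"
proof (induction n arbitrary: x)
  case (Suc n)
  have "x mod b ^ n = (\<Sum>i<n. digit b (x mod b ^ n) i * b ^ i)"
  proof (cases "b = 0")
    case True thus ?thesis using Suc by (cases n) auto
  next
    case False
    thus ?thesis using Suc.IH[of "x mod b ^ n"] by simp
  qed
  also have "\<dots> = (\<Sum>i<n. digit b x i * b ^ i)"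
  proof (intro sum.cong refl)
    fix i assume "i \<in> {..<n}"
    then obtain k where n: "n = i + Suc k" using less_iff_Suc_add by auto
    have "x mod b ^ n div b ^ i mod b = x div b ^ i mod b"
    proof -
      have b: "0 < b" using Suc.prems by (cases b) auto
      have "x mod b ^ n = b ^ i * (x div b ^ i mod b ^ Suc k) + x mod b ^ i"
        unfolding n power_add by (rule mod_mult2_eq)
      hence "x mod b ^ n div b ^ i = x div b ^ i mod b ^ Suc k" using b by simp
      thus ?thesis by (simp add: mod_mod_cancel)
    qed
    thus "digit b (x mod b ^ n) i * b ^ i = digit b x i * b ^ i" by (simp add: digit_def)
  qed
  finally have e: "(\<Sum>i<n. digit b x i * b ^ i) = x mod b ^ n" by simp
  have "x div b ^ n < b" using Suc.prems
    by (metis less_mult_imp_div_less mult.commute power_Suc)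
  hence "digit b x n = x div b ^ n" by (simp add: digit_def)
  thus ?case using e mod_div_mult_eq[of x "b ^ n"] by simp
qed simp

lemma digit_eqI:
  assumes "x < b ^ n" "y < b ^ n" "\<And>i. i < n \<Longrightarrow> digit b x i = digit b y i"
  shows "x = y"
proof -
  have "x = (\<Sum>i<n. digit b x i * b ^ i)" using sum_digit[OF assms(1)] by (rule sym)
  also have "\<dots> = (\<Sum>i<n. digit b y i * b ^ i)" using assms(3) by (intro sum.cong) simp_all
  also have "\<dots> = y" by (rule sum_digit[OF assms(2)])
  finally show ?thesis .
qed

section \<open>Gluing and restricting configurations\<close>

definition merge_conf :: "nat \<Rightarrow> nat \<Rightarrow> nat set \<Rightarrow> nat \<Rightarrow> nat \<Rightarrow> nat" where
  "merge_conf d N X x y = (\<Sum>i<N. digit d (if i \<in> X then x else y) i * d ^ i)"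

lemma merge_conf_less: "1 \<le> d \<Longrightarrow> merge_conf d N X x y < d ^ N"
  unfolding merge_conf_def by (intro digit_sum digit_less)

lemma digit_merge_conf:
  "1 \<le> d \<Longrightarrow> i < N \<Longrightarrow> digit d (merge_conf d N X x y) i = digit d (if i \<in> X then x else y) i"
  unfolding merge_conf_def by (intro digit_sum digit_less)

lemma restrict_conf_less: "1 \<le> d \<Longrightarrow> restrict_conf d X x < d ^ card X"
  unfolding restrict_conf_def by (intro digit_sum digit_less)

lemma digit_restrict_conf:
  "1 \<le> d \<Longrightarrow> j < card X \<Longrightarrow> digit d (restrict_conf d X x) j = digit d x (sorted_list_of_set X ! j)"
  unfolding restrict_conf_def by (intro digit_sum digit_less)

lemma restrict_conf_eq_iff:
  assumes "1 \<le> d" "finite X"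
  shows "restrict_conf d X x = restrict_conf d X y \<longleftrightarrow> (\<forall>i\<in>X. digit d x i = digit d y i)"
proof
  assume eq: "restrict_conf d X x = restrict_conf d X y"
  show "\<forall>i\<in>X. digit d x i = digit d y i"
  proof
    fix i assume "i \<in> X"
    then obtain j where "j < card X" "sorted_list_of_set X ! j = i"
      using assms(2) by (metis in_set_conv_nth length_sorted_list_of_set set_sorted_list_of_set)
    thus "digit d x i = digit d y i" using digit_restrict_conf[OF assms(1), of j X] eq by metis
  qed
next
  assume eq: "\<forall>i\<in>X. digit d x i = digit d y i"
  show "restrict_conf d X x = restrict_conf d X y"
    unfolding restrict_conf_def
  proof (intro sum.cong refl arg_cong2[of _ _ _ _ "(*)"])
    fix j assume "j \<in> {..<card X}"
    hence "sorted_list_of_set X ! j \<in> X"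
      using assms(2) by (metis lessThan_iff nth_mem length_sorted_list_of_set set_sorted_list_of_set)
    thus "digit d x (sorted_list_of_set X ! j) = digit d y (sorted_list_of_set X ! j)" using eq by auto
  qed
qed

lemma restrict_conf_surj:
  assumes d: "1 \<le> d" and X: "X \<subseteq> {..<N}" and s: "s < d ^ card X"
  obtains z where "z < d ^ N" "restrict_conf d X z = s"
proof -
  let ?l = "sorted_list_of_set X"
  have fin: "finite X" using X by (rule finite_subset) simp
  \<comment> \<open>A site of \<open>X\<close> receives the digit of \<open>s\<close> at its
    position in the increasing enumeration of \<open>X\<close>; all other sites receive 0.\<close>
  define g where "g i = (if i \<in> X then digit d s (THE j. j < card X \<and> ?l ! j = i) else 0)" for i
  define z where "z = (\<Sum>i<N. g i * d ^ i)"
  have g: "g i < d" for i using d by (auto simp: g_def digit_less)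
  have "z < d ^ N" unfolding z_def by (intro digit_sum g d)
  moreover have "restrict_conf d X z = s"
  proof (rule digit_eqI[OF restrict_conf_less[OF d] s])
    fix j assume j: "j < card X"
    let ?i = "?l ! j"
    have iX: "?i \<in> X" using j fin by (metis nth_mem length_sorted_list_of_set set_sorted_list_of_set)
    have "(THE j. j < card X \<and> ?l ! j = ?i) = j"
      using j fin by (intro the_equality) (auto simp: nth_eq_iff_index_eq)
    hence "g ?i = digit d s j" using iX by (simp add: g_def)
    moreover have "digit d z ?i = g ?i" unfolding z_def using iX X by (intro digit_sum g d) auto
    ultimately show "digit d (restrict_conf d X z) j = digit d s j"
      by (simp add: digit_restrict_conf[OF d j])
  qed
  ultimately show ?thesis by (rule that)
qed

lemma restrict_conf_merge:
  assumes "1 \<le> d" "Y \<subseteq> X" "X \<subseteq> {..<N}"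
  shows "restrict_conf d Y (merge_conf d N X x y) = restrict_conf d Y x"
  using assms finite_subset[of Y "{..<N}"]
  by (subst restrict_conf_eq_iff) (auto simp: digit_merge_conf subset_eq)

lemma restrict_conf_merge_off:
  assumes "1 \<le> d" "Y \<inter> X = {}" "Y \<subseteq> {..<N}"
  shows "restrict_conf d Y (merge_conf d N X x y) = restrict_conf d Y y"
  using assms finite_subset[of Y "{..<N}"]
  by (subst restrict_conf_eq_iff) (auto simp: digit_merge_conf subset_eq)

lemma agree_off_refl [simp]: "agree_off d N X x x"
  by (simp add: agree_off_def)

lemma agree_off_sym: "agree_off d N X x y \<longleftrightarrow> agree_off d N X y x"
  by (auto simp: agree_off_def)

lemma agree_off_trans: "agree_off d N X x y \<Longrightarrow> agree_off d N X y z \<Longrightarrow> agree_off d N X x z"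
  by (auto simp: agree_off_def)

lemma agree_off_merge: "1 \<le> d \<Longrightarrow> agree_off d N X (merge_conf d N X x y) y"
  by (auto simp: agree_off_def digit_merge_conf)

lemma restrict_agree_eqI:
  assumes "1 \<le> d" "finite X" "x < d ^ N" "y < d ^ N" "restrict_conf d X x = restrict_conf d X y" "agree_off d N X x y"
  shows "x = y"
  using assms by (intro digit_eqI[of x d N y]) (auto simp: agree_off_def restrict_conf_eq_iff)

text \<open>Turns the sum over intermediate states in a product of embedded operators into a sum
  over the basis of the region. For surjectivity, a preimage of \<open>s\<close> is overwritten by
  \<open>x\<close> outside \<open>X\<close>.\<close>

lemma bij_betw_restrict_conf:
  assumes d: "1 \<le> d" and X: "X \<subseteq> {..<N}"
  shows "bij_betw (restrict_conf d X) {z. z < d ^ N \<and> agree_off d N X x z} {..<d ^ card X}"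
proof (rule bij_betwI')
  have fin: "finite X" using X by (rule finite_subset) simp
  fix z w assume z: "z \<in> {z. z < d ^ N \<and> agree_off d N X x z}" and w: "w \<in> {z. z < d ^ N \<and> agree_off d N X x z}"
  show "(restrict_conf d X z = restrict_conf d X w) = (z = w)"
  proof
    assume "restrict_conf d X z = restrict_conf d X w"
    moreover have "agree_off d N X z x" using z agree_off_sym[of d N X x z] by simp
    hence "agree_off d N X z w" by (rule agree_off_trans) (use w in simp)
    ultimately show "z = w" using restrict_agree_eqI[OF d fin, of z N w] z w by simp
  qed simp
next
  fix z assume "z \<in> {z. z < d ^ N \<and> agree_off d N X x z}"
  thus "restrict_conf d X z \<in> {..<d ^ card X}" using restrict_conf_less[OF d] by simp
next
  fix s assume "s \<in> {..<d ^ card X}"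
  then obtain z where "z < d ^ N" "restrict_conf d X z = s" using restrict_conf_surj[OF d X, of s] by auto
  thus "\<exists>z\<in>{z. z < d ^ N \<and> agree_off d N X x z}. s = restrict_conf d X z"
    using merge_conf_less[OF d, of N X z x] restrict_conf_merge[OF d order.refl X, of z x] agree_off_merge[OF d, of N X z x]
      agree_off_sym[of d N X "merge_conf d N X z x" x]
    by (intro bexI[of _ "merge_conf d N X z x"]) auto
qed

section \<open>Algebra of operators embedded into the full lattice\<close>

lemma extend_op_carrier [simp]: "extend_op d N X B \<in> carrier_mat (d ^ N) (d ^ N)"
  by (simp add: extend_op_def)

lemma extend_op_dim [simp]: "dim_row (extend_op d N X B) = d ^ N" "dim_col (extend_op d N X B) = d ^ N"
  by (simp_all add: extend_op_def)

lemma extend_op_index: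
  "x < d ^ N \<Longrightarrow> y < d ^ N \<Longrightarrow> extend_op d N X B $$ (x, y) =
    (if agree_off d N X x y then B $$ (restrict_conf d X x, restrict_conf d X y) else 0)"
  by (simp add: extend_op_def)

lemma mat_mult_index:
  "A \<in> carrier_mat n m \<Longrightarrow> B \<in> carrier_mat m k \<Longrightarrow> x < n \<Longrightarrow> y < k \<Longrightarrow>
    (A * B) $$ (x, y) = (\<Sum>z<m. A $$ (x, z) * B $$ (z, y))" for A B :: "complex mat"
  by (auto simp: scalar_prod_def atLeast0LessThan intro!: sum.cong)

text \<open>A term of the matrix product survives only if its intermediate state agrees with
  \<open>x\<close> off \<open>X\<close>, and these states are enumerated by the basis of the
  region.\<close>

lemma extend_op_mult:
  assumes d: "1 \<le> d" and X: "X \<subseteq> {..<N}"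
    and B: "B \<in> carrier_mat (d ^ card X) (d ^ card X)" "C \<in> carrier_mat (d ^ card X) (d ^ card X)"
  shows "extend_op d N X B * extend_op d N X C = extend_op d N X (B * C)"
proof (rule eq_matI)
  fix x y assume "x < dim_row (extend_op d N X (B * C))" "y < dim_col (extend_op d N X (B * C))"
  hence xy: "x < d ^ N" "y < d ^ N" by simp_all
  let ?r = "restrict_conf d X" and ?S = "{z. z < d ^ N \<and> agree_off d N X x z}"
  have "(extend_op d N X B * extend_op d N X C) $$ (x, y) =
      (\<Sum>z<d ^ N. extend_op d N X B $$ (x, z) * extend_op d N X C $$ (z, y))"
    using xy by (intro mat_mult_index[of _ _ "d ^ N" _ "d ^ N"]) auto
  also have "\<dots> = (\<Sum>z\<in>?S. extend_op d N X B $$ (x, z) * extend_op d N X C $$ (z, y))"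
    using xy by (intro sum.mono_neutral_right) (auto simp: extend_op_index)
  also have "\<dots> = extend_op d N X (B * C) $$ (x, y)"
  proof (cases "agree_off d N X x y")
    case False
    hence "(\<Sum>z\<in>?S. extend_op d N X B $$ (x, z) * extend_op d N X C $$ (z, y)) = 0"
      using xy by (intro sum.neutral) (auto simp: extend_op_index dest: agree_off_trans)
    thus ?thesis using False xy by (simp add: extend_op_index)
  next
    case True
    have "(\<Sum>z\<in>?S. extend_op d N X B $$ (x, z) * extend_op d N X C $$ (z, y)) =
        (\<Sum>z\<in>?S. B $$ (?r x, ?r z) * C $$ (?r z, ?r y))"
    proof (intro sum.cong refl)
      fix z assume z: "z \<in> ?S"
      hence "agree_off d N X z y" using True agree_off_trans agree_off_sym by blast
      thus "extend_op d N X B $$ (x, z) * extend_op d N X C $$ (z, y) = B $$ (?r x, ?r z) * C $$ (?r z, ?r y)"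
        using z xy by (simp add: extend_op_index)
    qed
    also have "\<dots> = (\<Sum>s<d ^ card X. B $$ (?r x, s) * C $$ (s, ?r y))"
      by (rule sum.reindex_bij_betw[OF bij_betw_restrict_conf[OF d X]])
    also have "\<dots> = (B * C) $$ (?r x, ?r y)"
      using B restrict_conf_less[OF d] by (intro mat_mult_index[symmetric]) auto
    finally show ?thesis using True xy by (simp add: extend_op_index)
  qed
  finally show "(extend_op d N X B * extend_op d N X C) $$ (x, y) = extend_op d N X (B * C) $$ (x, y)" .
qed simp_all

lemma extend_op_adjoint:
  assumes d: "1 \<le> d" and B: "B \<in> carrier_mat (d ^ card X) (d ^ card X)"
  shows "mat_adjoint (extend_op d N X B) = extend_op d N X (mat_adjoint B)"
proof (rule eq_matI)
  fix x y assume "x < dim_row (extend_op d N X (mat_adjoint B))" "y < dim_col (extend_op d N X (mat_adjoint B))"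
  thus "mat_adjoint (extend_op d N X B) $$ (x, y) = extend_op d N X (mat_adjoint B) $$ (x, y)"
    using B restrict_conf_less[OF d, of X] agree_off_sym[of d N X x y] by (simp add: extend_op_index)
qed simp_all

lemma extend_op_one:
  assumes d: "1 \<le> d" and X: "X \<subseteq> {..<N}"
  shows "extend_op d N X (1\<^sub>m (d ^ card X)) = 1\<^sub>m (d ^ N)"
proof (rule eq_matI)
  have fin: "finite X" using X by (rule finite_subset) simp
  fix x y assume "x < dim_row (1\<^sub>m (d ^ N))" "y < dim_col (1\<^sub>m (d ^ N))"
  thus "extend_op d N X (1\<^sub>m (d ^ card X)) $$ (x, y) = 1\<^sub>m (d ^ N) $$ (x, y)"
    using restrict_conf_less[OF d, of X] restrict_agree_eqI[OF d fin, of x N y] by (auto simp: extend_op_index)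
qed simp_all

lemma extend_op_add:
  assumes d: "1 \<le> d"
    and B: "B \<in> carrier_mat (d ^ card X) (d ^ card X)" "C \<in> carrier_mat (d ^ card X) (d ^ card X)"
  shows "extend_op d N X B + extend_op d N X C = extend_op d N X (B + C)"
  using B restrict_conf_less[OF d, of X] by (intro eq_matI) (auto simp: extend_op_index)

lemma extend_op_smult:
  assumes d: "1 \<le> d" and B: "B \<in> carrier_mat (d ^ card X) (d ^ card X)"
  shows "c \<cdot>\<^sub>m extend_op d N X B = extend_op d N X (c \<cdot>\<^sub>m B)"
  using B restrict_conf_less[OF d, of X] by (intro eq_matI) (auto simp: extend_op_index)

text \<open>Only one intermediate state can contribute: it equals \<open>y\<close> on
  \<open>X\<close> and \<open>x\<close> elsewhere. The resulting formula is symmetric in the two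
  regions, which is what yields commutation.\<close>

lemma extend_op_mult_disjoint:
  assumes d: "1 \<le> d" and X: "X \<subseteq> {..<N}" "Y \<subseteq> {..<N}" "X \<inter> Y = {}" and xy: "x < d ^ N" "y < d ^ N"
  shows "(extend_op d N X B * extend_op d N Y C) $$ (x, y) =
    (if agree_off d N (X \<union> Y) x y then B $$ (restrict_conf d X x, restrict_conf d X y) *
       C $$ (restrict_conf d Y x, restrict_conf d Y y) else 0)"
proof -
  let ?z = "merge_conf d N X y x"
  have z: "?z < d ^ N" by (rule merge_conf_less[OF d])
  have "(extend_op d N X B * extend_op d N Y C) $$ (x, y) =
      (\<Sum>z<d ^ N. extend_op d N X B $$ (x, z) * extend_op d N Y C $$ (z, y))"
    using xy by (intro mat_mult_index[of _ _ "d ^ N" _ "d ^ N"]) auto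
  also have "\<dots> = (\<Sum>z\<in>{?z}. extend_op d N X B $$ (x, z) * extend_op d N Y C $$ (z, y))"
  proof (intro sum.mono_neutral_right ballI)
    fix w assume w: "w \<in> {..<d ^ N} - {?z}"
    show "extend_op d N X B $$ (x, w) * extend_op d N Y C $$ (w, y) = 0"
    proof (rule ccontr)
      assume "extend_op d N X B $$ (x, w) * extend_op d N Y C $$ (w, y) \<noteq> 0"
      hence "agree_off d N X x w" "agree_off d N Y w y"
        using w xy by (auto simp: extend_op_index split: if_splits)
      hence "w = ?z" using w z X(3)
        by (intro digit_eqI[of w d N ?z]) (auto simp: agree_off_def digit_merge_conf[OF d])
      thus False using w by simp
    qed
  qed (use z in auto)
  also have "\<dots> = extend_op d N X B $$ (x, ?z) * extend_op d N Y C $$ (?z, y)" by simp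
  also have "\<dots> = (if agree_off d N (X \<union> Y) x y then B $$ (restrict_conf d X x, restrict_conf d X y) *
       C $$ (restrict_conf d Y x, restrict_conf d Y y) else 0)"
  proof -
    have "agree_off d N X x ?z" using agree_off_merge[OF d] agree_off_sym by blast
    moreover have "agree_off d N Y ?z y \<longleftrightarrow> agree_off d N (X \<union> Y) x y"
      by (auto simp: agree_off_def digit_merge_conf[OF d])
    moreover have "restrict_conf d X ?z = restrict_conf d X y" by (rule restrict_conf_merge[OF d order.refl X(1)])
    moreover have "restrict_conf d Y ?z = restrict_conf d Y x"
      using X by (intro restrict_conf_merge_off[OF d]) auto
    ultimately show ?thesis using z xy by (simp add: extend_op_index)
  qed
  finally show ?thesis .
qed

lemma extend_op_commute:
  assumes d: "1 \<le> d" and X: "X \<subseteq> {..<N}" "Y \<subseteq> {..<N}" "X \<inter> Y = {}"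
  shows "extend_op d N X B * extend_op d N Y C = extend_op d N Y C * extend_op d N X B"
proof (rule eq_matI)
  fix x y assume "x < dim_row (extend_op d N Y C * extend_op d N X B)" "y < dim_col (extend_op d N Y C * extend_op d N X B)"
  hence xy: "x < d ^ N" "y < d ^ N" by simp_all
  have YX: "Y \<inter> X = {}" using X by auto
  have "(extend_op d N X B * extend_op d N Y C) $$ (x, y) =
      (if agree_off d N (X \<union> Y) x y then B $$ (restrict_conf d X x, restrict_conf d X y) *
         C $$ (restrict_conf d Y x, restrict_conf d Y y) else 0)"
    by (rule extend_op_mult_disjoint[OF d X xy])
  also have "\<dots> = (if agree_off d N (Y \<union> X) x y then C $$ (restrict_conf d Y x, restrict_conf d Y y) *
         B $$ (restrict_conf d X x, restrict_conf d X y) else 0)"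
    by (subst Un_commute, subst mult.commute) (rule refl)
  also have "\<dots> = (extend_op d N Y C * extend_op d N X B) $$ (x, y)"
    by (rule extend_op_mult_disjoint[OF d X(2,1) YX xy, symmetric])
  finally show "(extend_op d N X B * extend_op d N Y C) $$ (x, y) = (extend_op d N Y C * extend_op d N X B) $$ (x, y)" .
qed (simp_all only: index_mult_mat extend_op_dim)

lemma supported_on_carrier: "supported_on d N X A \<Longrightarrow> A \<in> carrier_mat (d ^ N) (d ^ N)"
  by (auto simp: supported_on_def)

text \<open>The matrix on the larger region is read off from the entries of \<open>A\<close>, at one
  representative full configuration for each configuration of \<open>Y\<close>.\<close>

lemma supported_on_mono:
  assumes d: "1 \<le> d" and X: "X \<subseteq> Y" "Y \<subseteq> {..<N}" and A: "supported_on d N X A"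
  shows "supported_on d N Y A"
proof -
  have finY: "finite Y" using X(2) by (rule finite_subset) simp
  have finX: "finite X" using X(1) finY by (rule finite_subset)
  obtain B where A: "A = extend_op d N X B" using A by (auto simp: supported_on_def)
  \<comment> \<open>Representatives carry the digits of 0 outside \<open>Y\<close>, so they never
    differ there and agreement off \<open>X\<close> is decided within \<open>Y\<close>.\<close>
  define z where "z s = merge_conf d N Y (SOME z. z < d ^ N \<and> restrict_conf d Y z = s) 0" for s
  define C where "C = mat (d ^ card Y) (d ^ card Y) (\<lambda>(s, t). A $$ (z s, z t))"
  have "A = extend_op d N Y C"
  proof (rule eq_matI)
    fix x y assume "x < dim_row (extend_op d N Y C)" "y < dim_col (extend_op d N Y C)"
    hence xy: "x < d ^ N" "y < d ^ N" by simp_all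
    have rz: "restrict_conf d Y (z (restrict_conf d Y x)) = restrict_conf d Y x" for x
    proof -
      have "\<exists>w. w < d ^ N \<and> restrict_conf d Y w = restrict_conf d Y x"
        using restrict_conf_surj[OF d X(2) restrict_conf_less[OF d], of x] by metis
      from someI_ex[OF this] show ?thesis unfolding z_def restrict_conf_merge[OF d order.refl X(2)] by (rule conjunct2)
    qed
    have zl: "z s < d ^ N" for s unfolding z_def by (rule merge_conf_less[OF d])
    have dz: "digit d (z (restrict_conf d Y x)) i = digit d x i" if "i \<in> Y" for x i
      using rz[of x] that by (simp add: restrict_conf_eq_iff[OF d finY])
    hence rX: "restrict_conf d X (z (restrict_conf d Y x)) = restrict_conf d X x" for x
      using X by (auto simp: restrict_conf_eq_iff[OF d finX])
    have dz0: "digit d (z s) i = digit d 0 i" if "i \<notin> Y" "i < N" for s i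
      using that by (simp add: z_def digit_merge_conf[OF d])
    have iff: "agree_off d N Y x y \<and> agree_off d N X (z (restrict_conf d Y x)) (z (restrict_conf d Y y)) \<longleftrightarrow> agree_off d N X x y"
      (is "?L \<longleftrightarrow> _")
    proof
      assume L: ?L
      show "agree_off d N X x y"
        unfolding agree_off_def
      proof (intro allI impI)
        fix i assume i: "i < N" "i \<notin> X"
        show "digit d x i = digit d y i"
        proof (cases "i \<in> Y")
          case True
          thus ?thesis using L i dz[OF True, of x] dz[OF True, of y] by (simp add: agree_off_def)
        qed (use L i in \<open>simp add: agree_off_def\<close>)
      qed
    next
      assume R: "agree_off d N X x y"
      have "digit d (z (restrict_conf d Y x)) i = digit d (z (restrict_conf d Y y)) i" if "i < N" "i \<notin> X" for i
        using that R dz[of i x] dz[of i y] dz0[of i] by (cases "i \<in> Y") (simp_all add: agree_off_def)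
      thus ?L using R X(1) by (auto simp: agree_off_def)
    qed
    have "extend_op d N Y C $$ (x, y) = (if agree_off d N Y x y
        then A $$ (z (restrict_conf d Y x), z (restrict_conf d Y y)) else 0)"
      unfolding extend_op_index[OF xy] C_def index_mat(1)[OF restrict_conf_less[OF d] restrict_conf_less[OF d]] by simp
    also have "A $$ (z (restrict_conf d Y x), z (restrict_conf d Y y)) =
        (if agree_off d N X (z (restrict_conf d Y x)) (z (restrict_conf d Y y))
         then B $$ (restrict_conf d X x, restrict_conf d X y) else 0)"
      unfolding A extend_op_index[OF zl zl] rX by (rule refl)
    finally have e: "extend_op d N Y C $$ (x, y) = (if agree_off d N Y x y
        then (if agree_off d N X (z (restrict_conf d Y x)) (z (restrict_conf d Y y))
         then B $$ (restrict_conf d X x, restrict_conf d X y) else 0) else 0)" .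
    show "A $$ (x, y) = extend_op d N Y C $$ (x, y)"
      unfolding e unfolding A extend_op_index[OF xy] iff[symmetric] by simp
  qed (simp_all only: A extend_op_dim)
  moreover have "C \<in> carrier_mat (d ^ card Y) (d ^ card Y)" by (simp add: C_def)
  ultimately show ?thesis by (auto simp: supported_on_def)
qed

lemma supported_on_mult:
  assumes "1 \<le> d" "X \<subseteq> {..<N}" "supported_on d N X A" "supported_on d N X B"
  shows "supported_on d N X (A * B)"
  using assms extend_op_mult[OF assms(1,2)] mult_carrier_mat[of _ "d ^ card X" "d ^ card X"]
  by (auto simp: supported_on_def image_iff)

lemma supported_on_one:
  assumes "1 \<le> d" "X \<subseteq> {..<N}"
  shows "supported_on d N X (1\<^sub>m (d ^ N))"
  unfolding supported_on_def using extend_op_one[OF assms]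
  by (metis image_eqI one_carrier_mat)

lemma supported_on_add_smult:
  assumes "1 \<le> d" "supported_on d N X A" "supported_on d N X B"
  shows "supported_on d N X (A + c \<cdot>\<^sub>m B)"
proof -
  obtain A' B' where AB: "A' \<in> carrier_mat (d ^ card X) (d ^ card X)" "B' \<in> carrier_mat (d ^ card X) (d ^ card X)"
    "A = extend_op d N X A'" "B = extend_op d N X B'" using assms by (auto simp: supported_on_def)
  hence "A + c \<cdot>\<^sub>m B = extend_op d N X (A' + c \<cdot>\<^sub>m B')"
    by (simp add: extend_op_smult[OF assms(1)] extend_op_add[OF assms(1)])
  moreover have "A' + c \<cdot>\<^sub>m B' \<in> carrier_mat (d ^ card X) (d ^ card X)" using AB by auto
  ultimately show ?thesis unfolding supported_on_def by blast
qed

section \<open>Partial trace\<close>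

lemma reduced_state_carrier [simp]: "reduced_state d N X \<rho> \<in> carrier_mat (d ^ card X) (d ^ card X)"
  by (simp add: reduced_state_def)

text \<open>The duality that characterises the partial trace. Both sides are one sum over pairs of
  configurations agreeing off \<open>X\<close>; on the left the pairs are grouped by their
  restrictions to \<open>X\<close>.\<close>

lemma trace_reduced_state_mult:
  assumes d: "1 \<le> d" and X: "X \<subseteq> {..<N}" and \<rho>: "\<rho> \<in> carrier_mat (d ^ N) (d ^ N)"
    and B: "B \<in> carrier_mat (d ^ card X) (d ^ card X)"
  shows "mat_trace (reduced_state d N X \<rho> * B) = mat_trace (\<rho> * extend_op d N X B)"
proof -
  let ?r = "restrict_conf d X" and ?m = "d ^ card X"
  let ?P = "\<lambda>s t. {(x, y). x < d ^ N \<and> y < d ^ N \<and> ?r x = s \<and> ?r y = t \<and> agree_off d N X x y}"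
  let ?Q = "{(x, y). x < d ^ N \<and> y < d ^ N \<and> agree_off d N X x y}"
  have finQ: "finite ?Q" by (rule finite_subset[of _ "{..<d ^ N} \<times> {..<d ^ N}"]) auto
  have "mat_trace (reduced_state d N X \<rho> * B) =
      (\<Sum>s<?m. \<Sum>t<?m. (\<Sum>(x, y)\<in>?P s t. \<rho> $$ (x, y)) * B $$ (t, s))"
    using B by (subst mat_trace_mult[of _ ?m ?m]) (auto simp: reduced_state_def)
  also have "\<dots> = (\<Sum>(s, t)\<in>{..<?m} \<times> {..<?m}. \<Sum>p\<in>?P s t. \<rho> $$ p * B $$ (?r (snd p), ?r (fst p)))"
    unfolding sum.cartesian_product[symmetric]
    by (intro sum.cong refl) (auto simp: sum_distrib_right intro!: sum.cong)
  also have "\<dots> = (\<Sum>q\<in>{..<?m} \<times> {..<?m}. \<Sum>p\<in>{p \<in> ?Q. (?r (fst p), ?r (snd p)) = q}. \<rho> $$ p * B $$ (?r (snd p), ?r (fst p)))"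
    by (intro sum.cong refl) (auto intro!: sum.cong)
  also have "\<dots> = (\<Sum>p\<in>?Q. \<rho> $$ p * B $$ (?r (snd p), ?r (fst p)))"
    by (rule sum.group) (use finQ restrict_conf_less[OF d] in auto)
  also have "\<dots> = (\<Sum>p\<in>{..<d ^ N} \<times> {..<d ^ N}. \<rho> $$ p * extend_op d N X B $$ (snd p, fst p))"
  proof (rule sum.mono_neutral_cong_left)
    have ext: "extend_op d N X B $$ (y, x) = (if agree_off d N X x y then B $$ (?r y, ?r x) else 0)"
      if "x < d ^ N" "y < d ^ N" for x y
      using that agree_off_sym[of d N X y x] by (simp add: extend_op_index)
    show "\<forall>p\<in>{..<d ^ N} \<times> {..<d ^ N} - ?Q. \<rho> $$ p * extend_op d N X B $$ (snd p, fst p) = 0"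
      using ext by (auto split: if_splits)
    fix p assume "p \<in> ?Q"
    thus "\<rho> $$ p * B $$ (?r (snd p), ?r (fst p)) = \<rho> $$ p * extend_op d N X B $$ (snd p, fst p)"
      using ext by auto
  qed auto
  also have "\<dots> = mat_trace (\<rho> * extend_op d N X B)"
    using \<rho> by (subst mat_trace_mult[of _ "d ^ N" "d ^ N"]) (auto simp: sum.cartesian_product case_prod_beta)
  finally show ?thesis .
qed

lemma trace_reduced_state:
  assumes d: "1 \<le> d" and X: "X \<subseteq> {..<N}" and \<rho>: "\<rho> \<in> carrier_mat (d ^ N) (d ^ N)"
  shows "mat_trace (reduced_state d N X \<rho>) = mat_trace \<rho>"
  using trace_reduced_state_mult[OF assms, of "1\<^sub>m (d ^ card X)"] \<rho> extend_op_one[OF d X]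
  by (simp add: right_mult_one_mat[OF reduced_state_carrier])

lemma reduced_state_adjoint:
  assumes \<rho>: "\<rho> \<in> carrier_mat (d ^ N) (d ^ N)"
  shows "mat_adjoint (reduced_state d N X \<rho>) = reduced_state d N X (mat_adjoint \<rho>)"
proof (rule eq_matI)
  let ?r = "restrict_conf d X"
  let ?P = "\<lambda>s t. {(x, y). x < d ^ N \<and> y < d ^ N \<and> ?r x = s \<and> ?r y = t \<and> agree_off d N X x y}"
  fix s t assume "s < dim_row (reduced_state d N X (mat_adjoint \<rho>))" "t < dim_col (reduced_state d N X (mat_adjoint \<rho>))"
  hence st: "s < d ^ card X" "t < d ^ card X" by (auto simp: reduced_state_def)
  have idx: "reduced_state d N X \<tau> $$ (a, c) = (\<Sum>p\<in>?P a c. \<tau> $$ p)"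
    if "a < d ^ card X" "c < d ^ card X" for a c \<tau>
    using that by (simp add: reduced_state_def)
  have dims: "s < dim_col (reduced_state d N X \<rho>)" "t < dim_row (reduced_state d N X \<rho>)"
    using st by (auto simp: reduced_state_def)
  have "mat_adjoint (reduced_state d N X \<rho>) $$ (s, t) = (\<Sum>p\<in>?P t s. cnj (\<rho> $$ p))"
    unfolding mat_adjoint_index[OF dims] idx[OF st(2,1)] by (rule cnj_sum)
  also have "\<dots> = (\<Sum>p\<in>?P s t. mat_adjoint \<rho> $$ p)"
  proof (rule sum.reindex_bij_witness[of _ prod.swap prod.swap])
    fix p assume "p \<in> ?P t s"
    thus "prod.swap p \<in> ?P s t" "mat_adjoint \<rho> $$ prod.swap p = cnj (\<rho> $$ p)"
      using \<rho> agree_off_sym[of d N X "fst p" "snd p"] by auto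
  next
    fix p assume "p \<in> ?P s t"
    thus "prod.swap p \<in> ?P t s" using agree_off_sym[of d N X "fst p" "snd p"] by auto
  qed simp_all
  also have "\<dots> = reduced_state d N X (mat_adjoint \<rho>) $$ (s, t)"
    by (rule idx[OF st, symmetric])
  finally show "mat_adjoint (reduced_state d N X \<rho>) $$ (s, t) = reduced_state d N X (mat_adjoint \<rho>) $$ (s, t)" .
qed (auto simp: reduced_state_def)

subsection \<open>An exponential moment bound for commuting projections\<close>

definition qform :: "complex mat \<Rightarrow> complex vec \<Rightarrow> real" where
  "qform A v = Re ((A *\<^sub>v v) \<bullet>c v)"

definition proj_mat :: "nat \<Rightarrow> complex mat \<Rightarrow> bool" where
  "proj_mat n Q \<longleftrightarrow> Q \<in> carrier_mat n n \<and> Q * Q = Q \<and> mat_adjoint Q = Q"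

lemma hermitian_form_real:
  assumes "A \<in> carrier_mat n n" "mat_adjoint A = A" "v \<in> carrier_vec n"
  shows "(A *\<^sub>v v) \<bullet>c v = complex_of_real (qform A v)"
proof -
  have "(A *\<^sub>v v) \<bullet>c v = v \<bullet>c (A *\<^sub>v v)" using cscalar_adjoint[OF assms(1,3,3)] assms(2) by simp
  also have "\<dots> = cnj ((A *\<^sub>v v) \<bullet>c v)"
    using assms by (intro cscalar_commute[of _ n]) (auto intro: mult_mat_vec_carrier)
  finally show ?thesis unfolding qform_def
    by (metis Reals_cnj_iff complex_is_Real_iff of_real_Re)
qed

lemma proj_decomp:
  assumes Q: "proj_mat n Q" and v: "v \<in> carrier_vec n"
  defines "v1 \<equiv> Q *\<^sub>v v" and "v0 \<equiv> v - Q *\<^sub>v v"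
  shows "v0 \<in> carrier_vec n" "v1 \<in> carrier_vec n" "v0 + v1 = v" "Q *\<^sub>v v0 = 0\<^sub>v n" "Q *\<^sub>v v1 = v1"
proof -
  have Qc: "Q \<in> carrier_mat n n" and QQ: "Q * Q = Q" using Q by (auto simp: proj_mat_def)
  show v1: "v1 \<in> carrier_vec n" unfolding v1_def by (rule mult_mat_vec_carrier[OF Qc v])
  show v0: "v0 \<in> carrier_vec n" using v v1 by (simp add: v0_def v1_def)
  show "v0 + v1 = v" using v Qc unfolding v0_def v1_def by (intro eq_vecI) auto
  show Qv1: "Q *\<^sub>v v1 = v1" unfolding v1_def using assoc_mult_mat_vec[OF Qc Qc v] QQ by simp
  have "Q *\<^sub>v v0 = Q *\<^sub>v v - Q *\<^sub>v v1"
    unfolding v0_def v1_def using mult_minus_distrib_mat_vec[OF Qc v v1[unfolded v1_def]] by simp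
  thus "Q *\<^sub>v v0 = 0\<^sub>v n" using Qv1 v1 v1_def by simp
qed

text \<open>Commuting with \<open>Q\<close>, the matrix \<open>B\<close> preserves range and kernel
  of \<open>Q\<close>, so the cross terms vanish. For the identity this is Pythagoras.\<close>

lemma qform_split:
  assumes Q: "proj_mat n Q" and B: "B \<in> carrier_mat n n" "B * Q = Q * B" and v: "v \<in> carrier_vec n"
  shows "qform B v = qform B (v - Q *\<^sub>v v) + qform B (Q *\<^sub>v v)"
proof -
  let ?v1 = "Q *\<^sub>v v" and ?v0 = "v - Q *\<^sub>v v"
  note d = proj_decomp[OF Q v]
  have Qc: "Q \<in> carrier_mat n n" and Qadj: "mat_adjoint Q = Q" using Q by (auto simp: proj_mat_def)
  have Bc: "B *\<^sub>v u \<in> carrier_vec n" if "u \<in> carrier_vec n" for u using B that by (auto intro: mult_mat_vec_carrier)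
  have QB: "Q *\<^sub>v (B *\<^sub>v u) = B *\<^sub>v (Q *\<^sub>v u)" if "u \<in> carrier_vec n" for u
    using assoc_mult_mat_vec[OF Qc B(1) that] assoc_mult_mat_vec[OF B(1) Qc that] B(2) by simp
  have "(B *\<^sub>v ?v0) \<bullet>c ?v1 = (Q *\<^sub>v (B *\<^sub>v ?v0)) \<bullet>c v"
    using cscalar_adjoint[OF Qc Bc[OF d(1)] v] Qadj by simp
  also have "Q *\<^sub>v (B *\<^sub>v ?v0) = 0\<^sub>v n"
    unfolding QB[OF d(1)] d(4) using B(1) by (intro eq_vecI) (auto simp: scalar_prod_def)
  finally have c1: "(B *\<^sub>v ?v0) \<bullet>c ?v1 = 0" using v by simp
  have "(B *\<^sub>v ?v1) \<bullet>c ?v0 = (Q *\<^sub>v (B *\<^sub>v ?v1)) \<bullet>c ?v0"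
    using QB[OF d(2)] d(5) by simp
  also have "\<dots> = (B *\<^sub>v ?v1) \<bullet>c (Q *\<^sub>v ?v0)"
    using cscalar_adjoint[OF Qc Bc[OF d(2)] d(1)] Qadj by simp
  also have "\<dots> = 0" unfolding d(4) using Bc[OF d(2)] by (simp add: cscalar_eq_sum)
  finally have c2: "(B *\<^sub>v ?v1) \<bullet>c ?v0 = 0" .
  have "(B *\<^sub>v v) \<bullet>c v = (B *\<^sub>v ?v0 + B *\<^sub>v ?v1) \<bullet>c (?v0 + ?v1)"
    using mult_add_distrib_mat_vec[OF B(1) d(1,2)] d(3) by simp
  also have "\<dots> = (B *\<^sub>v ?v0) \<bullet>c ?v0 + (B *\<^sub>v ?v1) \<bullet>c ?v1"
    unfolding cscalar_add_left[OF Bc[OF d(1)] Bc[OF d(2)] add_carrier_vec[OF d(1,2)]]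
      cscalar_add_right[OF d(1,2) Bc[OF d(1)]] cscalar_add_right[OF d(1,2) Bc[OF d(2)]] c1 c2 by simp
  finally show ?thesis by (simp add: qform_def)
qed

lemma qform_one: "v \<in> carrier_vec n \<Longrightarrow> qform (1\<^sub>m n) v = (euclid_norm v)\<^sup>2"
  by (simp add: qform_def euclid_norm_sq)

lemma qform_add:
  assumes "A \<in> carrier_mat n n" "B \<in> carrier_mat n n" "v \<in> carrier_vec n"
  shows "qform (A + B) v = qform A v + qform B v"
  using assms unfolding qform_def
  by (simp add: add_mult_distrib_mat_vec[OF assms] cscalar_add_left[of _ n] mult_mat_vec_carrier[of _ n n])

lemma qform_zero: "v \<in> carrier_vec n \<Longrightarrow> qform (0\<^sub>m n n) v = 0"
proof -
  assume v: "v \<in> carrier_vec n"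
  have "0\<^sub>m n n *\<^sub>v v = 0\<^sub>v n" using v by (intro eq_vecI) (auto simp: scalar_prod_def)
  thus ?thesis using v by (simp add: qform_def)
qed

lemma qform_proj:
  assumes "proj_mat n Q" "v \<in> carrier_vec n"
  shows "qform Q v = (euclid_norm (Q *\<^sub>v v))\<^sup>2"
proof -
  have Q: "Q \<in> carrier_mat n n" "mat_adjoint Q = Q" using assms by (auto simp: proj_mat_def)
  note d = proj_decomp[OF assms]
  have "(Q *\<^sub>v v) \<bullet>c v = (Q *\<^sub>v (Q *\<^sub>v v)) \<bullet>c v" using d(5) by simp
  also have "\<dots> = (Q *\<^sub>v v) \<bullet>c (Q *\<^sub>v v)" using cscalar_adjoint[OF Q(1) d(2) assms(2)] Q(2) by simp
  finally show ?thesis by (simp add: qform_def euclid_norm_sq)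
qed

lemma qform_proj_le:
  assumes "proj_mat n Q" "v \<in> carrier_vec n"
  shows "qform Q v \<le> (euclid_norm v)\<^sup>2"
proof -
  have Qc: "Q \<in> carrier_mat n n" using assms by (auto simp: proj_mat_def)
  note d = proj_decomp[OF assms]
  have "(euclid_norm v)\<^sup>2 = (euclid_norm (v - Q *\<^sub>v v))\<^sup>2 + (euclid_norm (Q *\<^sub>v v))\<^sup>2"
    using qform_split[OF assms(1) one_carrier_mat _ assms(2)] Qc d(1,2) assms(2)
    by (simp add: qform_one)
  thus ?thesis using qform_proj[OF assms] by simp
qed

text \<open>For a projection \<open>Q\<close> this is \<open>exp (t * Q)\<close>, in a form from
  which its support can be read off.\<close>

definition tilt :: "nat \<Rightarrow> real \<Rightarrow> complex mat \<Rightarrow> complex mat" where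
  "tilt n t Q = 1\<^sub>m n + complex_of_real (exp t - 1) \<cdot>\<^sub>m Q"

text \<open>For commuting projections this is the exponential of \<open>t\<close> times
  \<open>proj_sum n Q m\<close>. Written as a product, it allows one factor at a time to be
  decorrelated from the earlier ones.\<close>

primrec tilt_prod :: "nat \<Rightarrow> real \<Rightarrow> (nat \<Rightarrow> complex mat) \<Rightarrow> nat \<Rightarrow> complex mat" where
  "tilt_prod n t Q 0 = 1\<^sub>m n"
| "tilt_prod n t Q (Suc m) = tilt_prod n t Q m * tilt n t (Q m)"

primrec proj_sum :: "nat \<Rightarrow> (nat \<Rightarrow> complex mat) \<Rightarrow> nat \<Rightarrow> complex mat" where
  "proj_sum n Q 0 = 0\<^sub>m n n"
| "proj_sum n Q (Suc m) = proj_sum n Q m + Q m"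

lemma tilt_carrier [simp]: "Q \<in> carrier_mat n n \<Longrightarrow> tilt n t Q \<in> carrier_mat n n"
  by (simp add: tilt_def)

lemma tilt_mult_vec:
  assumes Q: "Q \<in> carrier_mat n n" and v: "v \<in> carrier_vec n"
  shows "tilt n t Q *\<^sub>v v = v + complex_of_real (exp t - 1) \<cdot>\<^sub>v (Q *\<^sub>v v)"
proof (rule eq_vecI)
  fix i assume "i < dim_vec (v + complex_of_real (exp t - 1) \<cdot>\<^sub>v (Q *\<^sub>v v))"
  hence i: "i < n" using Q by simp
  have "(tilt n t Q *\<^sub>v v) $ i = (\<Sum>j<n. (1\<^sub>m n $$ (i, j) + complex_of_real (exp t - 1) * Q $$ (i, j)) * v $ j)"
    using i Q v by (auto simp: tilt_def scalar_prod_def atLeast0LessThan intro!: sum.cong)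
  also have "\<dots> = (\<Sum>j<n. 1\<^sub>m n $$ (i, j) * v $ j) + complex_of_real (exp t - 1) * (\<Sum>j<n. Q $$ (i, j) * v $ j)"
    by (simp only: distrib_right sum.distrib sum_distrib_left mult.assoc)
  also have "(\<Sum>j<n. 1\<^sub>m n $$ (i, j) * v $ j) = (\<Sum>j<n. if j = i then v $ j else 0)"
    using i by (intro sum.cong) auto
  also have "\<dots> = v $ i" using i by simp
  also have "(\<Sum>j<n. Q $$ (i, j) * v $ j) = (Q *\<^sub>v v) $ i"
    using i Q v by (auto simp: scalar_prod_def atLeast0LessThan intro!: sum.cong)
  finally show "(tilt n t Q *\<^sub>v v) $ i = (v + complex_of_real (exp t - 1) \<cdot>\<^sub>v (Q *\<^sub>v v)) $ i"
    using i Q v by simp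
qed (use Q in \<open>simp add: tilt_def\<close>)

lemma tilt_commute:
  assumes "Q \<in> carrier_mat n n" "R \<in> carrier_mat n n" "Q * R = R * Q"
  shows "tilt n t Q * R = R * tilt n t Q"
proof -
  let ?a = "complex_of_real (exp t - 1)"
  have "tilt n t Q * R = 1\<^sub>m n * R + ?a \<cdot>\<^sub>m Q * R"
    unfolding tilt_def using assms by (intro add_mult_distrib_mat[of _ n n]) auto
  also have "\<dots> = R * 1\<^sub>m n + R * (?a \<cdot>\<^sub>m Q)"
    unfolding mult_smult_assoc_mat[OF assms(1,2)] mult_smult_distrib[OF assms(2,1)] assms(3) using assms by simp
  also have "\<dots> = R * tilt n t Q"
    unfolding tilt_def using assms by (intro mult_add_distrib_mat[of _ n n, symmetric]) auto
  finally show ?thesis .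
qed

lemma tilt_prod_carrier:
  "(\<And>j. j < m \<Longrightarrow> Q j \<in> carrier_mat n n) \<Longrightarrow> tilt_prod n t Q m \<in> carrier_mat n n"
  by (induction m) (auto intro!: mult_carrier_mat[of _ n n])

lemma proj_sum_carrier:
  "(\<And>j. j < m \<Longrightarrow> Q j \<in> carrier_mat n n) \<Longrightarrow> proj_sum n Q m \<in> carrier_mat n n"
  by (induction m) auto

lemma tilt_prod_commute:
  assumes "\<And>j. j < m \<Longrightarrow> Q j \<in> carrier_mat n n" "R \<in> carrier_mat n n" "\<And>j. j < m \<Longrightarrow> Q j * R = R * Q j"
  shows "tilt_prod n t Q m * R = R * tilt_prod n t Q m"
  using assms
proof (induction m)
  case (Suc m)
  have F: "tilt_prod n t Q m \<in> carrier_mat n n" and Qm: "tilt n t (Q m) \<in> carrier_mat n n" and R: "R \<in> carrier_mat n n"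
    using Suc.prems by (auto intro: tilt_prod_carrier)
  have "tilt_prod n t Q (Suc m) * R = tilt_prod n t Q m * (tilt n t (Q m) * R)"
    using assoc_mult_mat[OF F Qm R] by simp
  also have "tilt n t (Q m) * R = R * tilt n t (Q m)" using Suc.prems by (intro tilt_commute) auto
  also have "tilt_prod n t Q m * (R * tilt n t (Q m)) = tilt_prod n t Q m * R * tilt n t (Q m)"
    using assoc_mult_mat[OF F R Qm] by simp
  also have "tilt_prod n t Q m * R = R * tilt_prod n t Q m" using Suc by auto
  also have "R * tilt_prod n t Q m * tilt n t (Q m) = R * tilt_prod n t Q (Suc m)"
    using assoc_mult_mat[OF R F Qm] by simp
  finally show ?case .
qed simp

lemma proj_sum_commute:
  assumes "\<And>j. j < m \<Longrightarrow> Q j \<in> carrier_mat n n" "R \<in> carrier_mat n n" "\<And>j. j < m \<Longrightarrow> Q j * R = R * Q j"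
  shows "proj_sum n Q m * R = R * proj_sum n Q m"
  using assms
proof (induction m)
  case (Suc m)
  have S: "proj_sum n Q m \<in> carrier_mat n n" and Qm: "Q m \<in> carrier_mat n n" and R: "R \<in> carrier_mat n n"
    using Suc.prems by (auto intro: proj_sum_carrier)
  show ?case using Suc add_mult_distrib_mat[OF S Qm R] mult_add_distrib_mat[OF R S Qm] by simp
qed simp

text \<open>
  For commuting projections \<open>Q j\<close> with sum \<open>S\<close> this is the tangent line inequality
  \<open>exp (t * S) \<ge> exp c * (1 + t * S - c)\<close>; splitting along the last projection
  replaces \<open>c\<close> by \<open>c\<close> and \<open>c - t\<close> and avoids a joint diagonalisation.
\<close>

lemma tilt_prod_tangent:
  assumes "\<And>j. j < m \<Longrightarrow> proj_mat n (Q j)" "\<And>i j. i < m \<Longrightarrow> j < m \<Longrightarrow> Q i * Q j = Q j * Q i"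
    and "v \<in> carrier_vec n"
  shows "exp c * ((1 - c) * (euclid_norm v)\<^sup>2 + t * qform (proj_sum n Q m) v) \<le> qform (tilt_prod n t Q m) v"
  using assms
proof (induction m arbitrary: c v)
  case 0
  have "exp c * (1 - c) \<le> 1"
  proof -
    have "1 - c \<le> exp (- c)" using exp_ge_add_one_self[of "- c"] by simp
    hence "exp c * (1 - c) \<le> exp c * exp (- c)" by (intro mult_left_mono) auto
    thus ?thesis by (simp flip: exp_add)
  qed
  hence "exp c * (1 - c) * (euclid_norm v)\<^sup>2 \<le> 1 * (euclid_norm v)\<^sup>2" by (rule mult_right_mono) simp
  thus ?case using 0 by (simp add: qform_one qform_zero mult_ac)
next
  case (Suc m)
  let ?F = "tilt_prod n t Q m" and ?S = "proj_sum n Q m" and ?Q = "Q m"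
  let ?F' = "tilt_prod n t Q (Suc m)" and ?S' = "proj_sum n Q (Suc m)"
  note v = Suc.prems(3)
  have Qj: "Q j \<in> carrier_mat n n" if "j < Suc m" for j using Suc.prems(1)[OF that] by (auto simp: proj_mat_def)
  have P: "proj_mat n ?Q" using Suc.prems(1) by simp
  have Qc: "?Q \<in> carrier_mat n n" using Qj by simp
  have Fc: "?F \<in> carrier_mat n n" and Sc: "?S \<in> carrier_mat n n"
    and Fc': "?F' \<in> carrier_mat n n" and Sc': "?S' \<in> carrier_mat n n"
    using Qj by (auto intro: tilt_prod_carrier proj_sum_carrier simp del: tilt_prod.simps proj_sum.simps)
  have Fcomm: "?F' * ?Q = ?Q * ?F'" using Suc.prems(2) Qj by (intro tilt_prod_commute) auto
  have Scomm: "?S' * ?Q = ?Q * ?S'" using Suc.prems(2) Qj by (intro proj_sum_commute) auto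
  note d = proj_decomp[OF P v]
  let ?v1 = "?Q *\<^sub>v v" and ?v0 = "v - ?Q *\<^sub>v v"
  have tv: "tilt n t ?Q *\<^sub>v u = u + complex_of_real (exp t - 1) \<cdot>\<^sub>v (?Q *\<^sub>v u)" if "u \<in> carrier_vec n" for u
    by (rule tilt_mult_vec[OF Qc that])
  have F'v: "?F' *\<^sub>v u = ?F *\<^sub>v (tilt n t ?Q *\<^sub>v u)" if "u \<in> carrier_vec n" for u
    using assoc_mult_mat_vec[OF Fc tilt_carrier[OF Qc] that] by simp
  have t0: "tilt n t ?Q *\<^sub>v ?v0 = ?v0" unfolding tv[OF d(1)] d(4) using v Qc by (intro eq_vecI) auto
  have t1: "tilt n t ?Q *\<^sub>v ?v1 = complex_of_real (exp t) \<cdot>\<^sub>v ?v1"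
    unfolding tv[OF d(2)] d(5) using d(2) Qc by (intro eq_vecI) (auto simp: algebra_simps)
  have F0: "qform ?F' ?v0 = qform ?F ?v0" unfolding qform_def F'v[OF d(1)] t0 ..
  have F1: "qform ?F' ?v1 = exp t * qform ?F ?v1"
    unfolding qform_def F'v[OF d(2)] t1 mult_mat_vec[OF Fc d(2)]
      cscalar_smult_left[OF mult_mat_vec_carrier[OF Fc d(2)] d(2)] by simp
  have q0: "qform ?Q ?v0 = 0" unfolding qform_def d(4) using d(1) by simp
  have q1: "qform ?Q ?v1 = (euclid_norm ?v1)\<^sup>2" unfolding qform_def d(5) by (simp add: euclid_norm_sq)
  have S0: "qform ?S' ?v0 = qform ?S ?v0" using qform_add[OF Sc Qc d(1)] q0 by simp
  have S1: "qform ?S' ?v1 = qform ?S ?v1 + (euclid_norm ?v1)\<^sup>2" using qform_add[OF Sc Qc d(2)] q1 by simp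
  have nv: "(euclid_norm v)\<^sup>2 = (euclid_norm ?v0)\<^sup>2 + (euclid_norm ?v1)\<^sup>2"
    using qform_split[OF P one_carrier_mat _ v] Qc d(1,2) v by (simp add: qform_one)
  have IH: "exp c * ((1 - c) * (euclid_norm u)\<^sup>2 + t * qform ?S u) \<le> qform ?F u" if "u \<in> carrier_vec n" for c u
    using Suc.prems by (intro Suc.IH that) auto
  \<comment> \<open>On the range of the last projection the new factor is the scalar
    \<open>exp t\<close> and the sum of projections grows by 1; multiplying the tangent at
    \<open>c - t\<close> by \<open>exp t\<close> restores the prefactor
    \<open>exp c\<close>.\<close>
  have "exp t * (exp (c - t) * ((1 - (c - t)) * (euclid_norm ?v1)\<^sup>2 + t * qform ?S ?v1)) \<le> exp t * qform ?F ?v1"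
    by (intro mult_left_mono IH d) simp
  hence "exp c * ((1 - (c - t)) * (euclid_norm ?v1)\<^sup>2 + t * qform ?S ?v1) \<le> exp t * qform ?F ?v1"
    unfolding mult.assoc[symmetric] exp_add[symmetric] by simp
  moreover have "exp c * ((1 - c) * (euclid_norm ?v0)\<^sup>2 + t * qform ?S ?v0) \<le> qform ?F ?v0"
    by (rule IH[OF d(1)])
  ultimately have "exp c * ((1 - c) * (euclid_norm ?v0)\<^sup>2 + t * qform ?S ?v0) +
      exp c * ((1 - (c - t)) * (euclid_norm ?v1)\<^sup>2 + t * qform ?S ?v1) \<le> qform ?F' v"
    unfolding qform_split[OF P Fc' Fcomm v] F0 F1 by simp
  moreover have "exp c * ((1 - c) * (euclid_norm v)\<^sup>2 + t * qform ?S' v) =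
      exp c * ((1 - c) * (euclid_norm ?v0)\<^sup>2 + t * qform ?S ?v0) +
      exp c * ((1 - (c - t)) * (euclid_norm ?v1)\<^sup>2 + t * qform ?S ?v1)"
    unfolding qform_split[OF P Sc' Scomm v] S0 S1 nv by (simp add: algebra_simps)
  ultimately show ?case by simp
qed

section \<open>Exponential moments in the two states\<close>

lemma trace_spec_real:
  assumes "U \<in> carrier_mat n n" "X \<in> carrier_mat n n"
  shows "Re (mat_trace (real_spec_mat n U w * X)) = (\<Sum>i<n. w i * qform X (col U i))"
  unfolding trace_spec_mat_mult[OF assms] by (simp add: qform_def)

text \<open>Makes the expectation of a single projection a real factor, so that the real part of a
  product of traces factorises.\<close>

lemma trace_spec_hermitian:
  assumes "U \<in> carrier_mat n n" "X \<in> carrier_mat n n" "mat_adjoint X = X"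
  shows "mat_trace (real_spec_mat n U w * X) =
    complex_of_real (Re (mat_trace (real_spec_mat n U w * X)))"
proof -
  have "mat_trace (real_spec_mat n U w * X) = complex_of_real (\<Sum>i<n. w i * qform X (col U i))"
    unfolding trace_spec_mat_mult[OF assms(1,2)] using assms
    by (simp add: hermitian_form_real[OF assms(2,3)])
  thus ?thesis by simp
qed

lemma unitary_col_norm:
  assumes "unitary_mat n U" "i < n"
  shows "euclid_norm (col U i) = 1"
proof -
  have "(euclid_norm (col U i))\<^sup>2 = 1" using unitary_col_inner[OF assms assms(2)] by (simp add: euclid_norm_sq)
  hence "euclid_norm (col U i) = 1 \<or> euclid_norm (col U i) = - 1" by (simp only: power2_eq_1_iff)
  thus ?thesis using euclid_norm_nonneg[of "col U i"] by linarith
qed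

text \<open>Jensen's inequality followed by the domination of \<open>w\<close> by
  \<open>lam * g\<close>, both in the eigenbasis of the Hamiltonian: the tangent line inequality is
  averaged over the columns of \<open>U\<close> with weights \<open>w\<close>.\<close>

lemma tilt_prod_chernoff:
  assumes U: "unitary_mat n U"
    and w: "\<And>i. i < n \<Longrightarrow> 0 \<le> w i" "\<And>i. i < n \<Longrightarrow> w i \<le> lam * g i" "(\<Sum>i<n. w i) = 1"
    and Q: "\<And>j. j < m \<Longrightarrow> proj_mat n (Q j)" "\<And>i j. i < m \<Longrightarrow> j < m \<Longrightarrow> Q i * Q j = Q j * Q i"
    and t: "0 \<le> t"
  shows "exp (t * (\<Sum>j<m. Re (mat_trace (real_spec_mat n U w * Q j))))
    \<le> lam * Re (mat_trace (real_spec_mat n U g * tilt_prod n t Q m))"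
proof -
  note Uc = unitary_matD(1)[OF U]
  let ?F = "tilt_prod n t Q m" and ?S = "proj_sum n Q m"
  have Qj: "Q j \<in> carrier_mat n n" if "j < m" for j using Q(1)[OF that] by (auto simp: proj_mat_def)
  have Fc: "?F \<in> carrier_mat n n" and Sc: "?S \<in> carrier_mat n n"
    using Qj by (auto intro: tilt_prod_carrier proj_sum_carrier)
  have uc: "col U i \<in> carrier_vec n" if "i < n" for i using Uc that by auto
  have qS: "qform (proj_sum n Q k) v = (\<Sum>j<k. qform (Q j) v)" if "k \<le> m" "v \<in> carrier_vec n" for k v
    using that
  proof (induction k)
    case (Suc k)
    have "proj_sum n Q k \<in> carrier_mat n n" "Q k \<in> carrier_mat n n" using Suc Qj by (auto intro: proj_sum_carrier)
    thus ?case using Suc by (simp add: qform_add)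
  qed (simp add: qform_zero)
  have qS0: "0 \<le> qform ?S v" if "v \<in> carrier_vec n" for v
    unfolding qS[OF order.refl that] using qform_proj[OF Q(1) that] by (intro sum_nonneg) simp
  \<comment> \<open>The point of tangency is the mean itself; on averaging the linear terms cancel
    and exactly \<open>exp c\<close> is left.\<close>
  define c where "c = t * (\<Sum>j<m. Re (mat_trace (real_spec_mat n U w * Q j)))"
  have cw: "(\<Sum>i<n. w i * (t * qform ?S (col U i))) = c"
  proof -
    have "c = t * (\<Sum>j<m. \<Sum>i<n. w i * qform (Q j) (col U i))"
      unfolding c_def using Qj by (simp add: trace_spec_real[OF Uc])
    also have "(\<Sum>j<m. \<Sum>i<n. w i * qform (Q j) (col U i)) = (\<Sum>i<n. \<Sum>j<m. w i * qform (Q j) (col U i))"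
      by (rule sum.swap)
    also have "\<dots> = (\<Sum>i<n. w i * qform ?S (col U i))"
      using uc qS[OF order.refl] by (intro sum.cong) (auto simp: sum_distrib_left)
    finally show ?thesis by (simp add: sum_distrib_left mult_ac)
  qed
  \<comment> \<open>Replacing \<open>w\<close> by \<open>lam * g\<close> requires nonnegative forms.
    At tangency point 1 the constant term of the tangent vanishes, and the rest is visibly
    nonnegative.\<close>
  have F0: "0 \<le> qform ?F (col U i)" if i: "i < n" for i
  proof -
    have "0 \<le> exp 1 * ((1 - 1) * (euclid_norm (col U i))\<^sup>2 + t * qform ?S (col U i))"
      using qS0[OF uc[OF i]] t by simp
    also have "\<dots> \<le> qform ?F (col U i)" by (intro tilt_prod_tangent Q uc i) auto
    finally show ?thesis .
  qed
  have "exp c = (\<Sum>i<n. w i) * (exp c * (1 - c)) + exp c * (\<Sum>i<n. w i * (t * qform ?S (col U i)))"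
    unfolding w(3) cw by (simp add: algebra_simps)
  also have "\<dots> = (\<Sum>i<n. w i * (exp c * ((1 - c) * (euclid_norm (col U i))\<^sup>2 + t * qform ?S (col U i))))"
    unfolding sum_distrib_left sum_distrib_right sum.distrib[symmetric]
    by (intro sum.cong refl) (simp add: unitary_col_norm[OF U] algebra_simps)
  also have "\<dots> \<le> (\<Sum>i<n. w i * qform ?F (col U i))"
    using w(1) Q uc by (intro sum_mono mult_left_mono tilt_prod_tangent) auto
  also have "\<dots> \<le> (\<Sum>i<n. (lam * g i) * qform ?F (col U i))"
    using w(2) F0 by (intro sum_mono mult_right_mono) auto
  also have "\<dots> = lam * Re (mat_trace (real_spec_mat n U g * ?F))"
    unfolding trace_spec_real[OF Uc Fc] by (simp add: sum_distrib_left mult_ac)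
  finally show ?thesis unfolding c_def .
qed

lemma euclid_norm_unit_vec: "0 < n \<Longrightarrow> euclid_norm (unit_vec n 0) = 1"
proof -
  assume n: "0 < n"
  have "(\<Sum>i<n. (cmod (unit_vec n 0 $ i))\<^sup>2) = (\<Sum>i<n. if i = 0 then 1 else 0)"
    by (intro sum.cong) auto
  thus ?thesis using n by (simp add: euclid_norm_def)
qed

lemma op_norm_le:
  assumes "A \<in> carrier_mat n n" "0 < n" "\<And>v. v \<in> carrier_vec n \<Longrightarrow> euclid_norm (A *\<^sub>v v) \<le> c * euclid_norm v"
  shows "op_norm A \<le> c"
  unfolding op_norm_def
proof (rule cSUP_least)
  have "euclid_norm (unit_vec n 0) = 1" by (rule euclid_norm_unit_vec[OF assms(2)])
  thus "{v \<in> carrier_vec (dim_col A). euclid_norm v = 1} \<noteq> {}"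
    using assms(1) by (auto intro!: exI[of _ "unit_vec n 0"])
  fix v assume "v \<in> {v \<in> carrier_vec (dim_col A). euclid_norm v = 1}"
  thus "euclid_norm (A *\<^sub>v v) \<le> c" using assms(1) assms(3)[of v] by auto
qed

text \<open>The operator is 1 on the kernel and \<open>exp t\<close> on the range of
  \<open>Q\<close>, and the two components are orthogonal.\<close>

lemma tilt_norm:
  assumes Q: "proj_mat n Q" and t: "0 \<le> t" and v: "v \<in> carrier_vec n"
  shows "euclid_norm (tilt n t Q *\<^sub>v v) \<le> exp t * euclid_norm v"
proof -
  have Qc: "Q \<in> carrier_mat n n" and Qadj: "mat_adjoint Q = Q" using Q by (auto simp: proj_mat_def)
  note d = proj_decomp[OF Q v]
  let ?v1 = "Q *\<^sub>v v" and ?v0 = "v - Q *\<^sub>v v"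
  have pyth: "(euclid_norm u)\<^sup>2 = (euclid_norm (u - Q *\<^sub>v u))\<^sup>2 + (euclid_norm (Q *\<^sub>v u))\<^sup>2" if u: "u \<in> carrier_vec n" for u
    using qform_split[OF Q one_carrier_mat _ u] Qc proj_decomp(1,2)[OF Q u] u by (simp add: qform_one)
  have tv: "tilt n t Q *\<^sub>v v = v + complex_of_real (exp t - 1) \<cdot>\<^sub>v ?v1"
    by (rule tilt_mult_vec[OF Qc v])
  have tvc: "tilt n t Q *\<^sub>v v \<in> carrier_vec n" unfolding tv using v d(2) by auto
  have Qt: "Q *\<^sub>v (tilt n t Q *\<^sub>v v) = complex_of_real (exp t) \<cdot>\<^sub>v ?v1"
  proof -
    have "Q *\<^sub>v (tilt n t Q *\<^sub>v v) = Q *\<^sub>v v + Q *\<^sub>v (complex_of_real (exp t - 1) \<cdot>\<^sub>v ?v1)"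
      unfolding tv using v d(2) by (intro mult_add_distrib_mat_vec[OF Qc]) auto
    also have "Q *\<^sub>v (complex_of_real (exp t - 1) \<cdot>\<^sub>v ?v1) = complex_of_real (exp t - 1) \<cdot>\<^sub>v ?v1"
      unfolding mult_mat_vec[OF Qc d(2)] d(5) ..
    finally show ?thesis using d(2) Qc by (intro eq_vecI) (auto simp: algebra_simps)
  qed
  have t0: "tilt n t Q *\<^sub>v v - complex_of_real (exp t) \<cdot>\<^sub>v ?v1 = ?v0"
    unfolding tv using v d(2) Qc by (intro eq_vecI) (auto simp: algebra_simps)
  have sm: "euclid_norm (complex_of_real (exp t) \<cdot>\<^sub>v ?v1) = exp t * euclid_norm ?v1"
  proof -
    have "(euclid_norm (complex_of_real (exp t) \<cdot>\<^sub>v ?v1))\<^sup>2 = (exp t * euclid_norm ?v1)\<^sup>2"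
      unfolding euclid_norm_def by (simp add: sum_nonneg power_mult_distrib sum_distrib_left norm_mult)
    thus ?thesis by (rule power2_eq_imp_eq) auto
  qed
  have "(euclid_norm (tilt n t Q *\<^sub>v v))\<^sup>2 = (euclid_norm ?v0)\<^sup>2 + (exp t)\<^sup>2 * (euclid_norm ?v1)\<^sup>2"
    using pyth[OF tvc] unfolding Qt t0 sm by (simp add: power_mult_distrib)
  also have "\<dots> \<le> (exp t)\<^sup>2 * (euclid_norm ?v0)\<^sup>2 + (exp t)\<^sup>2 * (euclid_norm ?v1)\<^sup>2"
    using t mult_right_mono[of 1 "(exp t)\<^sup>2" "(euclid_norm ?v0)\<^sup>2"] by (simp add: one_le_power)
  also have "\<dots> = (exp t * euclid_norm v)\<^sup>2"
    using pyth[OF v] by (simp add: power_mult_distrib algebra_simps)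
  finally show ?thesis by (rule power2_le_imp_le) simp
qed

text \<open>The growth \<open>exp (t * m)\<close> is the price of applying decay of correlations to
  a product of \<open>m\<close> factors; the separation of the cubes has to compensate for
  it.\<close>

lemma tilt_prod_norm:
  assumes "\<And>j. j < m \<Longrightarrow> proj_mat n (Q j)" "0 \<le> t" "v \<in> carrier_vec n"
  shows "euclid_norm (tilt_prod n t Q m *\<^sub>v v) \<le> exp (t * m) * euclid_norm v"
  using assms
proof (induction m arbitrary: v)
  case (Suc m)
  have Qj: "Q j \<in> carrier_mat n n" if "j < Suc m" for j using Suc.prems(1)[OF that] by (auto simp: proj_mat_def)
  have F: "tilt_prod n t Q m \<in> carrier_mat n n" and T: "tilt n t (Q m) \<in> carrier_mat n n"
    using Qj by (auto intro: tilt_prod_carrier)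
  have Tv: "tilt n t (Q m) *\<^sub>v v \<in> carrier_vec n" using T Suc.prems by (auto intro: mult_mat_vec_carrier)
  have "euclid_norm (tilt_prod n t Q (Suc m) *\<^sub>v v) = euclid_norm (tilt_prod n t Q m *\<^sub>v (tilt n t (Q m) *\<^sub>v v))"
    using assoc_mult_mat_vec[OF F T Suc.prems(3)] by simp
  also have "\<dots> \<le> exp (t * m) * euclid_norm (tilt n t (Q m) *\<^sub>v v)" using Suc Tv by auto
  also have "\<dots> \<le> exp (t * m) * (exp t * euclid_norm v)"
    using Suc.prems by (intro mult_left_mono tilt_norm) auto
  also have "\<dots> = exp (t * Suc m) * euclid_norm v" by (simp add: algebra_simps exp_add)
  finally show ?case .
qed simp

text \<open>The moment generating function of nearly independent events. Splitting off one factor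
  costs \<open>\<eta>\<close>, and the factor itself contributes \<open>1 + (exp t - 1) * p\<close>,
  which is at most the corresponding exponential.\<close>

lemma tilt_prod_trace_le:
  assumes U: "unitary_mat n U" and g: "\<And>i. i < n \<Longrightarrow> 0 \<le> g i" "(\<Sum>i<n. g i) = 1"
    and Q: "\<And>j. j < m \<Longrightarrow> proj_mat n (Q j)" and t: "0 \<le> t" and \<eta>: "0 \<le> \<eta>"
    and \<tau>: "\<tau> = real_spec_mat n U g"
    and decay: "\<And>j. j < m \<Longrightarrow> cmod (mat_trace (\<tau> * tilt_prod n t Q j * tilt n t (Q j)) -
        mat_trace (\<tau> * tilt_prod n t Q j) * mat_trace (\<tau> * tilt n t (Q j))) \<le> \<eta>"
  shows "Re (mat_trace (\<tau> * tilt_prod n t Q m)) \<le> exp ((exp t - 1) * (\<Sum>j<m. Re (mat_trace (\<tau> * Q j)))) * (1 + m * \<eta>)"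
  using Q decay
proof (induction m)
  case 0
  have "\<tau> * 1\<^sub>m n = \<tau>" unfolding \<tau> using unitary_matD(1)[OF U] by (intro right_mult_one_mat[of _ n n]) auto
  thus ?case using trace_spec_mat[OF U] g(2) by (simp add: \<tau> flip: of_real_sum)
next
  case (Suc m)
  note Uc = unitary_matD(1)[OF U]
  let ?F = "tilt_prod n t Q m" and ?T = "tilt n t (Q m)"
  have Qj: "Q j \<in> carrier_mat n n" if "j < Suc m" for j using Suc.prems(1)[OF that] by (auto simp: proj_mat_def)
  have F: "?F \<in> carrier_mat n n" and T: "?T \<in> carrier_mat n n" and Qm: "Q m \<in> carrier_mat n n"
    and \<tau>c: "\<tau> \<in> carrier_mat n n"
    using Qj Uc by (auto intro: tilt_prod_carrier simp: \<tau>)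
  define p where "p j = Re (mat_trace (\<tau> * Q j))" for j
  have p0: "0 \<le> p j" if "j < Suc m" for j
    unfolding p_def \<tau> trace_spec_real[OF Uc Qj[OF that]]
    using g(1) Uc qform_proj[OF Suc.prems(1)[OF that]] by (intro sum_nonneg mult_nonneg_nonneg) auto
  have trT: "mat_trace (\<tau> * ?T) = complex_of_real (1 + (exp t - 1) * p m)"
  proof -
    have "\<tau> * ?T = \<tau> * 1\<^sub>m n + \<tau> * (complex_of_real (exp t - 1) \<cdot>\<^sub>m Q m)"
      unfolding tilt_def using \<tau>c Qm by (intro mult_add_distrib_mat[of _ n n]) auto
    also have "\<dots> = \<tau> + complex_of_real (exp t - 1) \<cdot>\<^sub>m (\<tau> * Q m)"
      using \<tau>c Qm by (simp add: mult_smult_distrib[of _ n n])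
    finally have "mat_trace (\<tau> * ?T) = mat_trace \<tau> + complex_of_real (exp t - 1) * mat_trace (\<tau> * Q m)"
      using \<tau>c Qm by (simp add: mat_trace_add[of _ n] mat_trace_smult[of _ n])
    moreover have "mat_trace \<tau> = 1" unfolding \<tau> trace_spec_mat[OF U] using g(2) by (simp flip: of_real_sum)
    moreover have "mat_trace (\<tau> * Q m) = complex_of_real (p m)"
      unfolding p_def using trace_spec_hermitian[OF Uc Qm, of g] Suc.prems(1)[of m] by (simp add: proj_mat_def \<tau>)
    ultimately show ?thesis by simp
  qed
  let ?E = "Re (mat_trace (\<tau> * ?F))" and ?s = "(exp t - 1) * (\<Sum>j<m. p j)"
  have et: "0 \<le> exp t - 1" using t by simp
  have "Re (mat_trace (\<tau> * tilt_prod n t Q (Suc m))) = Re (mat_trace (\<tau> * ?F * ?T))"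
    using assoc_mult_mat[OF \<tau>c F T] by simp
  also have "\<dots> \<le> Re (mat_trace (\<tau> * ?F) * mat_trace (\<tau> * ?T)) + \<eta>"
    using complex_Re_le_cmod[of "mat_trace (\<tau> * ?F * ?T) - mat_trace (\<tau> * ?F) * mat_trace (\<tau> * ?T)"]
      Suc.prems(2)[of m] by simp
  finally have step: "Re (mat_trace (\<tau> * tilt_prod n t Q (Suc m))) \<le>
      Re (mat_trace (\<tau> * ?F) * mat_trace (\<tau> * ?T)) + \<eta>" .
  have "Re (mat_trace (\<tau> * ?F) * mat_trace (\<tau> * ?T)) = ?E * (1 + (exp t - 1) * p m)"
    unfolding trT by simp
  also have "\<dots> \<le> (exp ?s * (1 + m * \<eta>)) * (1 + (exp t - 1) * p m)"
  proof (rule mult_right_mono)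
    show "?E \<le> exp ?s * (1 + m * \<eta>)" using Suc by (simp add: p_def)
    show "0 \<le> 1 + (exp t - 1) * p m" using et p0[of m] by (intro add_nonneg_nonneg mult_nonneg_nonneg) auto
  qed
  also have "\<dots> \<le> (exp ?s * (1 + m * \<eta>)) * exp ((exp t - 1) * p m)"
    using \<eta> by (intro mult_left_mono exp_ge_add_one_self) auto
  also have "\<dots> = exp ((exp t - 1) * (\<Sum>j<Suc m. p j)) * (1 + m * \<eta>)"
  proof -
    have "(exp t - 1) * (\<Sum>j<Suc m. p j) = ?s + (exp t - 1) * p m" by (simp add: algebra_simps)
    thus ?thesis by (simp only: exp_add mult_ac)
  qed
  finally have "Re (mat_trace (\<tau> * tilt_prod n t Q (Suc m))) \<le>
      exp ((exp t - 1) * (\<Sum>j<Suc m. p j)) * (1 + m * \<eta>) + \<eta>" using step by linarith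
  \<comment> \<open>The exponential is at least 1, so the additive \<open>\<eta>\<close> can be
    placed under it; in this way all errors collect in one factor.\<close>
  also have "\<dots> \<le> exp ((exp t - 1) * (\<Sum>j<Suc m. p j)) * (1 + Suc m * \<eta>)"
  proof -
    have "0 \<le> (\<Sum>j<Suc m. p j)" using p0 by (intro sum_nonneg) auto
    hence "1 \<le> exp ((exp t - 1) * (\<Sum>j<Suc m. p j))" using et by simp
    hence "1 * \<eta> \<le> exp ((exp t - 1) * (\<Sum>j<Suc m. p j)) * \<eta>" using \<eta> by (intro mult_right_mono) auto
    thus ?thesis by (simp add: algebra_simps)
  qed
  finally show ?case unfolding p_def .
qed

text \<open>Takes logarithms of the two moment bounds. The loss \<open>m * t\<close> is the second
  order term in \<open>exp t - 1 \<le> t + t * t\<close>, valid for \<open>t \<le> 1\<close>, with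
  each expectation of a projection at most 1.\<close>

lemma chernoff_deviation:
  assumes U: "unitary_mat n U"
    and w: "\<And>i. i < n \<Longrightarrow> 0 \<le> w i" "\<And>i. i < n \<Longrightarrow> w i \<le> lam * g i" "(\<Sum>i<n. w i) = 1"
    and g: "\<And>i. i < n \<Longrightarrow> 0 \<le> g i" "(\<Sum>i<n. g i) = 1"
    and Q: "\<And>j. j < m \<Longrightarrow> proj_mat n (Q j)" "\<And>i j. i < m \<Longrightarrow> j < m \<Longrightarrow> Q i * Q j = Q j * Q i"
    and t: "0 < t" "t \<le> 1" and \<eta>: "0 \<le> \<eta>"
    and \<tau>: "\<tau> = real_spec_mat n U g"
    and \<omega>: "\<omega> = real_spec_mat n U w"
    and decay: "\<And>j. j < m \<Longrightarrow> cmod (mat_trace (\<tau> * tilt_prod n t Q j * tilt n t (Q j)) -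
        mat_trace (\<tau> * tilt_prod n t Q j) * mat_trace (\<tau> * tilt n t (Q j))) \<le> \<eta>"
  shows "(\<Sum>j<m. Re (mat_trace (\<omega> * Q j)) - Re (mat_trace (\<tau> * Q j))) \<le> ln lam / t + m * t + m * \<eta> / t"
proof -
  note Uc = unitary_matD(1)[OF U]
  define p where "p j = Re (mat_trace (\<tau> * Q j))" for j
  define r where "r j = Re (mat_trace (\<omega> * Q j))" for j
  have Qj: "Q j \<in> carrier_mat n n" if "j < m" for j using Q(1)[OF that] by (auto simp: proj_mat_def)
  have p1: "p j \<le> 1" if "j < m" for j
  proof -
    have "p j \<le> (\<Sum>i<n. g i * 1)"
      unfolding p_def \<tau> trace_spec_real[OF Uc Qj[OF that]]
    proof (intro sum_mono mult_left_mono)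
      fix i assume i: "i \<in> {..<n}"
      thus "qform (Q j) (col U i) \<le> 1"
        using qform_proj_le[OF Q(1)[OF that], of "col U i"] unitary_col_norm[OF U, of i] Uc by auto
      show "0 \<le> g i" using g(1) i by simp
    qed
    thus ?thesis using g(2) by simp
  qed
  \<comment> \<open>A nonpositive factor cannot dominate weights of total 1; this licenses the
    logarithm of \<open>lam\<close>.\<close>
  have lam: "0 < lam"
  proof (rule ccontr)
    assume "\<not> 0 < lam"
    hence "w i \<le> 0" if "i < n" for i using w(2)[OF that] g(1)[OF that] mult_nonpos_nonneg[of lam "g i"] by linarith
    hence "(\<Sum>i<n. w i) \<le> 0" by (intro sum_nonpos) auto
    thus False using w(3) by simp
  qed
  have "exp (t * (\<Sum>j<m. r j)) \<le> lam * Re (mat_trace (\<tau> * tilt_prod n t Q m))"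
    unfolding r_def \<omega> \<tau> using t by (intro tilt_prod_chernoff U w Q) auto
  also have "\<dots> \<le> lam * (exp ((exp t - 1) * (\<Sum>j<m. p j)) * (1 + m * \<eta>))"
    unfolding p_def using lam t \<eta> by (intro mult_left_mono tilt_prod_trace_le[OF U g Q(1) _ _ \<tau>] decay) auto
  finally have le: "exp (t * (\<Sum>j<m. r j)) \<le> lam * (exp ((exp t - 1) * (\<Sum>j<m. p j)) * (1 + m * \<eta>))" .
  have pos: "0 < 1 + m * \<eta>" using \<eta> by (intro add_pos_nonneg) auto
  have "t * (\<Sum>j<m. r j) \<le> ln (lam * (exp ((exp t - 1) * (\<Sum>j<m. p j)) * (1 + m * \<eta>)))"
    using le lam pos by (subst ln_ge_iff) auto
  also have "\<dots> = ln lam + (exp t - 1) * (\<Sum>j<m. p j) + ln (1 + m * \<eta>)"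
    using lam pos by (simp add: ln_mult_pos)
  also have "ln (1 + m * \<eta>) \<le> m * \<eta>" using ln_add_one_self_le_self[of "m * \<eta>"] \<eta> by simp
  also have "(exp t - 1) * (\<Sum>j<m. p j) \<le> t * (\<Sum>j<m. p j) + t\<^sup>2 * m"
  proof -
    have "0 \<le> p j" if "j < m" for j
      unfolding p_def \<tau> trace_spec_real[OF Uc Qj[OF that]]
      using g(1) Uc qform_proj[OF Q(1)[OF that]] by (intro sum_nonneg mult_nonneg_nonneg) auto
    hence P0: "0 \<le> (\<Sum>j<m. p j)" by (intro sum_nonneg) auto
    have P1: "(\<Sum>j<m. p j) \<le> m" using sum_mono[of "{..<m}" p "\<lambda>_. 1"] p1 by simp
    have "exp t - 1 \<le> t + t\<^sup>2" using exp_bound[of t] t by simp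
    hence "(exp t - 1) * (\<Sum>j<m. p j) \<le> (t + t\<^sup>2) * (\<Sum>j<m. p j)" using P0 by (rule mult_right_mono)
    also have "\<dots> \<le> t * (\<Sum>j<m. p j) + t\<^sup>2 * m" using P1 by (simp add: distrib_right mult_left_mono)
    finally show ?thesis .
  qed
  finally have "t * ((\<Sum>j<m. r j) - (\<Sum>j<m. p j)) \<le> ln lam + t\<^sup>2 * m + m * \<eta>" by (simp add: algebra_simps)
  hence "(\<Sum>j<m. r j) - (\<Sum>j<m. p j) \<le> (ln lam + t\<^sup>2 * m + m * \<eta>) / t"
    using t by (simp add: field_simps)
  also have "\<dots> = ln lam / t + m * t + m * \<eta> / t" using t by (simp add: field_simps power2_eq_square)
  finally show ?thesis by (simp add: p_def r_def sum_subtractf)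
qed

subsection \<open>Coverings by separated cubes\<close>

text \<open>\<open>op_norm\<close> is a supremum of reals, which bounds its members only when the
  set is bounded above. The last hypothesis supplies such a bound, and a unit vector supplies a
  member.\<close>

lemma op_norm_nonneg:
  assumes "A \<in> carrier_mat n n" "0 < n" "\<And>v. v \<in> carrier_vec n \<Longrightarrow> euclid_norm (A *\<^sub>v v) \<le> c * euclid_norm v"
  shows "0 \<le> op_norm A"
proof -
  have u: "euclid_norm (unit_vec n 0) = 1" by (rule euclid_norm_unit_vec[OF assms(2)])
  have "0 \<le> euclid_norm (A *\<^sub>v unit_vec n 0)" by simp
  also have "\<dots> \<le> op_norm A"
    unfolding op_norm_def
  proof (rule cSUP_upper)
    show "unit_vec n 0 \<in> {v \<in> carrier_vec (dim_col A). euclid_norm v = 1}" using assms(1) u by auto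
    show "bdd_above ((\<lambda>v. euclid_norm (A *\<^sub>v v)) ` {v \<in> carrier_vec (dim_col A). euclid_norm v = 1})"
    proof (rule bdd_aboveI2[of _ _ c])
      fix v assume "v \<in> {v \<in> carrier_vec (dim_col A). euclid_norm v = 1}"
      thus "euclid_norm (A *\<^sub>v v) \<le> c" using assms(1) assms(3)[of v] by auto
    qed
  qed
  finally show ?thesis .
qed

lemma proj_extend_op:
  assumes d: "1 \<le> d" and X: "X \<subseteq> {..<N}" and B: "proj_mat (d ^ card X) B"
  shows "proj_mat (d ^ N) (extend_op d N X B)"
  using B extend_op_mult[OF d X, of B B] extend_op_adjoint[OF d, of B X N] by (auto simp: proj_mat_def)

lemma supported_on_tilt:
  assumes d: "1 \<le> d" and X: "X \<subseteq> {..<N}" and Q: "supported_on d N X Q"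
  shows "supported_on d N X (tilt (d ^ N) t Q)"
  unfolding tilt_def by (rule supported_on_add_smult[OF d supported_on_one[OF d X] Q])

text \<open>The accumulated product lives on the union of the cubes treated so far, so its
  decorrelation from the next cube is governed by the distance to that union.\<close>

lemma supported_on_tilt_prod:
  assumes d: "1 \<le> d" and C: "\<And>j. j < m \<Longrightarrow> C j \<subseteq> {..<N}" "\<And>j. j < m \<Longrightarrow> supported_on d N (C j) (Q j)"
  shows "supported_on d N (\<Union>j<m. C j) (tilt_prod (d ^ N) t Q m)"
  using C
proof (induction m)
  case 0
  show ?case using supported_on_one[OF d, of "{}" N] by simp
next
  case (Suc m)
  have sub: "(\<Union>j<Suc m. C j) \<subseteq> {..<N}" using Suc.prems by auto
  have "supported_on d N (\<Union>j<Suc m. C j) (tilt_prod (d ^ N) t Q m)"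
    by (rule supported_on_mono[OF d _ sub Suc.IH]) (use Suc.prems in \<open>auto intro: less_SucI\<close>)
  moreover have "supported_on d N (\<Union>j<Suc m. C j) (tilt (d ^ N) t (Q m))"
  proof -
    have "C m \<subseteq> (\<Union>j<Suc m. C j)" by (rule UN_upper) simp
    thus ?thesis using supported_on_mono[OF d _ sub supported_on_tilt[OF d, of "C m"]] Suc.prems by simp
  qed
  ultimately show ?case using supported_on_mult[OF d sub] by simp
qed

section \<open>Trace distances on separated regions\<close>

lemma site_dist_self [simp]: "site_dist D L i i = 0"
  by (simp add: site_dist_def)

text \<open>The optimal projection is found on the region and then embedded; duality of the partial
  trace converts its expectations in the reduced states into expectations in the global
  ones.\<close>

lemma trace_norm_reduced_diff:
  assumes d: "1 \<le> d" and X: "X \<subseteq> {..<N}"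
    and U: "unitary_mat (d ^ N) U" and w: "(\<Sum>i<d ^ N. w i) = 1" and g: "(\<Sum>i<d ^ N. g i) = 1"
    and \<tau>: "\<tau> = real_spec_mat (d ^ N) U g"
    and \<omega>: "\<omega> = real_spec_mat (d ^ N) U w"
  obtains B where "proj_mat (d ^ card X) B"
    "trace_norm (reduced_state d N X \<omega> - reduced_state d N X \<tau>) =
      2 * (Re (mat_trace (\<omega> * extend_op d N X B)) - Re (mat_trace (\<tau> * extend_op d N X B)))"
proof -
  let ?m = "d ^ card X" and ?X = "reduced_state d N X \<omega> - reduced_state d N X \<tau>"
  have c: "\<omega> \<in> carrier_mat (d ^ N) (d ^ N)" "\<tau> \<in> carrier_mat (d ^ N) (d ^ N)"
    using unitary_matD(1)[OF U] by (auto simp: \<tau> \<omega>)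
  have h: "mat_adjoint \<omega> = \<omega>" "mat_adjoint \<tau> = \<tau>"
    using unitary_matD(1)[OF U] by (simp_all add: \<tau> \<omega> spec_mat_adjoint)
  have tr: "mat_trace \<omega> = 1" "mat_trace \<tau> = 1"
    unfolding \<tau> \<omega> trace_spec_mat[OF U] using w g by (simp_all flip: of_real_sum)
  have Xc: "?X \<in> carrier_mat ?m ?m" by (intro minus_carrier_mat) simp
  have "hermitian_mat ?X"
    unfolding hermitian_mat_carrier[OF Xc]
    using mat_adjoint_minus[OF reduced_state_carrier reduced_state_carrier] reduced_state_adjoint c h by simp
  moreover have "mat_trace ?X = 0"
    using mat_trace_minus[OF reduced_state_carrier reduced_state_carrier] trace_reduced_state[OF d X] c tr by simp
  ultimately obtain B where B: "B \<in> carrier_mat ?m ?m" "B * B = B" "mat_adjoint B = B"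
    "trace_norm ?X = 2 * Re (mat_trace (?X * B))"
    using trace_norm_traceless[OF Xc] by blast
  have "?X * B = reduced_state d N X \<omega> * B - reduced_state d N X \<tau> * B"
    by (rule minus_mult_distrib_mat[OF reduced_state_carrier reduced_state_carrier B(1)])
  hence "mat_trace (?X * B) = mat_trace (reduced_state d N X \<omega> * B) - mat_trace (reduced_state d N X \<tau> * B)"
    using mat_trace_minus[OF mult_carrier_mat[OF reduced_state_carrier B(1)] mult_carrier_mat[OF reduced_state_carrier B(1)]] by simp
  also have "\<dots> = mat_trace (\<omega> * extend_op d N X B) - mat_trace (\<tau> * extend_op d N X B)"
    using trace_reduced_state_mult[OF d X _ B(1)] c by simp
  finally show ?thesis using that[of B] B by (simp add: proj_mat_def)
qed

lemma trace_proj_bounds: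
  assumes U: "unitary_mat n U" and g: "\<And>i. i < n \<Longrightarrow> 0 \<le> g i" "(\<Sum>i<n. g i) = 1" and Q: "proj_mat n Q"
  shows "0 \<le> Re (mat_trace (real_spec_mat n U g * Q))"
    "Re (mat_trace (real_spec_mat n U g * Q)) \<le> 1"
proof -
  note Uc = unitary_matD(1)[OF U]
  have Qc: "Q \<in> carrier_mat n n" using Q by (simp add: proj_mat_def)
  have q: "0 \<le> qform Q (col U i)" "qform Q (col U i) \<le> 1" if "i < n" for i
    using qform_proj[OF Q, of "col U i"] qform_proj_le[OF Q, of "col U i"] unitary_col_norm[OF U that] Uc that by auto
  show "0 \<le> Re (mat_trace (real_spec_mat n U g * Q))"
    unfolding trace_spec_real[OF Uc Qc] using g(1) q by (intro sum_nonneg mult_nonneg_nonneg) auto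
  have "(\<Sum>i<n. g i * qform Q (col U i)) \<le> (\<Sum>i<n. g i * 1)"
    using g(1) q by (intro sum_mono mult_left_mono) auto
  thus "Re (mat_trace (real_spec_mat n U g * Q)) \<le> 1"
    unfolding trace_spec_real[OF Uc Qc] using g(2) by simp
qed

text \<open>The factorisation error of the \<open>j\<close>-th step is the product of two operator
  norms, at most \<open>exp (t * (j + 1))\<close>, with \<open>exp (- s / \<xi>)\<close>.
  \<open>M\<close> bounds the family size from above, so that one error term serves families of all
  sizes.\<close>

lemma separated_family_bound:
  fixes C :: "nat \<Rightarrow> nat set"
  assumes d: "1 \<le> d" and U: "unitary_mat (d ^ (L ^ D)) U"
    and w: "\<And>i. i < d ^ (L ^ D) \<Longrightarrow> 0 \<le> w i" "\<And>i. i < d ^ (L ^ D) \<Longrightarrow> w i \<le> lam * g i" "(\<Sum>i<d ^ (L ^ D). w i) = 1"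
    and g: "\<And>i. i < d ^ (L ^ D) \<Longrightarrow> 0 \<le> g i" "(\<Sum>i<d ^ (L ^ D). g i) = 1"
    and \<tau>: "\<tau> = real_spec_mat (d ^ (L ^ D)) U g"
    and \<omega>: "\<omega> = real_spec_mat (d ^ (L ^ D)) U w"
    and decay: "exp_decay_correlations d D L \<xi> \<tau>" and \<xi>: "0 < \<xi>"
    and C: "\<And>j. j < m \<Longrightarrow> C j \<subseteq> {..<L ^ D}" "\<And>j. j < m \<Longrightarrow> C j \<noteq> {}"
    and sep: "\<And>i j x y. i < j \<Longrightarrow> j < m \<Longrightarrow> x \<in> C i \<Longrightarrow> y \<in> C j \<Longrightarrow> s \<le> site_dist D L x y"
    and s: "1 \<le> s" and t: "0 < t" "t \<le> 1" and M: "real m \<le> M"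
  shows "(\<Sum>j<m. trace_norm (reduced_state d (L ^ D) (C j) \<omega> - reduced_state d (L ^ D) (C j) \<tau>)) \<le>
    2 * (ln lam / t + m * t + m * exp (t * M - s / \<xi>) / t)"
proof -
  let ?N = "L ^ D" let ?n = "d ^ (L ^ D)"
  have "\<forall>j\<in>{..<m}. \<exists>B. proj_mat (d ^ card (C j)) B \<and>
      trace_norm (reduced_state d ?N (C j) \<omega> - reduced_state d ?N (C j) \<tau>) =
      2 * (Re (mat_trace (\<omega> * extend_op d ?N (C j) B)) - Re (mat_trace (\<tau> * extend_op d ?N (C j) B)))"
  proof
    fix j assume "j \<in> {..<m}"
    hence Cj: "C j \<subseteq> {..<?N}" using C by simp
    show "\<exists>B. proj_mat (d ^ card (C j)) B \<and>
      trace_norm (reduced_state d ?N (C j) \<omega> - reduced_state d ?N (C j) \<tau>) =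
      2 * (Re (mat_trace (\<omega> * extend_op d ?N (C j) B)) - Re (mat_trace (\<tau> * extend_op d ?N (C j) B)))"
      using trace_norm_reduced_diff[OF d Cj U w(3) g(2) \<tau> \<omega>] by metis
  qed
  from bchoice[OF this] obtain B where B: "\<And>j. j < m \<Longrightarrow> proj_mat (d ^ card (C j)) (B j)"
    "\<And>j. j < m \<Longrightarrow> trace_norm (reduced_state d ?N (C j) \<omega> - reduced_state d ?N (C j) \<tau>) =
      2 * (Re (mat_trace (\<omega> * extend_op d ?N (C j) (B j))) - Re (mat_trace (\<tau> * extend_op d ?N (C j) (B j))))"
    by auto
  define Q where "Q j = extend_op d ?N (C j) (B j)" for j
  have Q: "proj_mat ?n (Q j)" if "j < m" for j
    unfolding Q_def by (rule proj_extend_op[OF d C(1)[OF that] B(1)[OF that]])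
  have Qc: "Q j \<in> carrier_mat ?n ?n" for j by (simp add: Q_def)
  \<comment> \<open>A common site would have distance 0 from itself, against
    \<open>1 \<le> s\<close>.\<close>
  have disj: "C i \<inter> C j = {}" if "i < j" "j < m" for i j
    using sep[OF that, of x x for x] s by fastforce
  have Qcomm: "Q i * Q j = Q j * Q i" if ij: "i < m" "j < m" for i j
  proof (cases "i = j")
    case False
    hence "C i \<inter> C j = {}" using disj[of i j] disj[of j i] ij by (cases "i < j") auto
    thus ?thesis unfolding Q_def using C(1) ij by (intro extend_op_commute[OF d]) auto
  qed simp
  have Qs: "supported_on d ?N (C j) (Q j)" if "j < m" for j
    unfolding supported_on_def Q_def using B(1)[OF that] by (auto simp: proj_mat_def)
  let ?\<eta> = "exp (t * M - s / \<xi>)"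
  have dec: "cmod (mat_trace (\<tau> * tilt_prod ?n t Q j * tilt ?n t (Q j)) -
        mat_trace (\<tau> * tilt_prod ?n t Q j) * mat_trace (\<tau> * tilt ?n t (Q j))) \<le> ?\<eta>" if j: "j < m" for j
  \<comment> \<open>The empty product has empty support, and the decay hypothesis speaks only of
    nonempty regions; here the correlation vanishes exactly since the state has trace 1.\<close>
  proof (cases "j = 0")
    case True
    have \<tau>c: "\<tau> \<in> carrier_mat ?n ?n" using unitary_matD(1)[OF U] by (simp add: \<tau>)
    have "mat_trace \<tau> = 1" unfolding \<tau> trace_spec_mat[OF U] using g(2) by (simp flip: of_real_sum)
    thus ?thesis using True right_mult_one_mat[OF \<tau>c] by simp
  next
    case False
    let ?Y = "\<Union>i<j. C i"
    have Y: "?Y \<subseteq> {..<?N}" "?Y \<noteq> {}"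
    proof -
      show "?Y \<subseteq> {..<?N}" using C(1) j by (intro UN_least) auto
      have "C 0 \<subseteq> ?Y" using False by (intro UN_upper) simp
      thus "?Y \<noteq> {}" using C(2)[of 0] j by auto
    qed
    have Fs: "supported_on d ?N ?Y (tilt_prod ?n t Q j)"
      using C(1) Qs j by (intro supported_on_tilt_prod[OF d]) auto
    have Ts: "supported_on d ?N (C j) (tilt ?n t (Q j))" by (rule supported_on_tilt[OF d C(1)[OF j] Qs[OF j]])
    have n0: "0 < ?n" using d by simp
    have Fb: "euclid_norm (tilt_prod ?n t Q j *\<^sub>v v) \<le> exp (t * j) * euclid_norm v" if "v \<in> carrier_vec ?n" for v
      using Q j t that by (intro tilt_prod_norm) auto
    have Tb: "euclid_norm (tilt ?n t (Q j) *\<^sub>v v) \<le> exp t * euclid_norm v" if "v \<in> carrier_vec ?n" for v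
      using Q j t that by (intro tilt_norm) auto
    have Fc: "tilt_prod ?n t Q j \<in> carrier_mat ?n ?n" using Qc by (intro tilt_prod_carrier)
    have Tc: "tilt ?n t (Q j) \<in> carrier_mat ?n ?n" using Qc by simp
    have fin: "finite ?Y" "finite (C j)" using Y(1) C(1)[OF j] by (auto intro: finite_subset)
    have "s \<le> region_dist D L ?Y (C j)"
      unfolding region_dist_def
    proof (rule Min.boundedI)
      show "finite ((\<lambda>(i, j). site_dist D L i j) ` (?Y \<times> C j))" using fin by (intro finite_imageI finite_cartesian_product)
      show "(\<lambda>(i, j). site_dist D L i j) ` (?Y \<times> C j) \<noteq> {}" using Y(2) C(2)[OF j] by (simp only: image_is_empty Times_empty) simp
      fix a assume "a \<in> (\<lambda>(i, j). site_dist D L i j) ` (?Y \<times> C j)"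
      thus "s \<le> a" using sep j by auto
    qed
    hence "real s / \<xi> \<le> real (region_dist D L ?Y (C j)) / \<xi>" using \<xi> by (simp add: divide_right_mono)
    hence rd: "exp (- real (region_dist D L ?Y (C j)) / \<xi>) \<le> exp (- real s / \<xi>)" by simp
    have "cmod (mat_trace (\<tau> * tilt_prod ?n t Q j * tilt ?n t (Q j)) -
        mat_trace (\<tau> * tilt_prod ?n t Q j) * mat_trace (\<tau> * tilt ?n t (Q j)))
       \<le> op_norm (tilt_prod ?n t Q j) * op_norm (tilt ?n t (Q j)) * exp (- real (region_dist D L ?Y (C j)) / \<xi>)"
      using decay Y C[OF j] Fs Ts unfolding exp_decay_correlations_def by blast
    also have "\<dots> \<le> exp (t * j) * exp t * exp (- real s / \<xi>)"
      using rd op_norm_le[OF Fc n0 Fb] op_norm_le[OF Tc n0 Tb] op_norm_nonneg[OF Fc n0 Fb] op_norm_nonneg[OF Tc n0 Tb]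
      by (intro mult_mono) auto
    also have "\<dots> = exp (t * (j + 1) - s / \<xi>)" by (simp add: algebra_simps flip: exp_add)
    \<comment> \<open>From \<open>j < m\<close> follows \<open>j + 1 \<le> M\<close>.\<close>
    also have "\<dots> \<le> ?\<eta>" using M j t by (simp add: mult_left_mono)
    finally show ?thesis .
  qed
  have "(\<Sum>j<m. trace_norm (reduced_state d ?N (C j) \<omega> - reduced_state d ?N (C j) \<tau>)) =
      2 * (\<Sum>j<m. Re (mat_trace (\<omega> * Q j)) - Re (mat_trace (\<tau> * Q j)))"
    using B(2) by (simp add: Q_def sum_distrib_left)
  also have "\<dots> \<le> 2 * (ln lam / t + m * t + m * ?\<eta> / t)"
    by (intro mult_left_mono chernoff_deviation[OF U w g Q Qcomm t _ \<tau> \<omega> dec]) auto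
  finally show ?thesis .
qed

section \<open>Cubes and their corners\<close>

definition cube :: "nat \<Rightarrow> nat \<Rightarrow> nat \<Rightarrow> (nat \<Rightarrow> nat) \<Rightarrow> nat set" where
  "cube D L l c = {i. i < L ^ D \<and> (\<forall>a<D. c a \<le> digit L i a \<and> digit L i a < c a + l)}"

text \<open>A cube depends only on the values of \<open>c\<close> below \<open>D\<close>; taking
  corners as extensional functions makes the parametrisation injective.\<close>

lemma hypercubes_eq_image:
  assumes "l \<le> L"
  shows "hypercubes D L l = cube D L l ` (PiE {..<D} (\<lambda>_. {..L - l}))"
proof (intro equalityI subsetI)
  fix X assume "X \<in> hypercubes D L l"
  then obtain c where c: "\<forall>a<D. c a + l \<le> L" "X = cube D L l c" by (auto simp: hypercubes_def cube_def)
  have "X = cube D L l (restrict c {..<D})" using c(2) by (auto simp: cube_def)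
  moreover have "restrict c {..<D} \<in> PiE {..<D} (\<lambda>_. {..L - l})" using c(1) by (auto simp: le_diff_conv2 assms)
  ultimately show "X \<in> cube D L l ` (PiE {..<D} (\<lambda>_. {..L - l}))" by blast
next
  fix X assume "X \<in> cube D L l ` (PiE {..<D} (\<lambda>_. {..L - l}))"
  then obtain c where c: "c \<in> PiE {..<D} (\<lambda>_. {..L - l})" "X = cube D L l c" by blast
  have "\<forall>a<D. c a + l \<le> L" using PiE_mem[OF c(1)] assms by (fastforce simp: le_diff_conv2)
  thus "X \<in> hypercubes D L l" using c(2) by (auto simp: hypercubes_def cube_def)
qed

text \<open>The site at the corner itself. It witnesses that the cube is nonempty and allows the
  corner to be recovered from the cube.\<close>

lemma cube_corner:
  assumes "1 \<le> l" "l \<le> L" "c \<in> PiE {..<D} (\<lambda>_. {..L - l})"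
  obtains i where "i \<in> cube D L l c" "\<And>a. a < D \<Longrightarrow> digit L i a = c a"
proof -
  have cL: "c a < L" if "a < D" for a using PiE_mem[OF assms(3), of a] assms(1,2) that by auto
  have L: "1 \<le> L" using assms by simp
  let ?i = "\<Sum>a<D. c a * L ^ a"
  have dg: "digit L ?i a = c a" if "a < D" for a using that by (intro digit_sum(2)[OF L]) (auto simp: cL)
  moreover have "?i < L ^ D" by (intro digit_sum(1)[OF L]) (auto simp: cL)
  ultimately have "?i \<in> cube D L l c" using assms(1) by (auto simp: cube_def)
  thus ?thesis using that dg by blast
qed

text \<open>Each corner site lies in the other cube, so the coordinates bound one another in both
  directions.\<close>

lemma inj_on_cube:
  assumes "1 \<le> l" "l \<le> L"
  shows "inj_on (cube D L l) (PiE {..<D} (\<lambda>_. {..L - l}))"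
proof (rule inj_onI)
  fix c e assume c: "c \<in> PiE {..<D} (\<lambda>_. {..L - l})" and e: "e \<in> PiE {..<D} (\<lambda>_. {..L - l})"
    and eq: "cube D L l c = cube D L l e"
  obtain i where i: "i \<in> cube D L l c" "\<And>a. a < D \<Longrightarrow> digit L i a = c a" using cube_corner[OF assms c] by blast
  obtain j where j: "j \<in> cube D L l e" "\<And>a. a < D \<Longrightarrow> digit L j a = e a" using cube_corner[OF assms e] by blast
  have "i \<in> cube D L l e" "j \<in> cube D L l c" using eq i(1) j(1) by auto
  hence "c a = e a" if "a < D" for a
    using i(2) j(2) that by (auto simp: cube_def intro!: antisym)
  thus "c = e" using c e by (intro PiE_ext) auto
qed

lemma card_hypercubes:
  assumes "1 \<le> l" "l \<le> L"
  shows "card (hypercubes D L l) = (L - l + 1) ^ D"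
  unfolding hypercubes_eq_image[OF assms(2)] card_image[OF inj_on_cube[OF assms]]
  by (simp add: card_PiE)

text \<open>One coordinate suffices: distinct congruent corner values differ by at least
  \<open>l + s\<close>, and the width of a cube uses up only \<open>l\<close> of this gap.\<close>

lemma cube_separation:
  assumes i: "i \<in> cube D L l c" and j: "j \<in> cube D L l e" and a: "a < D" "c a \<noteq> e a"
    and mod: "c a mod (l + s) = e a mod (l + s)"
  shows "s \<le> site_dist D L i j"
proof -
  have far: "l + s + x \<le> y" if "x < y" "x mod (l + s) = y mod (l + s)" for x y :: nat
  proof -
    have "(l + s) dvd (y - x)" using mod_eq_dvd_iff_nat[of x y "l + s"] that by simp
    hence "l + s \<le> y - x" using that(1) by (intro dvd_imp_le) simp_all
    thus ?thesis using that(1) by simp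
  qed
  have "l + s + e a \<le> c a \<or> l + s + c a \<le> e a"
    using far[of "c a" "e a"] far[of "e a" "c a"] a(2) mod by (cases "c a < e a") simp_all
  moreover have "c a \<le> digit L i a" "digit L i a < c a + l" "e a \<le> digit L j a" "digit L j a < e a + l"
    using i j a(1) by (simp_all add: cube_def)
  ultimately have "digit L j a + s \<le> digit L i a \<or> digit L i a + s \<le> digit L j a"
    by (elim disjE) simp_all
  hence "s \<le> nat \<bar>int (digit L i a) - int (digit L j a)\<bar>" by (elim disjE) simp_all
  also have "\<dots> \<le> site_dist D L i j"
    unfolding site_dist_def using a(1) by (intro member_le_sum) auto
  finally show ?thesis .
qed

text \<open>
  The cubes are sorted into classes by the residues of their corners modulo \<open>l + s\<close>;
  two cubes of the same class have distance at least \<open>s\<close>.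
\<close>

lemma hypercube_sum_bound:
  fixes f :: "nat set \<Rightarrow> real"
  assumes l: "1 \<le> l" "l \<le> L" and A: "0 \<le> A"
    and fam: "\<And>m C. real m \<le> real ((L div (l + s) + 1) ^ D) \<Longrightarrow> (\<And>j. j < m \<Longrightarrow> C j \<subseteq> {..<L ^ D} \<and> C j \<noteq> {}) \<Longrightarrow>
      (\<And>i j x y. i < j \<Longrightarrow> j < m \<Longrightarrow> x \<in> C i \<Longrightarrow> y \<in> C j \<Longrightarrow> s \<le> site_dist D L x y) \<Longrightarrow>
      (\<Sum>j<m. f (C j)) \<le> A + B * real m"
  shows "(\<Sum>C\<in>hypercubes D L l. f C) \<le> real ((l + s) ^ D) * A + B * real (card (hypercubes D L l))"
proof -
  let ?k = "l + s" let ?P = "PiE {..<D} (\<lambda>_. {..L - l})" let ?cu = "cube D L l"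
  let ?R = "PiE {..<D} (\<lambda>_. {..<?k})"
  define r where "r c = (\<lambda>a\<in>{..<D}. c a mod ?k)" for c :: "nat \<Rightarrow> nat"
  have finP: "finite ?P" and finR: "finite ?R" by (simp_all add: finite_PiE)
  have k0: "0 < ?k" using l by simp
  have rP: "r ` ?P \<subseteq> ?R" unfolding r_def using k0 by (intro image_subsetI) (simp only: restrict_PiE_iff, simp)
  have cls: "(\<Sum>c\<in>{c \<in> ?P. r c = \<rho>}. f (?cu c)) \<le> A + B * card {c \<in> ?P. r c = \<rho>}" for \<rho>
  proof -
    let ?T = "{c \<in> ?P. r c = \<rho>}"
    have finT: "finite ?T" using finP by simp
    have modT: "c a mod ?k = e a mod ?k" if "c \<in> ?T" "e \<in> ?T" "a < D" for c e a
    proof -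
      have "r c a = r e a" using that by simp
      thus ?thesis using that(3) by (simp add: r_def)
    qed
    from ex_bij_betw_nat_finite[OF finT] obtain h where h: "bij_betw h {..<card ?T} ?T"
      unfolding atLeast0LessThan by blast
    have hT: "h j \<in> ?T" if "j < card ?T" for j using h that by (auto simp: bij_betw_def)
    \<comment> \<open>Within a residue class a corner is determined by its quotients by
      \<open>l + s\<close>, each of which is at most \<open>L div (l + s)\<close>.\<close>
    have "card ?T \<le> card (PiE {..<D} (\<lambda>_. {..L div ?k}))"
    proof (rule card_inj_on_le)
      show "inj_on (\<lambda>c. \<lambda>a\<in>{..<D}. c a div ?k) ?T"
      proof (rule inj_onI)
        fix c e assume ce: "c \<in> ?T" "e \<in> ?T" and eq: "(\<lambda>a\<in>{..<D}. c a div ?k) = (\<lambda>a\<in>{..<D}. e a div ?k)"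
        have "c a = e a" if a: "a < D" for a
        proof -
          have "c a div ?k = e a div ?k" using fun_cong[OF eq, of a] a by simp
          thus ?thesis using modT[OF ce a] by (metis div_mult_mod_eq)
        qed
        thus "c = e" using ce by (intro PiE_ext[of c "{..<D}" "\<lambda>_. {..L - l}" e]) auto
      qed
      show "(\<lambda>c. \<lambda>a\<in>{..<D}. c a div ?k) ` ?T \<subseteq> PiE {..<D} (\<lambda>_. {..L div ?k})"
      proof (rule image_subsetI)
        fix c assume "c \<in> ?T"
        hence "c a \<le> L" if "a < D" for a using that PiE_mem[of c "{..<D}" "\<lambda>_. {..L - l}" a] by auto
        thus "(\<lambda>a\<in>{..<D}. c a div ?k) \<in> PiE {..<D} (\<lambda>_. {..L div ?k})" by (simp only: restrict_PiE_iff) (auto intro: div_le_mono)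
      qed
    qed (simp add: finite_PiE)
    hence cT: "card ?T \<le> (L div ?k + 1) ^ D" by (simp add: card_PiE)
    have "(\<Sum>c\<in>?T. f (?cu c)) = (\<Sum>j<card ?T. f (?cu (h j)))"
      by (rule sum.reindex_bij_betw[OF h, symmetric])
    also have "\<dots> \<le> A + B * card ?T"
    proof (rule fam)
      show "real (card ?T) \<le> real ((L div ?k + 1) ^ D)" using cT by (simp only: of_nat_le_iff)
    next
      fix j assume j: "j < card ?T"
      hence "h j \<in> ?P" using hT by auto
      then obtain i where "i \<in> ?cu (h j)" using cube_corner[OF l] by blast
      thus "?cu (h j) \<subseteq> {..<L ^ D} \<and> ?cu (h j) \<noteq> {}" by (auto simp: cube_def)
    next
      fix i j x y assume ij: "i < j" "j < card ?T" and x: "x \<in> ?cu (h i)" and y: "y \<in> ?cu (h j)"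
      have "h i \<noteq> h j" using h ij by (auto simp: bij_betw_def inj_on_def)
      moreover have hij: "h i \<in> ?T" "h j \<in> ?T" using hT ij by auto
      ultimately obtain a where a: "a < D" "h i a \<noteq> h j a"
        using PiE_ext[of "h i" "{..<D}" "\<lambda>_. {..L - l}" "h j"] by auto
      show "s \<le> site_dist D L x y" by (rule cube_separation[OF x y a modT[OF hij a(1)]])
    qed
    finally show ?thesis .
  qed
  have "(\<Sum>C\<in>hypercubes D L l. f C) = (\<Sum>c\<in>?P. f (?cu c))"
    unfolding hypercubes_eq_image[OF l(2)] by (simp add: sum.reindex[OF inj_on_cube[OF l]])
  also have "\<dots> = (\<Sum>\<rho>\<in>?R. \<Sum>c\<in>{c \<in> ?P. r c = \<rho>}. f (?cu c))"
    by (rule sum.group[OF finP finR rP, symmetric])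
  also have "\<dots> \<le> (\<Sum>\<rho>\<in>?R. A + B * card {c \<in> ?P. r c = \<rho>})" by (intro sum_mono cls)
  also have "\<dots> = real (card ?R) * A + B * (\<Sum>\<rho>\<in>?R. real (card {c \<in> ?P. r c = \<rho>}))"
    by (simp add: sum.distrib sum_distrib_left)
  also have "(\<Sum>\<rho>\<in>?R. real (card {c \<in> ?P. r c = \<rho>})) = (\<Sum>\<rho>\<in>?R. \<Sum>c\<in>{c \<in> ?P. r c = \<rho>}. 1)" by simp
  also have "\<dots> = real (card ?P)" by (subst sum.group[OF finP finR rP]) simp
  also have "card ?P = card (hypercubes D L l)"
    unfolding hypercubes_eq_image[OF l(2)] card_image[OF inj_on_cube[OF l]] ..
  also have "card ?R = ?k ^ D" by (simp add: card_PiE)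
  finally show ?thesis .
qed

text \<open>\<open>ln lam / t\<close> is paid once per family, the other terms once per cube. After
  division by the number of cubes only the former keeps the ratio of families to cubes.\<close>

lemma local_distance_bound:
  assumes d: "1 \<le> d" and U: "unitary_mat (d ^ (L ^ D)) U"
    and w: "\<And>i. i < d ^ (L ^ D) \<Longrightarrow> 0 \<le> w i" "\<And>i. i < d ^ (L ^ D) \<Longrightarrow> w i \<le> lam * g i" "(\<Sum>i<d ^ (L ^ D). w i) = 1"
    and g: "\<And>i. i < d ^ (L ^ D) \<Longrightarrow> 0 \<le> g i" "(\<Sum>i<d ^ (L ^ D). g i) = 1"
    and \<tau>: "\<tau> = real_spec_mat (d ^ (L ^ D)) U g"
    and \<omega>: "\<omega> = real_spec_mat (d ^ (L ^ D)) U w"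
    and decay: "exp_decay_correlations d D L \<xi> \<tau>" and \<xi>: "0 < \<xi>"
    and lam: "1 \<le> lam" and l: "1 \<le> l" "l \<le> L" and s: "1 \<le> s" and t: "0 < t" "t \<le> 1"
  shows "local_distance d D L l \<omega> \<tau> \<le> (real (l + s) / real (L - l + 1)) ^ D * (2 * ln lam / t) +
    2 * (t + exp (t * real ((L div (l + s) + 1) ^ D) - s / \<xi>) / t)"
proof -
  let ?f = "\<lambda>C. trace_norm (reduced_state d (L ^ D) C \<omega> - reduced_state d (L ^ D) C \<tau>)"
  let ?M = "real ((L div (l + s) + 1) ^ D)"
  let ?A = "2 * ln lam / t" and ?B = "2 * (t + exp (t * ?M - s / \<xi>) / t)"
  let ?H = "hypercubes D L l"
  have "(\<Sum>C\<in>?H. ?f C) \<le> real ((l + s) ^ D) * ?A + ?B * real (card ?H)"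
  proof (rule hypercube_sum_bound[OF l])
    show "0 \<le> ?A" using lam t by (simp add: ln_ge_zero)
    fix m and C :: "nat \<Rightarrow> nat set"
    assume m: "real m \<le> ?M" and C: "\<And>j. j < m \<Longrightarrow> C j \<subseteq> {..<L ^ D} \<and> C j \<noteq> {}"
      and sep: "\<And>i j x y. i < j \<Longrightarrow> j < m \<Longrightarrow> x \<in> C i \<Longrightarrow> y \<in> C j \<Longrightarrow> s \<le> site_dist D L x y"
    have "(\<Sum>j<m. ?f (C j)) \<le> 2 * (ln lam / t + m * t + m * exp (t * ?M - s / \<xi>) / t)"
      by (rule separated_family_bound[OF d U w g \<tau> \<omega> decay \<xi> _ _ sep s t m]) (use C in auto)
    also have "\<dots> = ?A + ?B * real m" using t by (simp add: field_simps)
    finally show "(\<Sum>j<m. ?f (C j)) \<le> ?A + ?B * real m" .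
  qed
  moreover have cH: "real (card ?H) = real (L - l + 1) ^ D" using card_hypercubes[OF l, of D] by simp
  ultimately have "local_distance d D L l \<omega> \<tau> \<le> 1 / real (L - l + 1) ^ D * (real (l + s) ^ D * ?A + ?B * real (L - l + 1) ^ D)"
    unfolding local_distance_def cH by (intro mult_left_mono) auto
  also have "\<dots> = (real (l + s) / real (L - l + 1)) ^ D * ?A + ?B"
    by (simp add: power_divide field_simps del: of_nat_add of_nat_Suc)
  finally show ?thesis .
qed

text \<open>The trivial bound for two states; it serves the finitely many lattices before the
  asymptotics set in, and the case \<alpha> = 0.\<close>

lemma local_distance_le_2:
  assumes d: "1 \<le> d" and U: "unitary_mat (d ^ (L ^ D)) U"
    and w: "\<And>i. i < d ^ (L ^ D) \<Longrightarrow> 0 \<le> w i" "(\<Sum>i<d ^ (L ^ D). w i) = 1"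
    and g: "\<And>i. i < d ^ (L ^ D) \<Longrightarrow> 0 \<le> g i" "(\<Sum>i<d ^ (L ^ D). g i) = 1"
    and \<tau>: "\<tau> = real_spec_mat (d ^ (L ^ D)) U g"
    and \<omega>: "\<omega> = real_spec_mat (d ^ (L ^ D)) U w"
  shows "local_distance d D L l \<omega> \<tau> \<le> 2"
proof -
  let ?f = "\<lambda>C. trace_norm (reduced_state d (L ^ D) C \<omega> - reduced_state d (L ^ D) C \<tau>)"
  let ?H = "hypercubes D L l"
  have "?f C \<le> 2" if "C \<in> ?H" for C
  proof -
    have C: "C \<subseteq> {..<L ^ D}" using that by (auto simp: hypercubes_def)
    obtain B where B: "proj_mat (d ^ card C) B"
      "?f C = 2 * (Re (mat_trace (\<omega> * extend_op d (L ^ D) C B)) - Re (mat_trace (\<tau> * extend_op d (L ^ D) C B)))"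
      using trace_norm_reduced_diff[OF d C U w(2) g(2) \<tau> \<omega>] by blast
    have P: "proj_mat (d ^ (L ^ D)) (extend_op d (L ^ D) C B)" by (rule proj_extend_op[OF d C B(1)])
    show ?thesis unfolding B(2) unfolding \<omega> \<tau>
      using trace_proj_bounds(2)[OF U w P] trace_proj_bounds(1)[OF U g P] by simp
  qed
  hence "(\<Sum>C\<in>?H. ?f C) \<le> 2 * real (card ?H)" using sum_mono[of ?H ?f "\<lambda>_. 2"] by simp
  hence "local_distance d D L l \<omega> \<tau> \<le> 1 / real (card ?H) * (2 * real (card ?H))"
    unfolding local_distance_def by (intro mult_left_mono) auto
  \<comment> \<open>If there are no cubes the left side is 0 by the convention for division by
    0.\<close>
  also have "\<dots> \<le> 2" by simp
  finally show ?thesis .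
qed

subsection \<open>The Gibbs state and the generalized micro-canonical ensemble\<close>

lemma mat_sum_carrier [simp]: "mat_sum n f I \<in> carrier_mat n n"
  by (simp add: mat_sum_def)

lemma mat_trace_mat_sum:
  assumes "\<And>i. i \<in> I \<Longrightarrow> f i \<in> carrier_mat n n"
  shows "mat_trace (mat_sum n f I) = (\<Sum>i\<in>I. mat_trace (f i))"
proof -
  have "mat_trace (mat_sum n f I) = (\<Sum>x<n. \<Sum>i\<in>I. f i $$ (x, x))"
    by (simp add: mat_trace_def mat_sum_def)
  also have "\<dots> = (\<Sum>i\<in>I. \<Sum>x<n. f i $$ (x, x))" by (rule sum.swap)
  finally show ?thesis using assms by (auto simp: mat_trace_def intro!: sum.cong)
qed

lemma mult_mat_sum:
  assumes A: "A \<in> carrier_mat n n" and f: "\<And>i. i \<in> I \<Longrightarrow> f i \<in> carrier_mat n n"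
  shows "A * mat_sum n f I = mat_sum n (\<lambda>i. A * f i) I"
proof (rule eq_matI)
  fix x y assume "x < dim_row (mat_sum n (\<lambda>i. A * f i) I)" "y < dim_col (mat_sum n (\<lambda>i. A * f i) I)"
  hence xy: "x < n" "y < n" by (simp_all add: mat_sum_def)
  have "(A * mat_sum n f I) $$ (x, y) = (\<Sum>z<n. A $$ (x, z) * mat_sum n f I $$ (z, y))"
    by (rule mat_mult_index[OF A mat_sum_carrier xy])
  also have "\<dots> = (\<Sum>z<n. \<Sum>i\<in>I. A $$ (x, z) * f i $$ (z, y))"
    using xy by (simp add: mat_sum_def sum_distrib_left)
  also have "\<dots> = (\<Sum>i\<in>I. \<Sum>z<n. A $$ (x, z) * f i $$ (z, y))" by (rule sum.swap)
  also have "\<dots> = (\<Sum>i\<in>I. (A * f i) $$ (x, y))"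
    by (intro sum.cong refl mat_mult_index[OF A f xy, symmetric])
  finally show "(A * mat_sum n f I) $$ (x, y) = mat_sum n (\<lambda>i. A * f i) I $$ (x, y)"
    using xy by (simp add: mat_sum_def)
qed (use A in \<open>auto simp: mat_sum_def\<close>)

lemma mat_sum_mult:
  assumes A: "A \<in> carrier_mat n n" and f: "\<And>i. i \<in> I \<Longrightarrow> f i \<in> carrier_mat n n"
  shows "mat_sum n f I * A = mat_sum n (\<lambda>i. f i * A) I"
proof (rule eq_matI)
  fix x y assume "x < dim_row (mat_sum n (\<lambda>i. f i * A) I)" "y < dim_col (mat_sum n (\<lambda>i. f i * A) I)"
  hence xy: "x < n" "y < n" by (simp_all add: mat_sum_def)
  have "(mat_sum n f I * A) $$ (x, y) = (\<Sum>z<n. mat_sum n f I $$ (x, z) * A $$ (z, y))"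
    by (rule mat_mult_index[OF mat_sum_carrier A xy])
  also have "\<dots> = (\<Sum>z<n. \<Sum>i\<in>I. f i $$ (x, z) * A $$ (z, y))"
    using xy by (simp add: mat_sum_def sum_distrib_right)
  also have "\<dots> = (\<Sum>i\<in>I. \<Sum>z<n. f i $$ (x, z) * A $$ (z, y))" by (rule sum.swap)
  also have "\<dots> = (\<Sum>i\<in>I. (f i * A) $$ (x, y))"
    by (intro sum.cong refl mat_mult_index[OF f A xy, symmetric])
  finally show "(mat_sum n f I * A) $$ (x, y) = mat_sum n (\<lambda>i. f i * A) I $$ (x, y)"
    using xy by (simp add: mat_sum_def)
qed (use A in \<open>auto simp: mat_sum_def\<close>)

lemma hamiltonian_hermitian:
  assumes "local_terms d D L k h"
  shows "hamiltonian d (L ^ D) h \<in> carrier_mat (d ^ (L ^ D)) (d ^ (L ^ D))"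
    "hermitian_mat (hamiltonian d (L ^ D) h)"
proof -
  let ?n = "d ^ (L ^ D)"
  show c: "hamiltonian d (L ^ D) h \<in> carrier_mat ?n ?n" by (simp add: hamiltonian_def)
  have hc: "h i \<in> carrier_mat ?n ?n" "mat_adjoint (h i) = h i" if "i < L ^ D" for i
    using assms that supported_on_carrier unfolding local_terms_def hermitian_mat_def by blast+
  have "cnj (h i $$ (y, x)) = h i $$ (x, y)" if "i < L ^ D" "x < ?n" "y < ?n" for i x y
    using mat_adjoint_index[of x "h i" y] hc[OF that(1)] that by (metis carrier_matD)
  hence "mat_adjoint (hamiltonian d (L ^ D) h) = hamiltonian d (L ^ D) h"
    by (intro eq_matI) (auto simp: hamiltonian_def mat_sum_def intro!: sum.cong)
  thus "hermitian_mat (hamiltonian d (L ^ D) h)" using hermitian_mat_carrier[OF c] by simp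
qed

definition gibbs_weight :: "nat \<Rightarrow> real \<Rightarrow> (nat \<Rightarrow> real) \<Rightarrow> nat \<Rightarrow> real" where
  "gibbs_weight n \<beta> e i = exp (- \<beta> * e i) / (\<Sum>j<n. exp (- \<beta> * e j))"

lemma gibbs_weight_pos: "0 < n \<Longrightarrow> 0 < gibbs_weight n \<beta> e i"
  unfolding gibbs_weight_def by (intro divide_pos_pos sum_pos) auto

lemma gibbs_weight_sum: "0 < n \<Longrightarrow> (\<Sum>i<n. gibbs_weight n \<beta> e i) = 1"
proof -
  assume "0 < n"
  hence "0 < (\<Sum>j<n. exp (- \<beta> * e j))" by (intro sum_pos) auto
  thus ?thesis unfolding gibbs_weight_def by (simp flip: sum_divide_distrib)
qed

lemma gibbs_state_spec_mat:
  assumes U: "unitary_mat n U" and H: "H = real_spec_mat n U e"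
  shows "gibbs_state \<beta> H = real_spec_mat n U (gibbs_weight n \<beta> e)"
proof -
  note Uc = unitary_matD(1)[OF U]
  have "complex_of_real (- \<beta>) \<cdot>\<^sub>m H = spec_mat n U (\<lambda>i. complex_of_real (- \<beta> * e i))"
    unfolding H spec_mat_smult[OF Uc] by simp
  hence m: "mat_exp (complex_of_real (- \<beta>) \<cdot>\<^sub>m H) = spec_mat n U (\<lambda>i. complex_of_real (exp (- \<beta> * e i)))"
    unfolding mat_exp_spec_mat[OF U, symmetric] by (simp add: mat_exp_spec_mat[OF U] flip: exp_of_real)
  show ?thesis
    unfolding gibbs_state_def m trace_spec_mat[OF U] spec_mat_smult[OF Uc]
    by (intro spec_mat_cong) (simp add: gibbs_weight_def)
qed

section \<open>Energy variance from decay of correlations\<close>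

lemma site_dist_commute: "site_dist D L i j = site_dist D L j i"
  unfolding site_dist_def by (intro sum.cong refl arg_cong[of _ _ nat] abs_minus_commute)

lemma site_dist_triangle: "site_dist D L i j \<le> site_dist D L i m + site_dist D L m j"
  unfolding site_dist_def sum.distrib[symmetric]
  by (intro sum_mono) linarith

lemma sum_power_le:
  fixes q :: real
  assumes "0 \<le> q" "q < 1" "finite S"
  shows "(\<Sum>n\<in>S. q ^ n) \<le> 1 / (1 - q)"
  using sum_le_suminf[of "\<lambda>n. q ^ n" S] assms by (simp add: suminf_geometric)

text \<open>Split at \<open>x\<close>: on each side the distance is injective, which leaves two
  partial sums of the same geometric series.\<close>

lemma sum_power_abs_le:
  fixes q :: real
  assumes q: "0 \<le> q" "q < 1"
  shows "(\<Sum>c<L. q ^ nat \<bar>int x - int c\<bar>) \<le> 2 / (1 - q)"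
proof -
  have "(\<Sum>c<L. q ^ nat \<bar>int x - int c\<bar>) =
      (\<Sum>c\<in>{c. c < L \<and> c \<le> x}. q ^ nat \<bar>int x - int c\<bar>) + (\<Sum>c\<in>{c. c < L \<and> x < c}. q ^ nat \<bar>int x - int c\<bar>)"
    by (subst sum.union_disjoint[symmetric]) (auto intro!: sum.cong)
  also have "(\<Sum>c\<in>{c. c < L \<and> c \<le> x}. q ^ nat \<bar>int x - int c\<bar>) = (\<Sum>m\<in>(\<lambda>c. x - c) ` {c. c < L \<and> c \<le> x}. q ^ m)"
    by (subst sum.reindex) (auto intro!: inj_onI sum.cong arg_cong[of _ _ "\<lambda>m. q ^ m"])
  also have "\<dots> \<le> 1 / (1 - q)" by (intro sum_power_le q) auto
  also have "(\<Sum>c\<in>{c. c < L \<and> x < c}. q ^ nat \<bar>int x - int c\<bar>) = (\<Sum>m\<in>(\<lambda>c. c - x) ` {c. c < L \<and> x < c}. q ^ m)"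
    by (subst sum.reindex) (auto intro!: inj_onI sum.cong arg_cong[of _ _ "\<lambda>m. q ^ m"])
  also have "\<dots> \<le> 1 / (1 - q)" by (intro sum_power_le q) auto
  finally show ?thesis by simp
qed

text \<open>Distributivity over the coordinates, by induction on the dimension with the sites
  grouped by their leading digit.\<close>

lemma sum_prod_digit:
  fixes f :: "nat \<Rightarrow> nat \<Rightarrow> real"
  assumes L: "1 \<le> L"
  shows "(\<Sum>j<L ^ D. \<Prod>a<D. f a (digit L j a)) = (\<Prod>a<D. \<Sum>c<L. f a c)"
proof (induction D)
  case (Suc D)
  let ?k = "L ^ D"
  have dtop: "digit L (j + c * ?k) D = c" if "j < ?k" "c < L" for j c
    using that L by (simp add: digit_def)
  have "(\<Sum>j<L ^ Suc D. \<Prod>a<Suc D. f a (digit L j a)) = (\<Sum>j<L * ?k. \<Prod>a<Suc D. f a (digit L j a))" by simp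
  also have "\<dots> = (\<Sum>c<L. \<Sum>j\<in>{c * ?k..<c * ?k + ?k}. \<Prod>a<Suc D. f a (digit L j a))"
    by (rule sum.nat_group[symmetric])
  also have "\<dots> = (\<Sum>c<L. \<Sum>j<?k. \<Prod>a<Suc D. f a (digit L (j + c * ?k) a))"
  proof (rule sum.cong[OF refl])
    fix c
    show "(\<Sum>j\<in>{c * ?k..<c * ?k + ?k}. \<Prod>a<Suc D. f a (digit L j a)) =
        (\<Sum>j<?k. \<Prod>a<Suc D. f a (digit L (j + c * ?k) a))"
      by (rule sum.reindex_bij_witness[of _ "\<lambda>j. j + c * ?k" "\<lambda>j. j - c * ?k"]) auto
  qed
  also have "\<dots> = (\<Sum>c<L. \<Sum>j<?k. (\<Prod>a<D. f a (digit L j a)) * f D c)"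
    by (intro sum.cong refl) (simp add: digit_add_mult[OF L] dtop)
  also have "\<dots> = (\<Prod>a<Suc D. \<Sum>c<L. f a c)"
    by (simp add: Suc.IH flip: sum_distrib_left sum_distrib_right)
  finally show ?case .
qed simp

text \<open>For the Manhattan distance the summand is a product over coordinates; the bound obtained
  does not depend on \<open>L\<close>.\<close>

lemma sum_site_dist_le:
  fixes q :: real
  assumes L: "1 \<le> L" and q: "0 \<le> q" "q < 1"
  shows "(\<Sum>j<L ^ D. q ^ site_dist D L i j) \<le> (2 / (1 - q)) ^ D"
proof -
  have "(\<Sum>j<L ^ D. q ^ site_dist D L i j) =
      (\<Sum>j<L ^ D. \<Prod>a<D. (\<lambda>a c. q ^ nat \<bar>int (digit L i a) - int c\<bar>) a (digit L j a))"
    by (simp add: site_dist_def power_sum)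
  also have "\<dots> = (\<Prod>a<D. \<Sum>c<L. q ^ nat \<bar>int (digit L i a) - int c\<bar>)"
    by (rule sum_prod_digit[OF L])
  also have "\<dots> \<le> (\<Prod>a<D. 2 / (1 - q))"
    using q by (intro prod_mono conjI sum_nonneg sum_power_abs_le) auto
  finally show ?thesis by simp
qed

text \<open>The variance is the sum of all covariances of local terms, and for a fixed term these
  sum to a constant by exponential decay. The upper bound on \<sigma> is wanted because the Gaussian
  density in the bins carries the factor 1/\<sigma>.\<close>

lemma gibbs_variance_le:
  assumes d: "1 \<le> d" and L: "1 \<le> L" and h: "local_terms d D L k h" and \<xi>: "0 < \<xi>"
    and decay: "exp_decay_correlations d D L \<xi> (gibbs_state \<beta> (hamiltonian d (L ^ D) h))"
  shows "(gibbs_sd \<beta> (hamiltonian d (L ^ D) h))\<^sup>2 \<le>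
    real (L ^ D) * (exp (2 * k / \<xi>) * (2 / (1 - exp (- 1 / \<xi>))) ^ D)"
proof -
  let ?N = "L ^ D" let ?n = "d ^ (L ^ D)"
  define H where "H = hamiltonian d ?N h"
  define \<tau> where "\<tau> = gibbs_state \<beta> H"
  have Hc: "H \<in> carrier_mat ?n ?n" and Hh: "hermitian_mat H" unfolding H_def by (rule hamiltonian_hermitian[OF h])+
  obtain U e where U: "unitary_mat ?n U" and He: "H = real_spec_mat ?n U e"
    using spectral_theorem[OF Hc Hh] by blast
  note Uc = unitary_matD(1)[OF U]
  have \<tau>: "\<tau> = real_spec_mat ?n U (gibbs_weight ?n \<beta> e)"
    unfolding \<tau>_def by (rule gibbs_state_spec_mat[OF U He])
  have \<tau>c: "\<tau> \<in> carrier_mat ?n ?n" using Uc by (simp add: \<tau>)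
  define X where "X i = {j. j < ?N \<and> site_dist D L i j \<le> k}" for i
  have hX: "supported_on d ?N (X i) (h i)" "op_norm (h i) = 1" if "i < ?N" for i
    using h that unfolding local_terms_def X_def by blast+
  have hc: "h i \<in> carrier_mat ?n ?n" if "i < ?N" for i using supported_on_carrier[OF hX(1)[OF that]] .
  let ?q = "exp (- 1 / \<xi>)"
  define cv where "cv i j = mat_trace (\<tau> * h i * h j) - mat_trace (\<tau> * h i) * mat_trace (\<tau> * h j)" for i j
  have cov: "cmod (cv i j) \<le> exp (2 * k / \<xi>) * ?q ^ site_dist D L i j" if ij: "i < ?N" "j < ?N" for i j
  proof -
    have sub: "X i \<subseteq> {..<?N}" "X j \<subseteq> {..<?N}" by (auto simp: X_def)
    have ne: "i \<in> X i" "j \<in> X j" using ij by (auto simp: X_def)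
    let ?I = "(\<lambda>(i, j). site_dist D L i j) ` (X i \<times> X j)"
    have "finite ?I" using sub by (intro finite_imageI finite_cartesian_product) (auto intro: finite_subset)
    moreover have "?I \<noteq> {}" using ne by auto
    ultimately have "region_dist D L (X i) (X j) \<in> ?I" unfolding region_dist_def by (rule Min_in)
    then obtain a b where ab: "a \<in> X i" "b \<in> X j" "region_dist D L (X i) (X j) = site_dist D L a b" by auto
    \<comment> \<open>Through nearest points \<open>a\<close> and \<open>b\<close> of the two
      supports; each lies within \<open>k\<close> of its centre, whence
      \<open>2 * k\<close>.\<close>
    have "site_dist D L i j \<le> site_dist D L i a + site_dist D L a j" by (rule site_dist_triangle)
    also have "site_dist D L a j \<le> site_dist D L a b + site_dist D L b j" by (rule site_dist_triangle)
    finally have "site_dist D L i j \<le> region_dist D L (X i) (X j) + 2 * k"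
      using ab site_dist_commute[of D L b j] by (simp add: X_def)
    hence "real (site_dist D L i j) \<le> real (region_dist D L (X i) (X j)) + 2 * real k"
      by (metis of_nat_add of_nat_le_iff of_nat_mult of_nat_numeral)
    hence "real (site_dist D L i j) / \<xi> \<le> (real (region_dist D L (X i) (X j)) + 2 * real k) / \<xi>"
      using \<xi> by (intro divide_right_mono) auto
    hence le: "- real (region_dist D L (X i) (X j)) / \<xi> \<le> 2 * k / \<xi> + real (site_dist D L i j) * (- 1 / \<xi>)"
      by (simp add: add_divide_distrib)
    have "cmod (cv i j) \<le> op_norm (h i) * op_norm (h j) * exp (- real (region_dist D L (X i) (X j)) / \<xi>)"
      using decay sub ne hX(1) ij unfolding exp_decay_correlations_def cv_def \<tau>_def H_def by blast
    also have "\<dots> = exp (- real (region_dist D L (X i) (X j)) / \<xi>)" using hX(2) ij by simp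
    also have "\<dots> \<le> exp (2 * k / \<xi> + real (site_dist D L i j) * (- 1 / \<xi>))" using le by simp
    also have "\<dots> = exp (2 * k / \<xi>) * ?q ^ site_dist D L i j" by (simp only: exp_add exp_of_nat_mult)
    finally show ?thesis .
  qed
  have Hs: "H = mat_sum ?n h {..<?N}" by (simp add: H_def hamiltonian_def)
  have tH: "mat_trace (\<tau> * H) = (\<Sum>i<?N. mat_trace (\<tau> * h i))"
    unfolding Hs using \<tau>c hc
    by (subst mult_mat_sum) (auto intro!: mat_trace_mat_sum mult_carrier_mat[of _ ?n ?n])
  have "\<tau> * (H * H) = \<tau> * H * H" using \<tau>c Hc by (intro assoc_mult_mat[symmetric])
  also have "\<tau> * H = mat_sum ?n (\<lambda>i. \<tau> * h i) {..<?N}"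
    unfolding Hs using \<tau>c hc by (intro mult_mat_sum) auto
  finally have tHH: "mat_trace (\<tau> * (H * H)) = (\<Sum>j<?N. \<Sum>i<?N. mat_trace (\<tau> * h i * h j))"
  proof -
    assume eq: "\<tau> * (H * H) = mat_sum ?n (\<lambda>i. \<tau> * h i) {..<?N} * H"
    have c1: "\<tau> * h i \<in> carrier_mat ?n ?n" if "i < ?N" for i using \<tau>c hc[OF that] by (rule mult_carrier_mat)
    have c2: "\<tau> * h i * h j \<in> carrier_mat ?n ?n" if "i < ?N" "j < ?N" for i j
      using c1[OF that(1)] hc[OF that(2)] by (rule mult_carrier_mat)
    have e2: "mat_sum ?n (\<lambda>i. \<tau> * h i) {..<?N} * h j = mat_sum ?n (\<lambda>i. \<tau> * h i * h j) {..<?N}" if "j < ?N" for j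
      using hc[OF that] c1 by (intro mat_sum_mult) auto
    have "mat_sum ?n (\<lambda>i. \<tau> * h i) {..<?N} * H = mat_sum ?n (\<lambda>j. mat_sum ?n (\<lambda>i. \<tau> * h i) {..<?N} * h j) {..<?N}"
      unfolding Hs by (rule mult_mat_sum[OF mat_sum_carrier]) (simp add: hc)
    hence "mat_trace (\<tau> * (H * H)) = mat_trace (mat_sum ?n (\<lambda>j. mat_sum ?n (\<lambda>i. \<tau> * h i) {..<?N} * h j) {..<?N})"
      unfolding eq by (rule arg_cong)
    also have "\<dots> = (\<Sum>j<?N. mat_trace (mat_sum ?n (\<lambda>i. \<tau> * h i) {..<?N} * h j))"
      using e2 by (intro mat_trace_mat_sum) auto
    also have "\<dots> = (\<Sum>j<?N. \<Sum>i<?N. mat_trace (\<tau> * h i * h j))"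
    proof (rule sum.cong[OF refl])
      fix j assume "j \<in> {..<?N}"
      hence j: "j < ?N" by simp
      show "mat_trace (mat_sum ?n (\<lambda>i. \<tau> * h i) {..<?N} * h j) = (\<Sum>i<?N. mat_trace (\<tau> * h i * h j))"
        unfolding e2[OF j] by (rule mat_trace_mat_sum) (rule c2, use j in auto)
    qed
    finally show ?thesis .
  qed
  have "mat_adjoint H = H" using Hh hermitian_mat_carrier[OF Hc] by simp
  hence real: "mat_trace (\<tau> * H) = complex_of_real (Re (mat_trace (\<tau> * H)))"
    using trace_spec_hermitian[OF Uc Hc, of "gibbs_weight ?n \<beta> e"] unfolding \<tau> by simp
  have sq: "(Re (mat_trace (\<tau> * H)))\<^sup>2 = Re (\<Sum>j<?N. \<Sum>i<?N. mat_trace (\<tau> * h i) * mat_trace (\<tau> * h j))"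
  proof -
    have "complex_of_real ((Re (mat_trace (\<tau> * H)))\<^sup>2) = mat_trace (\<tau> * H) * mat_trace (\<tau> * H)"
      using real by (simp add: power2_eq_square)
    also have "\<dots> = (\<Sum>j<?N. \<Sum>i<?N. mat_trace (\<tau> * h i) * mat_trace (\<tau> * h j))"
      unfolding tH sum_product by (rule sum.swap)
    finally show ?thesis by (metis Re_complex_of_real)
  qed
  have var: "Re (mat_trace (\<tau> * (H * H))) - (Re (mat_trace (\<tau> * H)))\<^sup>2 = Re (\<Sum>j<?N. \<Sum>i<?N. cv i j)"
    unfolding sq tHH cv_def by (simp add: sum_subtractf)
  have "\<bar>Re (\<Sum>j<?N. \<Sum>i<?N. cv i j)\<bar> \<le> cmod (\<Sum>j<?N. \<Sum>i<?N. cv i j)" by (rule abs_Re_le_cmod)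
  also have "\<dots> \<le> (\<Sum>j<?N. \<Sum>i<?N. exp (2 * k / \<xi>) * ?q ^ site_dist D L i j)"
    by (intro order.trans[OF norm_sum] sum_mono cov) auto
  also have "\<dots> = (\<Sum>j<?N. exp (2 * k / \<xi>) * (\<Sum>i<?N. ?q ^ site_dist D L j i))"
    by (simp add: sum_distrib_left site_dist_commute)
  also have "\<dots> \<le> (\<Sum>j<?N. exp (2 * k / \<xi>) * (2 / (1 - ?q)) ^ D)"
    using \<xi> by (intro sum_mono mult_left_mono sum_site_dist_le L) auto
  also have "\<dots> = real ?N * (exp (2 * k / \<xi>) * (2 / (1 - ?q)) ^ D)" by simp
  finally have bound: "\<bar>Re (mat_trace (\<tau> * (H * H))) - (Re (mat_trace (\<tau> * H)))\<^sup>2\<bar> \<le>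
      real ?N * (exp (2 * k / \<xi>) * (2 / (1 - ?q)) ^ D)" unfolding var .
  \<comment> \<open>\<open>sqrt\<close> is odd on the reals, so its square is the absolute value of
    the argument whatever the sign.\<close>
  have "(gibbs_sd \<beta> H)\<^sup>2 = \<bar>Re (mat_trace (\<tau> * (H * H))) - (Re (mat_trace (\<tau> * H)))\<^sup>2\<bar>"
    unfolding gibbs_sd_def \<tau>_def[symmetric] by (simp only: power2_eq_square[of "sqrt _"] real_sqrt_mult_self)
  thus ?thesis using bound unfolding H_def by simp
qed



section \<open>Eigenvalue weights of the ensemble\<close>

lemma spec_mat_eigenvalue:
  assumes U: "unitary_mat n U" and H: "H = real_spec_mat n U e"
    and ev: "eigenvalue H (complex_of_real c)"
  shows "\<exists>i<n. e i = c"
proof (rule ccontr)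
  assume no: "\<not> (\<exists>i<n. e i = c)"
  note Uc = unitary_matD(1)[OF U]
  obtain v where ev: "eigenvector H v (complex_of_real c)" using ev by (auto simp: eigenvalue_def)
  hence v: "v \<in> carrier_vec n" "v \<noteq> 0\<^sub>v n" using Uc by (auto simp: eigenvector_def H)
  have "(spec_mat n U (\<lambda>_. 1) *\<^sub>v v) $ x = 0" if "x < n" for x
    unfolding spec_mat_mult_vec[OF Uc v(1) that] using eigenvector_orthogonal[OF U H ev] no by (intro sum.neutral) auto
  hence "v = 0\<^sub>v n" using spec_mat_one[OF U] v(1) by (intro eq_vecI) auto
  thus False using v(2) by simp
qed

text \<open>The trace of the spectral projection of \<open>S\<close>: levels are counted with
  multiplicity, along the columns of the diagonalising unitary.\<close>

definition bin_count :: "nat \<Rightarrow> (nat \<Rightarrow> real) \<Rightarrow> real set \<Rightarrow> nat" where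
  "bin_count n e S = card {i. i < n \<and> e i \<in> S}"

definition gme_weight :: "nat \<Rightarrow> (nat \<Rightarrow> real) \<Rightarrow> nat \<Rightarrow> (nat \<Rightarrow> real set) \<Rightarrow> (nat \<Rightarrow> real) \<Rightarrow> nat \<Rightarrow> real" where
  "gme_weight n e K b q i = (\<Sum>j<K. q j * (if e i \<in> b j then 1 / real (bin_count n e (b j)) else 0))"

lemma sum_indicator_bin: "(\<Sum>i<n. if e i \<in> S then 1 else 0) = of_nat (bin_count n e S)"
proof -
  have "(\<Sum>i<n. if e i \<in> S then 1 else 0) = (\<Sum>i\<in>{i \<in> {..<n}. e i \<in> S}. 1 :: 'b :: semiring_1)"
    by (rule sum.inter_filter[symmetric]) simp
  thus ?thesis by (simp add: bin_count_def)
qed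

lemma gme_spec_mat:
  assumes U: "unitary_mat n U" and H: "H = real_spec_mat n U e"
  shows "gme H K b q = real_spec_mat n U (gme_weight n e K b q)"
proof -
  note Uc = unitary_matD(1)[OF U]
  have dimH: "dim_row H = n" using Uc by (simp add: H)
  have "complex_of_real (q j) \<cdot>\<^sub>m max_mixed H (b j) =
      spec_mat n U (\<lambda>i. complex_of_real (q j * (if e i \<in> b j then 1 / real (bin_count n e (b j)) else 0)))" for j
    unfolding max_mixed_def spec_proj_spec_mat[OF U H] trace_spec_mat[OF U] sum_indicator_bin
      spec_mat_smult[OF Uc] by (intro spec_mat_cong) simp
  thus ?thesis unfolding gme_def dimH spec_mat_sum[OF Uc] by (simp add: gme_weight_def spec_mat_sum[OF Uc])
qed

lemma gme_weight_nonneg: "gme_weights H K b q \<Longrightarrow> 0 \<le> gme_weight n e K b q i"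
  unfolding gme_weight_def gme_weights_def by (intro sum_nonneg mult_nonneg_nonneg) auto

lemma gme_weight_sum:
  assumes U: "unitary_mat n U" and H: "H = real_spec_mat n U e"
    and q: "gme_weights H K b q"
  shows "(\<Sum>i<n. gme_weight n e K b q i) = 1"
proof -
  have "(\<Sum>i<n. gme_weight n e K b q i) =
      (\<Sum>j<K. \<Sum>i<n. q j * (if e i \<in> b j then 1 / real (bin_count n e (b j)) else 0))"
    unfolding gme_weight_def by (rule sum.swap)
  also have "\<dots> = (\<Sum>j<K. q j)"
  proof (intro sum.cong refl)
    fix j assume j: "j \<in> {..<K}"
    have "(\<Sum>i<n. q j * (if e i \<in> b j then 1 / real (bin_count n e (b j)) else 0)) =
        q j / real (bin_count n e (b j)) * (\<Sum>i<n. if e i \<in> b j then 1 else 0)"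
      unfolding sum_distrib_left by (intro sum.cong) auto
    also have "\<dots> = q j / real (bin_count n e (b j)) * real (bin_count n e (b j))"
      unfolding sum_indicator_bin ..
    also have "\<dots> = q j"
    \<comment> \<open>A bin of nonzero weight contains an eigenvalue, so its count is nonzero and
      cancels.\<close>
    proof (cases "q j = 0")
      case False
      then obtain c where c: "c \<in> b j" "eigenvalue H (complex_of_real c)"
        using q j unfolding gme_weights_def by blast
      then obtain i where "i < n" "e i = c" using spec_mat_eigenvalue[OF U H] by blast
      hence "i \<in> {i. i < n \<and> e i \<in> b j}" using c by simp
      hence "bin_count n e (b j) \<noteq> 0" unfolding bin_count_def using card_eq_0_iff[of "{i. i < n \<and> e i \<in> b j}"] by auto
      thus ?thesis by simp
    qed simp
    finally show "(\<Sum>i<n. q j * (if e i \<in> b j then 1 / real (bin_count n e (b j)) else 0)) = q j" .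
  qed
  also have "\<dots> = 1" using q by (simp add: gme_weights_def)
  finally show ?thesis .
qed

text \<open>The source of \<open>lam = exp B / p\<close>. Gibbs weights on \<open>I\<close> exceed
  the weight at any level of the bin by a factor of at most \<open>exp B\<close>. Hence
  \<open>p\<close> is at most the number of levels in the bin times \<open>exp B\<close> times the
  Gibbs weight of level \<open>i\<close>, which bounds the uniform weight from above; averaging with
  the probability vector \<open>q\<close> keeps the bound.\<close>

lemma gme_weight_le:
  assumes q: "gme_weights H K b q" and p: "0 < p" and i: "i < n"
    and sub: "\<And>j. j < K \<Longrightarrow> \<exists>I. I \<subseteq> b j \<and> p \<le> (\<Sum>m<n. if e m \<in> I then gibbs_weight n \<beta> e m else 0) \<and>
      (\<forall>x\<in>b j. \<forall>y\<in>I. \<beta> * (x - y) \<le> B)"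
  shows "gme_weight n e K b q i \<le> exp B / p * gibbs_weight n \<beta> e i"
proof -
  let ?g = "gibbs_weight n \<beta> e"
  let ?c = "exp B / p * ?g i"
  have n: "0 < n" using i by simp
  have g0: "0 < ?g m" for m by (rule gibbs_weight_pos[OF n])
  have Z: "0 < (\<Sum>j<n. exp (- \<beta> * e j))" using n by (intro sum_pos) auto
  have "q j * (if e i \<in> b j then 1 / real (bin_count n e (b j)) else 0) \<le> q j * ?c" if j: "j \<in> {..<K}" for j
  proof (rule mult_left_mono)
    show "0 \<le> q j" using q j by (simp add: gme_weights_def)
    show "(if e i \<in> b j then 1 / real (bin_count n e (b j)) else 0) \<le> ?c"
    proof (cases "e i \<in> b j")
      case False
      thus ?thesis using p g0[of i] by simp
    next
      case True
      obtain I where I: "I \<subseteq> b j" "p \<le> (\<Sum>m<n. if e m \<in> I then ?g m else 0)"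
        "\<And>x y. x \<in> b j \<Longrightarrow> y \<in> I \<Longrightarrow> \<beta> * (x - y) \<le> B" using sub[of j] j by auto
      have "p \<le> (\<Sum>m<n. if e m \<in> I then ?g m else 0)" by (rule I(2))
      \<comment> \<open>The levels in \<open>I\<close> are overcounted by all levels of the bin,
        whose number is the one in the maximally mixed state.\<close>
      also have "\<dots> \<le> (\<Sum>m<n. (if e m \<in> b j then 1 else 0) * (exp B * ?g i))"
      proof (intro sum_mono)
        fix m assume "m \<in> {..<n}"
        show "(if e m \<in> I then ?g m else 0) \<le> (if e m \<in> b j then 1 else 0) * (exp B * ?g i)"
        proof (cases "e m \<in> I")
          case True
          have "\<beta> * (e i - e m) \<le> B" using I(3)[OF \<open>e i \<in> b j\<close> True] .
          hence "exp (- \<beta> * e m) \<le> exp B * exp (- \<beta> * e i)" by (simp add: algebra_simps flip: exp_add)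
          hence "?g m \<le> exp B * ?g i" using Z by (simp add: gibbs_weight_def divide_right_mono)
          thus ?thesis using True I(1) by auto
        qed (use g0[of i] in auto)
      qed
      also have "\<dots> = real (bin_count n e (b j)) * (exp B * ?g i)"
        unfolding sum_distrib_right[symmetric] sum_indicator_bin ..
      finally have le: "p \<le> real (bin_count n e (b j)) * (exp B * ?g i)" .
      have "0 < real (bin_count n e (b j))"
      proof (rule ccontr)
        assume "\<not> 0 < real (bin_count n e (b j))"
        hence "bin_count n e (b j) = 0" by simp
        thus False using le p by simp
      qed
      thus ?thesis using le p True by (simp add: field_simps)
    qed
  qed
  hence "gme_weight n e K b q i \<le> (\<Sum>j<K. q j * ?c)" unfolding gme_weight_def by (rule sum_mono)
  also have "\<dots> = (\<Sum>j<K. q j) * ?c" by (rule sum_distrib_right[symmetric])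
  also have "\<dots> = ?c" using q by (simp add: gme_weights_def)
  finally show ?thesis .
qed

section \<open>Gibbs weight of energy intervals\<close>

lemma gaussian_cdf_bounds:
  assumes "0 < \<sigma>"
  shows "0 \<le> gaussian_cdf \<mu> \<sigma> x" "gaussian_cdf \<mu> \<sigma> x \<le> 1"
proof -
  interpret prob_space "density lborel (\<lambda>y. ennreal (normal_density \<mu> \<sigma> y))"
    by (rule prob_space_normal_density[OF assms])
  show "0 \<le> gaussian_cdf \<mu> \<sigma> x" "gaussian_cdf \<mu> \<sigma> x \<le> 1"
    unfolding gaussian_cdf_def cdf_def by simp_all
qed

lemma gaussian_cdf_diff_ge:
  assumes \<sigma>: "0 < \<sigma>" and xy: "x \<le> y" and c: "0 \<le> c" "\<And>z. x < z \<Longrightarrow> z \<le> y \<Longrightarrow> c \<le> normal_density \<mu> \<sigma> z"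
  shows "c * (y - x) \<le> gaussian_cdf \<mu> \<sigma> y - gaussian_cdf \<mu> \<sigma> x"
proof -
  let ?M = "density lborel (\<lambda>y. ennreal (normal_density \<mu> \<sigma> y))"
  interpret prob_space ?M by (rule prob_space_normal_density[OF \<sigma>])
  have "ennreal (c * (y - x)) = (\<integral>\<^sup>+z. ennreal c * indicator {x<..y} z \<partial>lborel)"
    using xy c by (simp add: nn_integral_cmult_indicator ennreal_mult)
  also have "\<dots> \<le> (\<integral>\<^sup>+z. ennreal (normal_density \<mu> \<sigma> z) * indicator {x<..y} z \<partial>lborel)"
    using c by (intro nn_integral_mono) (auto simp: indicator_def intro!: ennreal_leI)
  also have "\<dots> = emeasure ?M {x<..y}" by (simp add: emeasure_density)
  also have "\<dots> = ennreal (measure ?M {x<..y})" by (simp add: emeasure_eq_measure)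
  finally have "c * (y - x) \<le> measure ?M {x<..y}" by (simp add: ennreal_le_iff)
  also have "{x<..y} = {..y} - {..x}" by auto
  also have "measure ?M ({..y} - {..x}) = measure ?M {..y} - measure ?M {..x}"
    using xy by (intro finite_measure_Diff) auto
  finally show ?thesis by (simp add: gaussian_cdf_def cdf_def)
qed

text \<open>The error is a supremum over all reals and dominates single deviations only if these are
  bounded; they are, as both distribution functions take values between 0 and 1.\<close>

lemma berry_esseen_bound:
  assumes U: "unitary_mat n U" and H: "H = real_spec_mat n U e" and n: "0 < n"
    and \<sigma>: "0 < gibbs_sd \<beta> H"
  shows "\<bar>(\<Sum>i<n. if e i < x then gibbs_weight n \<beta> e i else 0) - gaussian_cdf (gibbs_energy \<beta> H) (gibbs_sd \<beta> H) x\<bar>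
    \<le> berry_esseen_error \<beta> H"
proof -
  let ?P = "\<lambda>x. \<Sum>i<n. if e i < x then gibbs_weight n \<beta> e i else 0"
  let ?G = "gaussian_cdf (gibbs_energy \<beta> H) (gibbs_sd \<beta> H)"
  have P: "Re (mat_trace (gibbs_state \<beta> H * spec_proj H {..<x})) = ?P x" for x
  proof -
    have "mat_trace (gibbs_state \<beta> H * spec_proj H {..<x}) =
        (\<Sum>i<n. complex_of_real (gibbs_weight n \<beta> e i) * (if e i \<in> {..<x} then 1 else 0))"
      unfolding gibbs_state_spec_mat[OF U H] spec_proj_spec_mat[OF U H] spec_mat_mult[OF U] trace_spec_mat[OF U] ..
    also have "\<dots> = complex_of_real (?P x)" unfolding of_real_sum by (intro sum.cong) auto
    finally show ?thesis by simp
  qed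
  have b: "\<bar>?P x - ?G x\<bar> \<le> 1" for x
  proof -
    have "0 \<le> ?P x" using gibbs_weight_pos[OF n, of \<beta> e] by (intro sum_nonneg) (auto intro: less_imp_le)
    moreover have "?P x \<le> (\<Sum>i<n. gibbs_weight n \<beta> e i)"
      using gibbs_weight_pos[OF n, of \<beta> e] by (intro sum_mono) (auto intro: less_imp_le)
    ultimately show ?thesis using gibbs_weight_sum[OF n, of \<beta> e] gaussian_cdf_bounds[OF \<sigma>, of "gibbs_energy \<beta> H" x] by linarith
  qed
  have "bdd_above (range (\<lambda>x. \<bar>?P x - ?G x\<bar>))" by (rule bdd_aboveI2[of _ _ 1]) (rule b)
  hence "\<bar>?P x - ?G x\<bar> \<le> (SUP x. \<bar>?P x - ?G x\<bar>)" by (intro cSUP_upper) auto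
  thus ?thesis unfolding berry_esseen_error_def P .
qed

text \<open>The distribution functions are compared at both end points, hence twice the
  error.\<close>

lemma gibbs_interval_weight_ge:
  assumes U: "unitary_mat n U" and H: "H = real_spec_mat n U e" and n: "0 < n"
    and \<sigma>: "0 < gibbs_sd \<beta> H" and xy: "x \<le> y"
    and c: "0 \<le> c" "\<And>z. x < z \<Longrightarrow> z \<le> y \<Longrightarrow> c \<le> normal_density (gibbs_energy \<beta> H) (gibbs_sd \<beta> H) z"
  shows "c * (y - x) - 2 * berry_esseen_error \<beta> H \<le> (\<Sum>i<n. if e i \<in> {x..<y} then gibbs_weight n \<beta> e i else 0)"
proof -
  let ?P = "\<lambda>x. \<Sum>i<n. if e i < x then gibbs_weight n \<beta> e i else 0"
  have "(\<Sum>i<n. if e i \<in> {x..<y} then gibbs_weight n \<beta> e i else 0) = ?P y - ?P x"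
    unfolding sum_subtractf[symmetric] using xy by (intro sum.cong) auto
  thus ?thesis
    using berry_esseen_bound[OF U H n \<sigma>, of x] berry_esseen_bound[OF U H n \<sigma>, of y] gaussian_cdf_diff_ge[OF \<sigma> xy c] by linarith
qed

text \<open>Nonnegativity of the square of \<Delta> - 2\<sigma> gives (\<Delta> + \<sigma>)^2 \<le>
  (3/2) \<Delta>^2 + 3 \<sigma>^2. The uneven weights matter: they produce the exponent 3/4, whereas
  weights 2 and 2 would produce 1 and leave no power of N to beat the Berry--Esseen error.\<close>

lemma normal_density_ge:
  assumes \<sigma>: "0 < \<sigma>" and z: "\<bar>z - \<mu>\<bar> \<le> \<Delta> + \<sigma>"
  shows "exp (- (3 / 2)) * exp (\<Delta>\<^sup>2 / \<sigma>\<^sup>2) powr (- (3 / 4)) / (sqrt (2 * pi) * \<sigma>) \<le> normal_density \<mu> \<sigma> z"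
proof -
  have "(z - \<mu>)\<^sup>2 \<le> (\<Delta> + \<sigma>)\<^sup>2" using power_mono[OF z abs_ge_zero, of 2] by simp
  also have "\<dots> \<le> 3 / 2 * \<Delta>\<^sup>2 + 3 * \<sigma>\<^sup>2"
    using zero_le_power2[of "\<Delta> - 2 * \<sigma>"] by (simp add: power2_eq_square algebra_simps)
  finally have "(z - \<mu>)\<^sup>2 / (2 * \<sigma>\<^sup>2) \<le> (3 / 2 * \<Delta>\<^sup>2 + 3 * \<sigma>\<^sup>2) / (2 * \<sigma>\<^sup>2)" by (intro divide_right_mono) auto
  also have "\<dots> = 3 / 4 * (\<Delta>\<^sup>2 / \<sigma>\<^sup>2) + 3 / 2" using \<sigma> by (simp add: field_simps)
  finally have "exp (- (3 / 2) + - (3 / 4) * (\<Delta>\<^sup>2 / \<sigma>\<^sup>2)) \<le> exp (- (z - \<mu>)\<^sup>2 / (2 * \<sigma>\<^sup>2))" by simp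
  moreover have "exp (- (3 / 2)) * exp (\<Delta>\<^sup>2 / \<sigma>\<^sup>2) powr (- (3 / 4)) = exp (- (3 / 2) + - (3 / 4) * (\<Delta>\<^sup>2 / \<sigma>\<^sup>2))"
    unfolding exp_add by (simp add: powr_def)
  ultimately have "exp (- (3 / 2)) * exp (\<Delta>\<^sup>2 / \<sigma>\<^sup>2) powr (- (3 / 4)) \<le> exp (- (z - \<mu>)\<^sup>2 / (2 * \<sigma>\<^sup>2))"
    by simp
  hence "exp (- (3 / 2)) * exp (\<Delta>\<^sup>2 / \<sigma>\<^sup>2) powr (- (3 / 4)) / (sqrt (2 * pi) * \<sigma>) \<le> exp (- (z - \<mu>)\<^sup>2 / (2 * \<sigma>\<^sup>2)) / (sqrt (2 * pi) * \<sigma>)"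
    using \<sigma> by (intro divide_right_mono) auto
  also have "\<dots> = normal_density \<mu> \<sigma> z" using \<sigma> by (simp add: normal_density_def real_sqrt_mult)
  finally show ?thesis .
qed

text \<open>The slice width \<open>\<delta>'\<close> is decoupled from the bin width: its Gaussian
  weight has to exceed the Berry--Esseen error, while
  \<open>exp (2 * \<bar>\<beta>\<bar> * \<delta>')\<close> should stay small.\<close>

lemma gme_le_gibbs:
  assumes U: "unitary_mat n U" and H: "H = real_spec_mat n U e" and n: "0 < n"
    and \<sigma>: "0 < gibbs_sd \<beta> H" and q: "gme_weights H K b q"
    and bins: "equal_bins E \<Delta> \<delta> K b" and E: "\<bar>E - gibbs_energy \<beta> H\<bar> \<le> gibbs_sd \<beta> H"
    and \<delta>': "0 < \<delta>'" "3 * \<delta>' \<le> \<delta>" and p: "0 < p"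
    and le: "p \<le> exp (- (3 / 2)) * exp (\<Delta>\<^sup>2 / (gibbs_sd \<beta> H)\<^sup>2) powr (- (3 / 4)) / (sqrt (2 * pi) * gibbs_sd \<beta> H) * \<delta>'
        - 2 * berry_esseen_error \<beta> H"
    and i: "i < n"
  shows "gme_weight n e K b q i \<le> exp (2 * \<bar>\<beta>\<bar> * \<delta>') / p * gibbs_weight n \<beta> e i"
proof (rule gme_weight_le[OF q p i])
  fix j assume j: "j < K"
  let ?\<mu> = "gibbs_energy \<beta> H" and ?\<sigma> = "gibbs_sd \<beta> H"
  let ?c = "exp (- (3 / 2)) * exp (\<Delta>\<^sup>2 / ?\<sigma>\<^sup>2) powr (- (3 / 4)) / (sqrt (2 * pi) * ?\<sigma>)"
  define a where "a = E - \<Delta> + real j * \<delta>"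
  have b: "{a<..<a + \<delta>} \<subseteq> b j" "b j \<subseteq> {a..a + \<delta>}"
    using bins j unfolding equal_bins_def a_def by (auto simp: algebra_simps)
  have D: "0 < \<Delta>" "0 < \<delta>" "real K * \<delta> = 2 * \<Delta>" using bins by (auto simp: equal_bins_def)
  have win: "E - \<Delta> \<le> a" "a + \<delta> \<le> E + \<Delta>"
  proof -
    show "E - \<Delta> \<le> a" using D by (simp add: a_def)
    have "real (Suc j) * \<delta> \<le> real K * \<delta>" using j D by (intro mult_right_mono) auto
    thus "a + \<delta> \<le> E + \<Delta>" using D by (simp add: a_def algebra_simps)
  qed
  \<comment> \<open>The slice keeps the distance \<open>\<delta>'\<close> from the end point of the
    bin, whose membership is left open by \<open>equal_bins\<close>. Its far side is therefore
    \<open>2 * \<delta>'\<close> away from the end with the smallest Gibbs weights, which gives the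
    factor 2 in the exponent.\<close>
  define x where "x = (if 0 \<le> \<beta> then a + \<delta> - 2 * \<delta>' else a + \<delta>')"
  have x: "a < x" "x + \<delta>' < a + \<delta>" using \<delta>' by (auto simp: x_def)
  have "p \<le> (\<Sum>m<n. if e m \<in> {x..<x + \<delta>'} then gibbs_weight n \<beta> e m else 0)"
  proof -
    have "?c * (x + \<delta>' - x) - 2 * berry_esseen_error \<beta> H \<le> (\<Sum>m<n. if e m \<in> {x..<x + \<delta>'} then gibbs_weight n \<beta> e m else 0)"
    proof (rule gibbs_interval_weight_ge[OF U H n \<sigma>])
      show "x \<le> x + \<delta>'" using \<delta>' by simp
      show "0 \<le> ?c" using \<sigma> by simp
      fix z assume "x < z" "z \<le> x + \<delta>'"
      \<comment> \<open>The slice lies in the window around \<open>E\<close>, and \<open>E\<close>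
        is within one standard deviation of the mean.\<close>
      hence "\<bar>z - ?\<mu>\<bar> \<le> \<Delta> + ?\<sigma>" using x win E by linarith
      thus "?c \<le> normal_density ?\<mu> ?\<sigma> z" by (rule normal_density_ge[OF \<sigma>])
    qed
    thus ?thesis using le by simp
  qed
  moreover have "{x..<x + \<delta>'} \<subseteq> b j" using b(1) x by fastforce
  moreover have "\<beta> * (u - v) \<le> 2 * \<bar>\<beta>\<bar> * \<delta>'" if "u \<in> b j" "v \<in> {x..<x + \<delta>'}" for u v
  proof -
    have u: "a \<le> u" "u \<le> a + \<delta>" using that(1) b(2) by auto
    show ?thesis
    proof (cases "0 \<le> \<beta>")
      case True
      have "u - v \<le> 2 * \<delta>'" using u that(2) True by (auto simp: x_def)
      hence "\<beta> * (u - v) \<le> \<beta> * (2 * \<delta>')" using True by (rule mult_left_mono)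
      thus ?thesis using True by (simp add: mult_ac)
    next
      case False
      have "v - u \<le> 2 * \<delta>'" using u that(2) False by (auto simp: x_def)
      hence "\<bar>\<beta>\<bar> * (v - u) \<le> \<bar>\<beta>\<bar> * (2 * \<delta>')" by (rule mult_left_mono) simp
      thus ?thesis using False by (simp add: algebra_simps)
    qed
  qed
  ultimately show "\<exists>I\<subseteq>b j. p \<le> (\<Sum>m<n. if e m \<in> I then gibbs_weight n \<beta> e m else 0) \<and>
      (\<forall>x\<in>b j. \<forall>y\<in>I. \<beta> * (x - y) \<le> 2 * \<bar>\<beta>\<bar> * \<delta>')" by blast
qed

subsection \<open>Rates\<close>

text \<open>A positive power of \<open>x\<close> outweighs any powers of \<open>ln x\<close>; in the
  application \<open>u\<close> is at most 0.\<close>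

lemma eventually_polylog_le:
  fixes A B a u v :: real
  assumes "0 < A" "0 < a"
  shows "eventually (\<lambda>x. 1 \<le> A * ln x powr u * x powr a - B * ln x powr v) at_top"
proof -
  have "((\<lambda>x. (1 + B * ln x powr v) / (ln x powr u * x powr a)) \<longlongrightarrow> 0) at_top"
    using assms by real_asymp
  hence "eventually (\<lambda>x. (1 + B * ln x powr v) / (ln x powr u * x powr a) < A) at_top"
    using assms(1) by (rule order_tendstoD)
  thus ?thesis using eventually_gt_at_top[of 1]
  proof eventually_elim
    case (elim x)
    have "0 < ln x powr u * x powr a" using elim by simp
    thus ?case using elim(1) by (simp add: field_simps)
  qed
qed

text \<open>The exponent is sublinear minus linear in \<open>y\<close>. This makes the factorisation
  error at most the square of \<open>t = y powr (- \<alpha> / 2)\<close>.\<close>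

lemma eventually_exp_le:
  fixes A \<alpha> \<xi> :: real
  assumes "0 < A" "0 < \<alpha>" "\<alpha> < 1" "0 < \<xi>"
  shows "eventually (\<lambda>y. exp (A * y powr (1 - \<alpha> / 2) - y / \<xi>) \<le> y powr (- \<alpha>)) at_top"
proof -
  have "((\<lambda>y. (A * y powr (1 - \<alpha> / 2) + \<alpha> * ln y) / y) \<longlongrightarrow> 0) at_top"
    using assms by real_asymp
  hence "eventually (\<lambda>y. (A * y powr (1 - \<alpha> / 2) + \<alpha> * ln y) / y < 1 / \<xi>) at_top"
    by (rule order_tendstoD) (use assms in simp)
  thus ?thesis using eventually_gt_at_top[of 0]
  proof eventually_elim
    case (elim y)
    hence "A * y powr (1 - \<alpha> / 2) - y / \<xi> \<le> - \<alpha> * ln y" by (simp add: field_simps)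
    hence "exp (A * y powr (1 - \<alpha> / 2) - y / \<xi>) \<le> exp (- \<alpha> * ln y)" by simp
    thus ?case using elim by (simp add: powr_def)
  qed
qed

text \<open>\<open>y\<close> is N^(1/(D+1)), the scale at which family size and separation have the
  same order. The constant \<open>6 ^ D\<close> comes from \<open>l + s \<le> 3 * y\<close> and
  \<open>L / 2 \<le> L - l + 1\<close>.\<close>

lemma local_distance_rate:
  fixes y c :: real
  assumes d: "1 \<le> d" and U: "unitary_mat (d ^ (L ^ D)) U"
    and w: "\<And>i. i < d ^ (L ^ D) \<Longrightarrow> 0 \<le> w i" "\<And>i. i < d ^ (L ^ D) \<Longrightarrow> w i \<le> lam * g i" "(\<Sum>i<d ^ (L ^ D). w i) = 1"
    and g: "\<And>i. i < d ^ (L ^ D) \<Longrightarrow> 0 \<le> g i" "(\<Sum>i<d ^ (L ^ D). g i) = 1"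
    and \<tau>: "\<tau> = real_spec_mat (d ^ (L ^ D)) U g"
    and \<omega>: "\<omega> = real_spec_mat (d ^ (L ^ D)) U w"
    and decay: "exp_decay_correlations d D L \<xi> \<tau>" and \<xi>: "0 < \<xi>"
    and D: "1 \<le> D" and y: "y ^ (D + 1) = real (L ^ D)" "2 ^ D \<le> y"
    and lam: "1 \<le> lam" "ln lam \<le> c * y powr (1 - \<alpha>)" and \<alpha>: "0 < \<alpha>"
    and l: "1 \<le> l" "l \<le> L" "real l \<le> y"
    and ex: "exp (2 ^ D * y powr (1 - \<alpha> / 2) - y / \<xi>) \<le> y powr (- \<alpha>)"
  shows "local_distance d D L l \<omega> \<tau> \<le> (2 * 6 ^ D * c + 4) * y powr (- \<alpha> / 2)"
proof -
  have "(1::real) \<le> 2 ^ D" by simp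
  hence y1: "1 \<le> y" using y(2) by linarith
  define t where "t = y powr (- \<alpha> / 2)"
  define s where "s = nat \<lceil>y\<rceil>"
  have t: "0 < t" "t \<le> 1" using y1 \<alpha> powr_mono[of "- \<alpha> / 2" 0 y] by (auto simp: t_def)
  have t2: "t * t = y powr (- \<alpha>)" using y1 by (simp add: t_def flip: powr_add)
  have s: "y \<le> real s" "real s \<le> 2 * y" "1 \<le> s" using y1 unfolding s_def by linarith+
  \<comment> \<open>Cubes of side \<open>y\<close> tile the lattice in about \<open>y\<close>
    copies, which is why a separated family has order \<open>y\<close> members.\<close>
  have ratio: "(real L / y) ^ D = y" using y(1) y1 by (simp add: power_divide field_simps)
  \<comment> \<open>The assumption \<open>2 ^ D \<le> y\<close> is used to get
    \<open>2 * y \<le> L\<close>, so that a cube takes up at most half of the side of the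
    lattice.\<close>
  have "(2::real) ^ D \<le> (real L / y) ^ D" using ratio y(2) by simp
  hence "2 \<le> real L / y" using D y1 by (subst (asm) power_mono_iff) auto
  hence Ly: "2 * y \<le> real L" using y1 by (simp add: field_simps)
  have L1: "real L / 2 \<le> real (L - l + 1)" using l Ly by (simp add: of_nat_diff)
  have "real (l + s) / real (L - l + 1) \<le> (3 * y) / (real L / 2)"
    using L1 l s y1 Ly by (intro frac_le) auto
  also have "\<dots> = 6 / (real L / y)" using y1 by simp
  finally have "(real (l + s) / real (L - l + 1)) ^ D \<le> (6 / (real L / y)) ^ D" by (rule power_mono) simp
  also have "\<dots> = 6 ^ D / y" unfolding power_divide[of 6] ratio ..
  finally have r1: "(real (l + s) / real (L - l + 1)) ^ D \<le> 6 ^ D / y" .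
  have "real (L div (l + s)) \<le> real L / real (l + s)" using real_of_int_div4[of "int L" "int (l + s)"] by (simp only: zdiv_int[symmetric] of_int_of_nat_eq)
  also have "\<dots> \<le> real L / y" using s(1) y1 by (intro divide_left_mono) auto
  finally have "real (L div (l + s) + 1) \<le> 2 * (real L / y)" using \<open>2 \<le> real L / y\<close> by simp
  hence "real (L div (l + s) + 1) ^ D \<le> (2 * (real L / y)) ^ D" by (rule power_mono) simp
  also have "\<dots> = 2 ^ D * y" unfolding power_mult_distrib ratio ..
  finally have M: "real ((L div (l + s) + 1) ^ D) \<le> 2 ^ D * y" by simp
  have "t * real ((L div (l + s) + 1) ^ D) \<le> t * (2 ^ D * y)" using M t by (intro mult_left_mono) auto
  also have "\<dots> = 2 ^ D * y powr (1 - \<alpha> / 2)"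
  proof -
    have "y powr (1 - \<alpha> / 2) = y * t" using y1 powr_add[of y 1 "- \<alpha> / 2"] by (simp add: t_def)
    thus ?thesis by simp
  qed
  finally have "t * real ((L div (l + s) + 1) ^ D) - s / \<xi> \<le> 2 ^ D * y powr (1 - \<alpha> / 2) - y / \<xi>"
    using s(1) \<xi> by (intro diff_mono divide_right_mono) auto
  hence "exp (t * real ((L div (l + s) + 1) ^ D) - s / \<xi>) \<le> exp (2 ^ D * y powr (1 - \<alpha> / 2) - y / \<xi>)" by simp
  also have "\<dots> \<le> t * t" using ex t2 by simp
  finally have "exp (t * real ((L div (l + s) + 1) ^ D) - s / \<xi>) / t \<le> t" using t by (simp add: field_simps)
  hence second: "2 * (t + exp (t * real ((L div (l + s) + 1) ^ D) - s / \<xi>) / t) \<le> 4 * t" by simp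
  have first: "(real (l + s) / real (L - l + 1)) ^ D * (2 * ln lam / t) \<le> 2 * 6 ^ D * c * t"
  proof -
    have "(real (l + s) / real (L - l + 1)) ^ D * (2 * ln lam / t) \<le> 6 ^ D / y * (2 * ln lam / t)"
      using r1 lam t by (intro mult_right_mono) (auto intro!: divide_nonneg_pos)
    also have "\<dots> \<le> 6 ^ D / y * (2 * (c * y powr (1 - \<alpha>)) / t)"
      using lam t y1 by (intro mult_left_mono divide_right_mono) auto
    \<comment> \<open>As \<open>t * t = y powr (- \<alpha>)\<close>, the division by
      \<open>y\<close> and by \<open>t\<close> leaves a single \<open>t\<close>.\<close>
    also have "y powr (1 - \<alpha>) = y * (t * t)" unfolding t2 using y1 powr_add[of y 1 "- \<alpha>"] by simp
    also have "6 ^ D / y * (2 * (c * (y * (t * t))) / t) = 2 * 6 ^ D * c * t" using t y1 by simp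
    finally show ?thesis .
  qed
  have "local_distance d D L l \<omega> \<tau> \<le> (real (l + s) / real (L - l + 1)) ^ D * (2 * ln lam / t) +
    2 * (t + exp (t * real ((L div (l + s) + 1) ^ D) - s / \<xi>) / t)"
    by (rule local_distance_bound[OF d U w g \<tau> \<omega> decay \<xi> lam(1) l(1,2) s(3) t])
  also have "\<dots> \<le> (2 * 6 ^ D * c + 4) * t" using first second by (simp add: algebra_simps)
  finally show ?thesis unfolding t_def .
qed

lemma gme_local_distance_le_2:
  assumes d: "1 \<le> d" and H: "H \<in> carrier_mat (d ^ (L ^ D)) (d ^ (L ^ D))" "hermitian_mat H"
    and q: "gme_weights H K b q"
  shows "local_distance d D L l (gme H K b q) (gibbs_state \<beta> H) \<le> 2"
proof -
  let ?n = "d ^ (L ^ D)"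
  have n: "0 < ?n" using d by simp
  obtain U e where U: "unitary_mat ?n U" and He: "H = real_spec_mat ?n U e"
    using spectral_theorem[OF H] by blast
  show ?thesis
    by (rule local_distance_le_2[OF d U gme_weight_nonneg[OF q] gme_weight_sum[OF U He q]
          less_imp_le[OF gibbs_weight_pos[OF n]] gibbs_weight_sum[OF n]
          gibbs_state_spec_mat[OF U He] gme_spec_mat[OF U He]])
qed

text \<open>\<open>p \<le> 1\<close> ensures that the domination factor
  \<open>exp (2 * \<bar>\<beta>\<bar> * \<delta>') / p\<close> is at least 1, so that its logarithm
  is nonnegative.\<close>

lemma gme_local_distance_rate:
  fixes y c :: real
  assumes d: "1 \<le> d" and H: "H \<in> carrier_mat (d ^ (L ^ D)) (d ^ (L ^ D))" "hermitian_mat H"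
    and q: "gme_weights H K b q"
    and decay: "exp_decay_correlations d D L \<xi> (gibbs_state \<beta> H)" and \<xi>: "0 < \<xi>"
    and \<sigma>: "0 < gibbs_sd \<beta> H"
    and bins: "equal_bins E \<Delta> \<delta> K b"
    and E: "\<bar>E - gibbs_energy \<beta> H\<bar> \<le> gibbs_sd \<beta> H"
    and \<delta>': "0 < \<delta>'" "3 * \<delta>' \<le> \<delta>" and p: "0 < p" "p \<le> 1"
    and le: "p \<le> exp (- (3 / 2)) * exp (\<Delta>\<^sup>2 / (gibbs_sd \<beta> H)\<^sup>2) powr (- (3 / 4)) /
        (sqrt (2 * pi) * gibbs_sd \<beta> H) * \<delta>'
        - 2 * berry_esseen_error \<beta> H"
    and D: "1 \<le> D" and y: "y ^ (D + 1) = real (L ^ D)" "2 ^ D \<le> y"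
    and lam: "2 * \<bar>\<beta>\<bar> * \<delta>' - ln p \<le> c * y powr (1 - \<alpha>)" and \<alpha>: "0 < \<alpha>"
    and l: "1 \<le> l" "l \<le> L" "real l \<le> y"
    and ex: "exp (2 ^ D * y powr (1 - \<alpha> / 2) - y / \<xi>) \<le> y powr (- \<alpha>)"
  shows "local_distance d D L l (gme H K b q) (gibbs_state \<beta> H)
    \<le> (2 * 6 ^ D * c + 4) * y powr (- \<alpha> / 2)"
proof -
  let ?n = "d ^ (L ^ D)"
  have n: "0 < ?n" using d by simp
  obtain U e where U: "unitary_mat ?n U" and He: "H = real_spec_mat ?n U e"
    using spectral_theorem[OF H] by blast
  let ?lam = "exp (2 * \<bar>\<beta>\<bar> * \<delta>') / p"
  have "1 \<le> exp (2 * \<bar>\<beta>\<bar> * \<delta>')" using \<delta>' by simp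
  hence "p \<le> exp (2 * \<bar>\<beta>\<bar> * \<delta>')" using p(2) by linarith
  hence lam1: "1 \<le> ?lam" using p(1) by (subst le_divide_eq_1_pos)
  have "ln ?lam = 2 * \<bar>\<beta>\<bar> * \<delta>' - ln p" using p by (simp add: ln_div)
  hence lam2: "ln ?lam \<le> c * y powr (1 - \<alpha>)" using lam by simp
  show ?thesis
    by (rule local_distance_rate[OF d U gme_weight_nonneg[OF q]
          gme_le_gibbs[OF U He n \<sigma> q bins E \<delta>' p(1) le] gme_weight_sum[OF U He q]
          less_imp_le[OF gibbs_weight_pos[OF n]] gibbs_weight_sum[OF n]
          gibbs_state_spec_mat[OF U He] gme_spec_mat[OF U He] decay \<xi> D y lam1 lam2 \<alpha> l ex])
qed

section \<open>Asymptotics along the sequence of lattices\<close>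

lemma soft_O_E:
  assumes "f \<in> soft_O N g" "filterlim (\<lambda>n. real (N n)) at_top sequentially" "\<And>n. 0 \<le> g n"
  obtains C r where "0 < C" "eventually (\<lambda>n. \<bar>f n\<bar> \<le> C * (ln (real (N n)) ^ r * g n)) sequentially"
proof -
  obtain r where "f \<in> O(\<lambda>n. ln (real (N n)) ^ r * g n)" using assms(1) by (auto simp: soft_O_def)
  then obtain C where C: "0 < C" "eventually (\<lambda>n. norm (f n) \<le> C * norm (ln (real (N n)) ^ r * g n)) sequentially"
    by (rule landau_o.bigE)
  have "eventually (\<lambda>n. 1 \<le> real (N n)) sequentially"
    using assms(2) unfolding filterlim_at_top by (rule spec)
  with C(2) have "eventually (\<lambda>n. \<bar>f n\<bar> \<le> C * (ln (real (N n)) ^ r * g n)) sequentially"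
  proof eventually_elim
    case (elim n)
    thus ?case using assms(3)[of n] by (simp add: abs_mult)
  qed
  thus ?thesis using that C(1) by blast
qed

text \<open>Bookkeeping of exponents: -3a/4 from the density, a - \<kappa> from the slice and -1/2
  from \<sigma> add up to a/4 - 1/2 - \<kappa>. The surplus a/4 is what the hypothesis
  \<open>big\<close> spends on the logarithms and on the Berry--Esseen error.\<close>

lemma weight_lower_bound:
  fixes x :: real
  assumes x: "1 < x" and c: "0 < c" and \<sigma>: "0 < \<sigma>" "\<sigma> \<le> c2 * sqrt x"
    and X: "0 < X" "X \<le> C * (ln x ^ r * x powr a)" and C: "0 < C"
    and \<zeta>: "\<zeta> \<le> C' * (ln x ^ r' * x powr (- 1 / 2 - \<kappa>))"
    and big: "1 \<le> (exp (- (3 / 2)) * C powr (- (3 / 4)) * c / (sqrt (2 * pi) * c2)) * ln x powr (- (3 / 4) * real r) * x powr (a / 4)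
       - 2 * C' * ln x powr (real r')"
  shows "x powr (- 1 / 2 - \<kappa>) \<le> exp (- (3 / 2)) * X powr (- (3 / 4)) / (sqrt (2 * pi) * \<sigma>) * (c * x powr (a - \<kappa>)) - 2 * \<zeta>"
proof -
  have lx: "0 < ln x" and sx: "0 < sqrt x" using x by auto
  have c2: "0 < c2" using \<sigma> sx by (metis less_le_trans zero_less_mult_pos2)
  let ?A = "exp (- (3 / 2)) * C powr (- (3 / 4)) * c / (sqrt (2 * pi) * c2)"
  have "(C * (ln x ^ r * x powr a)) powr (- (3 / 4)) \<le> X powr (- (3 / 4))"
    using X by (intro powr_mono2') auto
  also have "(C * (ln x ^ r * x powr a)) powr (- (3 / 4)) = C powr (- (3 / 4)) * ln x powr (- (3 / 4) * real r) * x powr (- (3 / 4) * a)"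
    using C lx x by (simp add: powr_mult powr_powr mult_ac flip: powr_realpow)
  finally have Xp: "C powr (- (3 / 4)) * ln x powr (- (3 / 4) * real r) * x powr (- (3 / 4) * a) \<le> X powr (- (3 / 4))" .
  have "x powr (- 1 / 2 - \<kappa>) * (?A * ln x powr (- (3 / 4) * real r) * x powr (a / 4)) =
      exp (- (3 / 2)) * (C powr (- (3 / 4)) * ln x powr (- (3 / 4) * real r) * x powr (- (3 / 4) * a)) /
        (sqrt (2 * pi) * (c2 * sqrt x)) * (c * x powr (a - \<kappa>))"
  proof -
    have "x powr (- 1 / 2 - \<kappa>) * x powr (a / 4) = x powr (- (3 / 4) * a) * x powr (a - \<kappa>) * x powr (- 1 / 2)"
      by (simp add: algebra_simps flip: powr_add)
    also have "x powr (- 1 / 2) = 1 / sqrt x" using x by (simp add: powr_minus_divide powr_half_sqrt)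
    finally have e: "x powr (- 1 / 2 - \<kappa>) * x powr (a / 4) = x powr (- (3 / 4) * a) * x powr (a - \<kappa>) / sqrt x" by simp
    have "x powr (- 1 / 2 - \<kappa>) * (?A * ln x powr (- (3 / 4) * real r) * x powr (a / 4)) =
      ?A * ln x powr (- (3 / 4) * real r) * (x powr (- 1 / 2 - \<kappa>) * x powr (a / 4))" by (simp only: mult_ac)
    thus ?thesis unfolding e by (simp add: mult_ac)
  qed
  also have "\<dots> \<le> exp (- (3 / 2)) * X powr (- (3 / 4)) / (sqrt (2 * pi) * \<sigma>) * (c * x powr (a - \<kappa>))"
    using Xp \<sigma> c c2 sx by (intro mult_right_mono frac_le mult_left_mono) auto
  finally have 1: "x powr (- 1 / 2 - \<kappa>) * (?A * ln x powr (- (3 / 4) * real r) * x powr (a / 4)) \<le>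
    exp (- (3 / 2)) * X powr (- (3 / 4)) / (sqrt (2 * pi) * \<sigma>) * (c * x powr (a - \<kappa>))" .
  have 2: "2 * \<zeta> \<le> x powr (- 1 / 2 - \<kappa>) * (2 * C' * ln x powr (real r'))"
    using \<zeta> lx by (simp add: powr_realpow mult_ac)
  have "x powr (- 1 / 2 - \<kappa>) * 1 \<le> x powr (- 1 / 2 - \<kappa>) *
      (?A * ln x powr (- (3 / 4) * real r) * x powr (a / 4) - 2 * C' * ln x powr (real r'))"
    by (rule mult_left_mono[OF big]) simp
  thus ?thesis using 1 2 by (simp add: right_diff_distrib)
qed

text \<open>The slice weight is bounded below by p = N^(-1/2-\<kappa>), and the slice width is of
  order N^(a-\<kappa>). Then ln lam = O(N^a): the width contributes at most this order since
  \<kappa> is nonnegative, and -ln p is only logarithmic.\<close>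

lemma gme_gibbs_local_distance:
  fixes D d k :: nat and \<beta> \<kappa> \<alpha> :: real
    and L :: "nat \<Rightarrow> nat" and h :: "nat \<Rightarrow> nat \<Rightarrow> complex mat"
    and E \<Delta> \<delta> :: "nat \<Rightarrow> real" and K :: "nat \<Rightarrow> nat" and b :: "nat \<Rightarrow> nat \<Rightarrow> real set" and q :: "nat \<Rightarrow> nat \<Rightarrow> real"
  defines "N \<equiv> \<lambda>n. L n ^ D"
  defines "H \<equiv> \<lambda>n. hamiltonian d (N n) (h n)"
  defines "\<sigma> \<equiv> \<lambda>n. gibbs_sd \<beta> (H n)"
  assumes D: "1 \<le> D" and d: "1 \<le> d" and \<kappa>: "0 \<le> \<kappa>" and \<alpha>: "0 < \<alpha>" "\<alpha> < 1"
    and Lt: "filterlim L at_top sequentially"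
    and h: "\<And>n. local_terms d D (L n) k (h n)"
    and \<xi>: "0 < \<xi>" and decay: "\<And>n. exp_decay_correlations d D (L n) \<xi> (gibbs_state \<beta> (H n))"
    and be: "(\<lambda>n. berry_esseen_error \<beta> (H n)) \<in> soft_O N (\<lambda>n. real (N n) powr (- 1 / 2 - \<kappa>))"
    and bins: "\<And>n. equal_bins (E n) (\<Delta> n) (\<delta> n) (K n) (b n)"
    and q: "\<And>n. gme_weights (H n) (K n) (b n) (q n)"
    and X: "(\<lambda>n. exp ((\<Delta> n)\<^sup>2 / (\<sigma> n)\<^sup>2)) \<in> soft_O N (\<lambda>n. real (N n) powr ((1 - \<alpha>) / real (D + 1)))"
    and \<delta>: "\<delta> \<in> \<Omega>(\<lambda>n. real (N n) powr ((1 - \<alpha>) / real (D + 1) - \<kappa>))"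
    and \<delta>\<sigma>: "\<And>n. \<delta> n \<le> \<sigma> n"
    and E: "\<And>n. \<bar>E n - gibbs_energy \<beta> (H n)\<bar> \<le> \<sigma> n"
  shows "\<exists>C>0. eventually (\<lambda>n. \<forall>l. 1 \<le> l \<and> l \<le> L n \<and> real (l ^ D) \<le> real (N n) powr (1 / real (D + 1)) \<longrightarrow>
      local_distance d D (L n) l (gme (H n) (K n) (b n) (q n)) (gibbs_state \<beta> (H n))
        \<le> C * real (N n) powr (- \<alpha> / (2 * real (D + 1)))) sequentially"
proof -
  define a where "a = (1 - \<alpha>) / real (D + 1)"
  have a: "0 < a" using \<alpha> by (simp add: a_def)
  have \<delta>0: "0 < \<delta> n" for n using bins[of n] by (simp add: equal_bins_def)
  have Hh: "H n \<in> carrier_mat (d ^ (L n ^ D)) (d ^ (L n ^ D))" "hermitian_mat (H n)" for n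
    using hamiltonian_hermitian[OF h] by (simp_all add: H_def N_def)
  \<comment> \<open>Bins have positive width, so \<open>\<delta> n \<le> \<sigma> n\<close> yields
    positivity for every \<open>n\<close>.\<close>
  have \<sigma>0: "0 < \<sigma> n" for n using \<delta>0[of n] \<delta>\<sigma>[of n] by linarith
  have Nt: "filterlim (\<lambda>n. real (N n)) at_top sequentially"
  proof (rule filterlim_at_top_mono)
    show "filterlim (\<lambda>n. real (L n)) at_top sequentially"
      by (rule filterlim_compose[OF filterlim_real_sequentially Lt])
    show "eventually (\<lambda>n. real (L n) \<le> real (N n)) sequentially"
      using Lt[unfolded filterlim_at_top, rule_format, of 1]
    proof eventually_elim
      case (elim n)
      thus ?case using self_le_power[of "L n" D] D by (simp add: N_def)
    qed
  qed
  define c0 where "c0 = exp (2 * k / \<xi>) * (2 / (1 - exp (- 1 / \<xi>))) ^ D"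
  have c0: "0 < c0" using \<xi> by (simp add: c0_def)
  have \<sigma>le: "\<sigma> n \<le> sqrt c0 * sqrt (real (N n))" if "1 \<le> L n" for n
  proof -
    have "(\<sigma> n)\<^sup>2 \<le> real (N n) * c0"
      using gibbs_variance_le[OF d that h \<xi>, of \<beta>] decay[of n] unfolding \<sigma>_def H_def N_def c0_def by simp
    hence "\<sigma> n \<le> sqrt (real (N n) * c0)" using \<sigma>0[of n] by (intro real_le_rsqrt)
    thus ?thesis by (simp add: real_sqrt_mult mult.commute)
  qed
  obtain C r where C: "0 < C" "eventually (\<lambda>n. \<bar>exp ((\<Delta> n)\<^sup>2 / (\<sigma> n)\<^sup>2)\<bar> \<le> C * (ln (real (N n)) ^ r * real (N n) powr a)) sequentially"
    using soft_O_E[OF X[folded a_def] Nt] by auto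
  obtain C' r' where C': "0 < C'" "eventually (\<lambda>n. \<bar>berry_esseen_error \<beta> (H n)\<bar> \<le> C' * (ln (real (N n)) ^ r' * real (N n) powr (- 1 / 2 - \<kappa>))) sequentially"
    using soft_O_E[OF be Nt] by auto
  obtain c where c: "0 < c" "eventually (\<lambda>n. c * norm (real (N n) powr (a - \<kappa>)) \<le> norm (\<delta> n)) sequentially"
    using landau_omega.bigE[OF \<delta>[folded a_def]] by blast
  let ?A = "exp (- (3 / 2)) * C powr (- (3 / 4)) * (c / 3) / (sqrt (2 * pi) * sqrt c0)"
  have A: "0 < ?A" using C(1) c(1) c0 by simp
  \<comment> \<open>The second summand accounts for -ln p = (1/2 + \<kappa>) ln N, through ln N
    \<le> N^a / a.\<close>
  define c4 where "c4 = 2 * \<bar>\<beta>\<bar> * (c / 3) + (1 / 2 + \<kappa>) / a"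
  have c4: "0 \<le> c4" using c(1) \<kappa> a by (simp add: c4_def)
  define y where "y n = real (N n) powr (1 / real (D + 1))" for n
  have yt: "filterlim y at_top sequentially"
  proof -
    have "filterlim (\<lambda>x::real. x powr (1 / real (D + 1))) at_top at_top" by real_asymp
    from filterlim_compose[OF this Nt] show ?thesis by (simp add: y_def[abs_def])
  qed
  have e1: "eventually (\<lambda>n. 1 \<le> ?A * ln (real (N n)) powr (- (3 / 4) * real r) * real (N n) powr (a / 4)
       - 2 * C' * ln (real (N n)) powr (real r')) sequentially"
    using filterlim_compose[OF _ Nt] eventually_polylog_le[OF A, of "a / 4" "- (3 / 4) * real r" "2 * C'" "real r'"] a
    by (intro eventually_compose_filterlim[OF _ Nt]) auto
  have e2: "eventually (\<lambda>n. exp (2 ^ D * y n powr (1 - \<alpha> / 2) - y n / \<xi>) \<le> y n powr (- \<alpha>)) sequentially"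
    using \<alpha> \<xi> by (intro eventually_compose_filterlim[OF _ yt] eventually_exp_le) auto
  have e3: "eventually (\<lambda>n. 2 ^ D \<le> y n) sequentially" using yt by (simp add: filterlim_at_top)
  have e4: "eventually (\<lambda>n. 2 \<le> real (N n)) sequentially" using Nt unfolding filterlim_at_top by (rule spec)
  have e5: "eventually (\<lambda>n. 1 \<le> L n) sequentially" using Lt by (simp add: filterlim_at_top)
  have "eventually (\<lambda>n. \<forall>l. 1 \<le> l \<and> l \<le> L n \<and> real (l ^ D) \<le> real (N n) powr (1 / real (D + 1)) \<longrightarrow>
      local_distance d D (L n) l (gme (H n) (K n) (b n) (q n)) (gibbs_state \<beta> (H n))
        \<le> (2 * 6 ^ D * c4 + 4) * real (N n) powr (- \<alpha> / (2 * real (D + 1)))) sequentially"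
    using e1 e2 e3 e4 e5 C(2) C'(2) c(2)
  proof eventually_elim
    case (elim n)
    let ?x = "real (N n)"
    \<comment> \<open>A third of the assured bin width: room for the slice and for a gap of at least
      its own width on either side.\<close>
    let ?p = "?x powr (- 1 / 2 - \<kappa>)" and ?\<delta>' = "c / 3 * ?x powr (a - \<kappa>)"
    have x: "1 < ?x" "1 \<le> ?x" using elim(4) by auto
    have y: "y n ^ (D + 1) = real (L n ^ D)"
    proof -
      have "0 < y n" using x by (simp add: y_def)
      hence "y n ^ (D + 1) = y n powr real (D + 1)" by (rule powr_realpow[symmetric])
      also have "\<dots> = ?x powr (1 / real (D + 1) * real (D + 1))" unfolding y_def by (rule powr_powr)
      finally show ?thesis using x by (simp add: N_def)
    qed
    have ya: "y n powr (1 - \<alpha>) = ?x powr a" by (simp add: y_def powr_powr a_def)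
    have y\<alpha>: "y n powr (- \<alpha> / 2) = ?x powr (- \<alpha> / (2 * real (D + 1)))" by (simp add: y_def powr_powr mult.commute)
    have \<delta>': "0 < ?\<delta>'" "3 * ?\<delta>' \<le> \<delta> n" using c(1) x elim(8) \<delta>0[of n] by auto
    have p: "0 < ?p" "?p \<le> 1" using x \<kappa> powr_mono[of "- 1 / 2 - \<kappa>" 0 ?x] by auto
    have le: "?p \<le> exp (- (3 / 2)) * exp ((\<Delta> n)\<^sup>2 / (\<sigma> n)\<^sup>2) powr (- (3 / 4)) / (sqrt (2 * pi) * \<sigma> n) * ?\<delta>'
        - 2 * berry_esseen_error \<beta> (H n)"
      using elim(1,6,7) c(1) C(1) by (intro weight_lower_bound[OF x(1) _ \<sigma>0 \<sigma>le[OF elim(5)]]) auto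
    have "2 * \<bar>\<beta>\<bar> * ?\<delta>' - ln ?p = 2 * \<bar>\<beta>\<bar> * (c / 3) * ?x powr (a - \<kappa>) + (1 / 2 + \<kappa>) * ln ?x"
      using x by (simp add: ln_powr algebra_simps)
    also have "\<dots> \<le> 2 * \<bar>\<beta>\<bar> * (c / 3) * ?x powr a + (1 / 2 + \<kappa>) * (?x powr a / a)"
      using x a \<kappa> c(1) by (intro add_mono mult_left_mono powr_mono ln_powr_bound) auto
    also have "\<dots> = c4 * y n powr (1 - \<alpha>)" unfolding ya c4_def by (simp add: algebra_simps)
    finally have lam: "2 * \<bar>\<beta>\<bar> * ?\<delta>' - ln ?p \<le> c4 * y n powr (1 - \<alpha>)" .
    show ?case
    proof (intro allI impI)
      fix l assume l: "1 \<le> l \<and> l \<le> L n \<and> real (l ^ D) \<le> ?x powr (1 / real (D + 1))"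
      \<comment> \<open>Since \<open>D\<close> is positive the bound on the volume of the cube also
        bounds its side.\<close>
      have "real l \<le> real (l ^ D)" using l D self_le_power[of l D] by (simp only: of_nat_le_iff)
      hence ly: "real l \<le> y n" using l unfolding y_def by linarith
      show "local_distance d D (L n) l (gme (H n) (K n) (b n) (q n)) (gibbs_state \<beta> (H n))
        \<le> (2 * 6 ^ D * c4 + 4) * ?x powr (- \<alpha> / (2 * real (D + 1)))"
        unfolding y\<alpha>[symmetric]
        using l ly elim(2,3) \<alpha> lam
        by (intro gme_local_distance_rate[OF d Hh q decay \<xi> \<sigma>0[unfolded \<sigma>_def] bins E[unfolded \<sigma>_def]
              \<delta>' p le[unfolded \<sigma>_def] D y]) simp_all
    qed
  qed
  moreover have "0 < 2 * 6 ^ D * c4 + 4" using c4 by (intro add_nonneg_pos) auto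
  ultimately show ?thesis by blast
qed

text \<open>The choice \<gamma>2 = 1/(2(D+1)) is the exponent of y^(-\<alpha>/2) in terms of N. The
  rate holds for volumes up to N^(1/(D+1)), so the threshold lowered with \<gamma>1 = 1 and C1 = 1
  stays within its range.\<close>

theorem theorem1:
  fixes D :: nat
  assumes "1 \<le> D"
  shows "\<exists>\<gamma>1 > (0::real). \<exists>\<gamma>2 > (0::real).
    \<forall>(d::nat) (k::nat) (\<beta>::real) (\<kappa>::real) (\<alpha>::real)
      (L :: nat \<Rightarrow> nat) (h :: nat \<Rightarrow> nat \<Rightarrow> complex mat)
      (E :: nat \<Rightarrow> real) (\<Delta> :: nat \<Rightarrow> real) (\<delta> :: nat \<Rightarrow> real)
      (K :: nat \<Rightarrow> nat) (b :: nat \<Rightarrow> nat \<Rightarrow> real set) (q :: nat \<Rightarrow> nat \<Rightarrow> real).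
    let N = (\<lambda>n. L n ^ D);
        H = (\<lambda>n. hamiltonian d (N n) (h n));
        \<sigma> = (\<lambda>n. gibbs_sd \<beta> (H n))
    in
      1 \<le> d \<and> 0 \<le> \<kappa> \<and> 0 \<le> \<alpha> \<and> \<alpha> < 1 \<and>
      (\<forall>n. 1 \<le> L n) \<and> filterlim L at_top sequentially \<and>
      (\<forall>n. local_terms d D (L n) k (h n)) \<and>
      (\<forall>n. nondegenerate (H n)) \<and>
      (\<exists>\<xi>>0. \<forall>n. exp_decay_correlations d D (L n) \<xi> (gibbs_state \<beta> (H n))) \<and>
      \<sigma> \<in> \<Omega>(\<lambda>n. sqrt (real (N n))) \<and>
      (\<lambda>n. berry_esseen_error \<beta> (H n)) \<in> soft_O N (\<lambda>n. real (N n) powr (- 1 / 2 - \<kappa>)) \<and>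
      (\<forall>n. equal_bins (E n) (\<Delta> n) (\<delta> n) (K n) (b n)) \<and>
      (\<forall>n. gme_weights (H n) (K n) (b n) (q n)) \<and>
      (\<lambda>n. exp ((\<Delta> n)\<^sup>2 / (\<sigma> n)\<^sup>2)) \<in> soft_O N (\<lambda>n. real (N n) powr ((1 - \<alpha>) / real (D + 1))) \<and>
      \<delta> \<in> \<Omega>(\<lambda>n. real (N n) powr ((1 - \<alpha>) / real (D + 1) - \<kappa>)) \<and>
      (\<forall>n. \<delta> n \<le> \<sigma> n) \<and>
      (\<forall>n. \<bar>E n - gibbs_energy \<beta> (H n)\<bar> \<le> \<sigma> n)
    \<longrightarrow>
      (\<exists>C1 > (0::real). \<exists>C2 > (0::real). \<forall>n l.
         1 \<le> l \<and> l \<le> L n \<and>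
         real (l ^ D) \<le> C1 * real (N n) powr (1 / real (D + 1) - \<gamma>1 * \<alpha>)
         \<longrightarrow> local_distance d D (L n) l (gme (H n) (K n) (b n) (q n)) (gibbs_state \<beta> (H n))
               \<le> C2 * real (N n) powr (- \<gamma>2 * \<alpha>))"
proof (rule exI[where x = "1 :: real"], rule conjI, simp, rule exI[where x = "1 / (2 * real (D + 1))"], rule conjI, simp, intro allI, unfold Let_def, intro impI, elim conjE exE)
  fix d k :: nat and \<beta> \<kappa> \<alpha> :: real and L :: "nat \<Rightarrow> nat" and h :: "nat \<Rightarrow> nat \<Rightarrow> complex mat"
    and E \<Delta> \<delta> :: "nat \<Rightarrow> real" and K :: "nat \<Rightarrow> nat" and b :: "nat \<Rightarrow> nat \<Rightarrow> real set"
    and q :: "nat \<Rightarrow> nat \<Rightarrow> real"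
  let ?N = "\<lambda>n. L n ^ D"
  let ?H = "\<lambda>n. hamiltonian d (?N n) (h n)"
  let ?\<sigma> = "\<lambda>n. gibbs_sd \<beta> (?H n)"
  let ?dist = "\<lambda>n l. local_distance d D (L n) l (gme (?H n) (K n) (b n) (q n)) (gibbs_state \<beta> (?H n))"
  let ?\<gamma> = "1 / (2 * real (D + 1))"
  fix \<xi> :: real
  assume d: "1 \<le> d" and \<kappa>: "0 \<le> \<kappa>" and \<alpha>: "0 \<le> \<alpha>" "\<alpha> < 1" and L: "\<forall>n. 1 \<le> L n"
    and Lt: "filterlim L at_top sequentially" and h: "\<forall>n. local_terms d D (L n) k (h n)"
    and \<xi>: "0 < \<xi>" and decay: "\<forall>n. exp_decay_correlations d D (L n) \<xi> (gibbs_state \<beta> (?H n))"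
    and be: "(\<lambda>n. berry_esseen_error \<beta> (?H n)) \<in> soft_O ?N (\<lambda>n. real (?N n) powr (- 1 / 2 - \<kappa>))"
    and bins: "\<forall>n. equal_bins (E n) (\<Delta> n) (\<delta> n) (K n) (b n)"
    and q: "\<forall>n. gme_weights (?H n) (K n) (b n) (q n)"
    and X: "(\<lambda>n. exp ((\<Delta> n)\<^sup>2 / (?\<sigma> n)\<^sup>2)) \<in> soft_O ?N (\<lambda>n. real (?N n) powr ((1 - \<alpha>) / real (D + 1)))"
    and \<delta>: "\<delta> \<in> \<Omega>(\<lambda>n. real (?N n) powr ((1 - \<alpha>) / real (D + 1) - \<kappa>))"
    and \<delta>\<sigma>: "\<forall>n. \<delta> n \<le> ?\<sigma> n"
    and E: "\<forall>n. \<bar>E n - gibbs_energy \<beta> (?H n)\<bar> \<le> ?\<sigma> n"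
  have N1: "1 \<le> real (?N n)" for n using spec[OF L, of n] by simp
  have two: "?dist n l \<le> 2" for n l
    by (rule gme_local_distance_le_2[OF d hamiltonian_hermitian[OF spec[OF h]] spec[OF q]])
  have "\<exists>C2>0. \<forall>n l. 1 \<le> l \<and> l \<le> L n \<and> real (l ^ D) \<le> real (?N n) powr (1 / real (D + 1) - \<alpha>)
      \<longrightarrow> ?dist n l \<le> C2 * real (?N n) powr (- ?\<gamma> * \<alpha>)"
  \<comment> \<open>At \<alpha> = 0 the claimed rate is a constant, which the trivial bound 2
    meets.\<close>
  proof (cases "\<alpha> = 0")
    case True
    have "real (?N n) powr 0 = 1" for n using spec[OF L, of n] by simp
    thus ?thesis using two True by (intro exI[of _ 2]) simp
  next
    case False
    hence \<alpha>0: "0 < \<alpha>" using \<alpha> by simp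
    obtain C where C: "0 < C" "eventually (\<lambda>n. \<forall>l. 1 \<le> l \<and> l \<le> L n \<and>
        real (l ^ D) \<le> real (?N n) powr (1 / real (D + 1)) \<longrightarrow>
        ?dist n l \<le> C * real (?N n) powr (- \<alpha> / (2 * real (D + 1)))) sequentially"
      using gme_gibbs_local_distance[OF assms d \<kappa> \<alpha>0 \<alpha>(2) Lt spec[OF h] \<xi> spec[OF decay] be
          spec[OF bins] spec[OF q] X \<delta> spec[OF \<delta>\<sigma>] spec[OF E]] by blast
    have exponent: "- \<alpha> / (2 * real (D + 1)) = - ?\<gamma> * \<alpha>" by simp
    obtain m where m: "\<And>n l. m \<le> n \<Longrightarrow> 1 \<le> l \<Longrightarrow> l \<le> L n \<Longrightarrow>
        real (l ^ D) \<le> real (?N n) powr (1 / real (D + 1)) \<Longrightarrow> ?dist n l \<le> C * real (?N n) powr (- ?\<gamma> * \<alpha>)"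
      using C(2) unfolding exponent eventually_sequentially by blast
    \<comment> \<open>For each of the finitely many early \<open>n\<close> one summand is added that
      lets the trivial bound 2 imply the rate there.\<close>
    let ?C = "C + (\<Sum>n<m. 2 * real (?N n) powr (?\<gamma> * \<alpha>))"
    have s0: "0 \<le> (\<Sum>n<m. 2 * real (?N n) powr (?\<gamma> * \<alpha>))" by (intro sum_nonneg) simp
    show ?thesis
    proof (intro exI[of _ ?C] conjI allI impI)
      show "0 < ?C" using C(1) s0 by simp
      fix n l assume l: "1 \<le> l \<and> l \<le> L n \<and> real (l ^ D) \<le> real (?N n) powr (1 / real (D + 1) - \<alpha>)"
      show "?dist n l \<le> ?C * real (?N n) powr (- ?\<gamma> * \<alpha>)"
      proof (cases "m \<le> n")
        case True
        have "real (?N n) powr (1 / real (D + 1) - \<alpha>) \<le> real (?N n) powr (1 / real (D + 1))"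
          using N1 \<alpha> by (intro powr_mono) auto
        hence "?dist n l \<le> C * real (?N n) powr (- ?\<gamma> * \<alpha>)" using l by (intro m[OF True]) auto
        also have "\<dots> \<le> ?C * real (?N n) powr (- ?\<gamma> * \<alpha>)" using s0 by (intro mult_right_mono) auto
        finally show ?thesis .
      next
        case False
        have "2 = 2 * real (?N n) powr (?\<gamma> * \<alpha>) * real (?N n) powr (- ?\<gamma> * \<alpha>)"
          using spec[OF L, of n] by (simp flip: powr_add)
        also have "\<dots> \<le> ?C * real (?N n) powr (- ?\<gamma> * \<alpha>)"
        proof (rule mult_right_mono)
          have "2 * real (?N n) powr (?\<gamma> * \<alpha>) \<le> (\<Sum>n<m. 2 * real (?N n) powr (?\<gamma> * \<alpha>))"
            using False by (intro member_le_sum[of n]) auto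
          thus "2 * real (?N n) powr (?\<gamma> * \<alpha>) \<le> ?C" using C(1) by linarith
        qed simp
        finally show ?thesis using two[of n l] by linarith
      qed
    qed
  qed
  thus "\<exists>C1>0. \<exists>C2>0. \<forall>n l. 1 \<le> l \<and> l \<le> L n \<and>
      real (l ^ D) \<le> C1 * real (?N n) powr (1 / real (D + 1) - 1 * \<alpha>) \<longrightarrow>
      ?dist n l \<le> C2 * real (?N n) powr (- ?\<gamma> * \<alpha>)"
    by (intro exI[of _ "1 :: real"]) simp
qed

end
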